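(* Let $n\ge3$, let $\Lambda=\Lambda(\vec a,\vec b)$ be an admissible weight, and put $\eta=\sum_{i=0}^{n-1}a_i\omega_i$, $\xi=\sum_{i=0}^{n-1}b_i\omega_i$. Let $$P_\Lambda(q)=q^{-(\Lambda,\rho)}\sum_{\underline d}q^{\sum_{i=1}^nd_i(\underline d)},$$ the sum being over all affine Gelfand--Tsetlin patterns $\underline d$ permitted with respect to $\Lambda$. Then $$P_\Lambda(q)=\frac{q^{-(\Lambda,\rho)}}{(q)_\infty^n}\sum_{w\in\widehat W}(-1)^{l(w)}q^{(\xi+\rho-w(\xi+\rho),\,\eta+\rho)},\qquad (q)_\infty=\prod_{m=1}^\infty(1-q^m).$$
   Context: **Root data.** $\mathfrak h^*=\{\sum_{i=1}^nc_i\epsilon_i:\sum c_i=0\}$ with $(\epsilon_i,\epsilon_j)=\delta_{ij}$; $\widetilde{\mathfrak h}^*=\mathfrak h^*\oplus\mathbb C\delta\oplus\mathbb C\omega_0$ with $(\delta,\omega_0)=1$, $(\delta,\delta)=(\omega_0,\omega_0)=0$, $\delta,\omega_0\perp\mathfrak h^*$. $\alpha_i=\epsilon_i-\epsilon_{i+1}$ ($1\le i\le n-1$), $\alpha_0=\delta+\epsilon_n-\epsilon_1$, $\alpha_{i+n}=\alpha_i$. $\omega_0,\dots,\omega_{n-1}$: $(\omega_i,\alpha_j)=\delta_{ij}$ ($0\le j\le n-1$), $(\omega_i,\omega_0)=0$; $\rho=\sum_{i=0}^{n-1}\omega_i$. With $\Phi=\{\epsilon_i-\epsilon_j:i\ne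 j\}$: $\widehat\Phi=\{\alpha+m\delta:\alpha\in\Phi,m\in\mathbb Z\}\cup\{m\delta:m\ne0\}$; $\widehat\Phi_+$ consists of $\alpha+m\delta$ ($\alpha\in\Phi$, $m>0$), $\epsilon_i-\epsilon_j$ ($i<j$), $m\delta$ ($m>0$). For integers $l<r$, $\alpha_{l,r}=\sum_{s=l}^{r-1}\alpha_s$. $\widehat W$ is the affine Weyl group generated by the reflections in $\alpha_0,\dots,\alpha_{n-1}$ acting on $\widetilde{\mathfrak h}^*$, $l$ its length function. $W\cong\mathfrak S_n$ is the finite Weyl group, $P=\operatorname{Span}_{\mathbb Z}\{\omega_i-\omega_0\}_{i=1}^{n-1}$ acts by $t_V(v)=v-(v,V)\delta$ for $v\in\mathfrak h^*\oplus\mathbb C\delta$, $t_V(\omega_0)=\omega_0+V-\frac{(V,V)}2\delta$; $\widehat W^e=W\ltimes P$. **Admissible weights.** $\Lambda\in\omega_0^\perp=\operatorname{Span}_{\mathbb C}(\omega_0,\dots,\omega_{n-1})$; $k=(\Lambda,\delta)$, $\kappa=k+n$. $\Lambda$ is dominant if $(\Lambda+\rho,\alpha)\notin\mathbb Z_{\le0}$ for all $\alpha\in\widehat\Phi_+$; a dominant $\Lambda$ is admissible if the $\mathbb Z$-span of $\{\beta\in\widehat\Phi:(\beta,\Lambda+\rho)\in\mathbb Z\}$ is a full-rank sublattice of $\operatorname{Span}_{\mathbb Z}\{\alpha_0,\dots,\alpha_{n-1}\}$. Then $\kappa=p/p'$ with $p,p'$ coprime positive integers and $p\ge n$. **Parametrization.**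 For $\vec b\in\mathbb Z_{\ge0}^n$, $(g_s(\vec b))_{s\in\mathbb Z}$ is the sequence with $g_0=0$ and $g_{s+1}-g_s=b_{s\bmod n}+1$. Let $\alpha_i'=\alpha_i$ for $1\le i\le n-1$ and $\alpha_0'=\alpha_0+(p'-1)\delta$. If $\sum b_i=p'n-n$ and $g_0,\dots,g_{n-1}$ are pairwise distinct modulo $n$, let $\gamma_{\vec g(\vec b)}\in\widehat W^e$ be the unique element with $\gamma_{\vec g(\vec b)}(\alpha_i')=\alpha_{g_i,g_{i+1}}$ for $0\le i\le n-1$. For such $\vec b$ and $\vec a\in\mathbb Z_{\ge0}^n$ with $\sum a_i=p-n$ put $$\Lambda(\vec a,\vec b)=\gamma_{\vec g(\vec b)}\Big(\sum_{i=0}^{n-1}a_i\omega_i-(p'-1)\kappa\,\omega_0+\rho\Big)-\rho-c\,\delta,$$ with $c\in\mathbb Q$ fixed by $\Lambda(\vec a,\vec b)\in\omega_0^\perp$. Every admissible weight with $\kappa=p/p'$ is $\Lambda(\vec a,\vec b)$ for a unique such pair. **Patterns.** An affine Gelfand--Tsetlin pattern is an array $\underline d=(d_{i,j})_{i\ge j,\ i,j\in\mathbb Z}$ of nonnegative integers with $d_{i,j}\ge d_{i+1,j}$, $d_{i+n,j+n}=d_{i,j}$, and for each $i$ only finitely many $d_{i,j}\ne0$; $d_i(\underline d)=\sum_{j\le i}d_{i,j}$. With $\mathtt y_l-\mathtt y_r=(\alpha_{l,r},\Lambda+\rho)$ for $l<r$, $\underline d$ is permitted with respect to $\Lambda$ if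 for all integers $l<r$ with $l\not\equiv r\pmod n$ and $\mathtt y_l-\mathtt y_r\in\mathbb Z$, and all $i\ge r-1$: $d_{i,l}\le d_{i+1,r}+\mathtt y_l-\mathtt y_r-1$. Here $q$ is a formal variable. *)

theory Defs
  imports
    "HOL-Analysis.Infinite_Products"
    "HOL-Computational_Algebra.Formal_Power_Series"
    "HOL-Library.Function_Algebras"
    "HOL-Library.Product_Plus"
    "HOL-Number_Theory.Cong"
begin

section \<open>The space and its bilinear form\<close>

text \<open>
  A triple \<open>(x, a, c)\<close> stands for \<open>\<Sum>i. x i \<epsilon>\<^sub>i + a \<delta> + c \<omega>\<^sub>0\<close>.  The type is larger than the space
  of the paper, which is the carrier \<open>htilde n\<close>.  The reflections and translations below are maps
  on the whole type.  They fix every triple \<open>(x, 0, 0)\<close> with \<open>x\<close> constant on \<open>{1..n}\<close>, and these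
  span a complement of \<open>htilde n\<close>, so such maps agree as soon as they agree on \<open>htilde n\<close>.
\<close>

type_synonym avec = "(nat \<Rightarrow> complex) \<times> complex \<times> complex"

definition htilde :: "nat \<Rightarrow> avec set" where
  "htilde n = {(x, a, c) | x a c. (\<forall>i. i \<notin> {1..n} \<longrightarrow> x i = 0) \<and> (\<Sum>i=1..n. x i) = 0}"

fun smul :: "complex \<Rightarrow> avec \<Rightarrow> avec" where
  "smul z (x, a, c) = ((\<lambda>i. z * x i), z * a, z * c)"

fun bform :: "nat \<Rightarrow> avec \<Rightarrow> avec \<Rightarrow> complex" where
  "bform n (x, a, c) (y, b, d) = (\<Sum>i=1..n. x i * y i) + a * d + c * b"

definition eps :: "nat \<Rightarrow> avec" where
  "eps i = ((\<lambda>j. if j = i then 1 else 0), 0, 0)"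

definition delta :: avec where
  "delta = (0, 1, 0)"

definition omega0 :: avec where
  "omega0 = (0, 0, 1)"

definition zsmul :: "int \<Rightarrow> avec \<Rightarrow> avec" where
  "zsmul m v = smul (of_int m) v"

interpretation zmod: module zsmul
  by unfold_locales (auto simp: zsmul_def fun_eq_iff algebra_simps)


section \<open>Roots and weights\<close>

definition alpha :: "nat \<Rightarrow> int \<Rightarrow> avec" where
  "alpha n i = (let r = nat (i mod int n) in
     if r = 0 then delta + eps n - eps 1 else eps r - eps (Suc r))"

definition alpha_seg :: "nat \<Rightarrow> int \<Rightarrow> int \<Rightarrow> avec" where
  "alpha_seg n l r = (\<Sum>s\<in>{l..<r}. alpha n s)"

definition omega :: "nat \<Rightarrow> nat \<Rightarrow> avec" where
  "omega n i = (THE v. v \<in> htilde n \<and>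
     (\<forall>j<n. bform n v (alpha n (int j)) = (if i = j then 1 else 0)) \<and> bform n v omega0 = 0)"

definition rho :: "nat \<Rightarrow> avec" where
  "rho n = (\<Sum>i<n. omega n i)"

definition fin_roots :: "nat \<Rightarrow> avec set" where
  "fin_roots n = {eps i - eps j | i j. i \<in> {1..n} \<and> j \<in> {1..n} \<and> i \<noteq> j}"

definition aff_roots :: "nat \<Rightarrow> avec set" where
  "aff_roots n = {\<alpha> + zsmul m delta | \<alpha> m. \<alpha> \<in> fin_roots n} \<union> {zsmul m delta | m. m \<noteq> 0}"

definition aff_pos_roots :: "nat \<Rightarrow> avec set" where
  "aff_pos_roots n = {\<alpha> + zsmul m delta | \<alpha> m. \<alpha> \<in> fin_roots n \<and> m > 0}
     \<union> {eps i - eps j | i j. 1 \<le> i \<and> i < j \<and> j \<le> n}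
     \<union> {zsmul m delta | m. m > 0}"


section \<open>Weyl groups\<close>

definition simple_refl :: "nat \<Rightarrow> nat \<Rightarrow> avec \<Rightarrow> avec" where
  "simple_refl n i v = v - smul (bform n v (alpha n (int i))) (alpha n (int i))"

definition refl_word :: "nat \<Rightarrow> nat list \<Rightarrow> avec \<Rightarrow> avec" where
  "refl_word n is = foldr (\<lambda>i w. simple_refl n i \<circ> w) is id"

text \<open>The generators are involutions, so the words in them form a group.\<close>

definition aff_weyl :: "nat \<Rightarrow> (avec \<Rightarrow> avec) set" where
  "aff_weyl n = {refl_word n is | is. set is \<subseteq> {0..<n}}"

definition weyl_length :: "nat \<Rightarrow> (avec \<Rightarrow> avec) \<Rightarrow> nat" where
  "weyl_length n w = (LEAST k. \<exists>is. length is = k \<and> set is \<subseteq> {0..<n} \<and> refl_word n is = w)"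

definition fin_weyl :: "nat \<Rightarrow> (avec \<Rightarrow> avec) set" where
  "fin_weyl n = {refl_word n is | is. set is \<subseteq> {1..<n}}"

definition weight_lattice :: "nat \<Rightarrow> avec set" where
  "weight_lattice n = zmod.span ((\<lambda>i. omega n i - omega0) ` {1..<n})"

text \<open>
  The linear extension of \<open>v \<mapsto> v - (v,V)\<delta>\<close> for \<open>v\<close> orthogonal to \<open>\<delta>\<close> and
  \<open>\<omega>\<^sub>0 \<mapsto> \<omega>\<^sub>0 + V - (V,V)/2 \<delta>\<close>; the coefficient of \<open>\<omega>\<^sub>0\<close> in \<open>v\<close> is \<open>(v,\<delta>)\<close>.
\<close>

definition transl :: "nat \<Rightarrow> avec \<Rightarrow> avec \<Rightarrow> avec" where
  "transl n V v = (let c = bform n v delta in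
     v + smul c V - smul (bform n v V + c * bform n V V / 2) delta)"

definition ext_weyl :: "nat \<Rightarrow> (avec \<Rightarrow> avec) set" where
  "ext_weyl n = {w \<circ> transl n V | w V. w \<in> fin_weyl n \<and> V \<in> weight_lattice n}"


section \<open>Admissible weights\<close>

definition root_lattice :: "nat \<Rightarrow> avec set" where
  "root_lattice n = zmod.span ((\<lambda>i. alpha n (int i)) ` {0..<n})"

definition lattice_rank :: "avec set \<Rightarrow> nat" where
  "lattice_rank L = (GREATEST r. \<exists>B. B \<subseteq> L \<and> finite B \<and> card B = r \<and> zmod.independent B)"

definition full_rank_sublattice :: "avec set \<Rightarrow> avec set \<Rightarrow> bool" where
  "full_rank_sublattice L Q \<longleftrightarrow> zmod.subspace L \<and> L \<subseteq> Q \<and> lattice_rank L = lattice_rank Q"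

definition dominant :: "nat \<Rightarrow> avec \<Rightarrow> bool" where
  "dominant n \<Lambda> \<longleftrightarrow> \<Lambda> \<in> htilde n \<and> bform n \<Lambda> omega0 = 0 \<and>
     (\<forall>\<alpha>\<in>aff_pos_roots n. \<not> (\<exists>m::int. m \<le> 0 \<and> bform n (\<Lambda> + rho n) \<alpha> = of_int m))"

definition admissible :: "nat \<Rightarrow> avec \<Rightarrow> bool" where
  "admissible n \<Lambda> \<longleftrightarrow> dominant n \<Lambda> \<and>
     full_rank_sublattice
       (zmod.span {\<beta> \<in> aff_roots n. bform n \<beta> (\<Lambda> + rho n) \<in> \<int>}) (root_lattice n)"


section \<open>The parametrization\<close>

text \<open>
  Tuples in \<open>\<int>\<^sub>\<ge>\<^sub>0\<^sup>n\<close> are functions on \<open>nat\<close> of which only the values at \<open>0, \<dots>, n - 1\<close> are used.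
  In \<open>gseq\<close> one of the two sums is empty.
\<close>

definition gseq :: "nat \<Rightarrow> (nat \<Rightarrow> nat) \<Rightarrow> int \<Rightarrow> int" where
  "gseq n b s = (\<Sum>t\<in>{0..<s}. int (b (nat (t mod int n))) + 1)
              - (\<Sum>t\<in>{s..<0}. int (b (nat (t mod int n))) + 1)"

definition alpha' :: "nat \<Rightarrow> nat \<Rightarrow> nat \<Rightarrow> avec" where
  "alpha' n p' i = (if i = 0 then alpha n 0 + zsmul (int p' - 1) delta else alpha n (int i))"

definition gamma :: "nat \<Rightarrow> nat \<Rightarrow> (nat \<Rightarrow> nat) \<Rightarrow> avec \<Rightarrow> avec" where
  "gamma n p' b = (THE \<gamma>. \<gamma> \<in> ext_weyl n \<and>
     (\<forall>i<n. \<gamma> (alpha' n p' i) = alpha_seg n (gseq n b (int i)) (gseq n b (int i + 1))))"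

text \<open>Validity of the pair of tuples, for \<open>\<kappa> = p/p'\<close>.\<close>

definition admissible_params ::
    "nat \<Rightarrow> nat \<Rightarrow> nat \<Rightarrow> (nat \<Rightarrow> nat) \<Rightarrow> (nat \<Rightarrow> nat) \<Rightarrow> bool" where
  "admissible_params n p p' a b \<longleftrightarrow>
     p > 0 \<and> p' > 0 \<and> coprime p p' \<and> p \<ge> n \<and>
     int (\<Sum>i<n. a i) = int p - int n \<and>
     int (\<Sum>i<n. b i) = int p' * int n - int n \<and>
     inj_on (\<lambda>s. gseq n b s mod int n) {0..<int n}"

text \<open>The vector \<open>v - (v,\<omega>\<^sub>0) \<delta>\<close> is the unique \<open>v - c \<delta>\<close> orthogonal to \<open>\<omega>\<^sub>0\<close>.\<close>

definition Lambda_ab ::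
    "nat \<Rightarrow> nat \<Rightarrow> nat \<Rightarrow> (nat \<Rightarrow> nat) \<Rightarrow> (nat \<Rightarrow> nat) \<Rightarrow> avec" where
  "Lambda_ab n p p' a b =
     (let \<kappa> = of_nat p / of_nat p';
          v = gamma n p' b ((\<Sum>i<n. smul (of_nat (a i)) (omega n i))
                - smul ((of_nat p' - 1) * \<kappa>) omega0 + rho n) - rho n
      in v - smul (bform n v omega0) delta)"


section \<open>Affine Gelfand--Tsetlin patterns\<close>

text \<open>
  The entries \<open>d i j\<close> with \<open>i < j\<close> are not part of the array; they are set to \<open>0\<close> so that an array
  is represented by exactly one function.
\<close>

definition agt_pattern :: "nat \<Rightarrow> (int \<Rightarrow> int \<Rightarrow> nat) \<Rightarrow> bool" where
  "agt_pattern n d \<longleftrightarrow>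
     (\<forall>i j. i < j \<longrightarrow> d i j = 0) \<and>
     (\<forall>i j. i \<ge> j \<longrightarrow> d i j \<ge> d (i + 1) j) \<and>
     (\<forall>i j. i \<ge> j \<longrightarrow> d (i + int n) (j + int n) = d i j) \<and>
     (\<forall>i. finite {j. j \<le> i \<and> d i j \<noteq> 0})"

definition row_sum :: "(int \<Rightarrow> int \<Rightarrow> nat) \<Rightarrow> int \<Rightarrow> nat" where
  "row_sum d i = (\<Sum>j\<in>{j. j \<le> i \<and> d i j \<noteq> 0}. d i j)"

definition permitted :: "nat \<Rightarrow> avec \<Rightarrow> (int \<Rightarrow> int \<Rightarrow> nat) \<Rightarrow> bool" where
  "permitted n \<Lambda> d \<longleftrightarrow>
     (\<forall>l r (y::int). l < r \<and> \<not> [l = r] (mod int n) \<and>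
        bform n (alpha_seg n l r) (\<Lambda> + rho n) = of_int y \<longrightarrow>
        (\<forall>i\<ge>r - 1. int (d i l) \<le> int (d (i + 1) r) + y - 1))"

definition permitted_patterns :: "nat \<Rightarrow> avec \<Rightarrow> (int \<Rightarrow> int \<Rightarrow> nat) set" where
  "permitted_patterns n \<Lambda> = {d. agt_pattern n d \<and> permitted n \<Lambda> d}"


section \<open>Formal series in \<open>q\<close> with complex exponents\<close>

text \<open>
  A series is its coefficient function.  The value of \<open>qsum\<close> at a family, and of \<open>qmult\<close> at a pair,
  is the intended series only if \<open>qsummable\<close>, respectively \<open>qmultipliable\<close>, holds: every
  coefficient is then a finite sum.
\<close>

type_synonym qseries = "complex \<Rightarrow> rat"

definition qpow :: "complex \<Rightarrow> qseries" where
  "qpow z = (\<lambda>x. if x = z then 1 else 0)"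

definition qscale :: "rat \<Rightarrow> qseries \<Rightarrow> qseries" where
  "qscale c F = (\<lambda>x. c * F x)"

definition qsummable :: "('i \<Rightarrow> qseries) \<Rightarrow> 'i set \<Rightarrow> bool" where
  "qsummable F A \<longleftrightarrow> (\<forall>x. finite {a \<in> A. F a x \<noteq> 0})"

definition qsum :: "('i \<Rightarrow> qseries) \<Rightarrow> 'i set \<Rightarrow> qseries" where
  "qsum F A = (\<lambda>x. \<Sum>a\<in>{a \<in> A. F a x \<noteq> 0}. F a x)"

definition qmultipliable :: "qseries \<Rightarrow> qseries \<Rightarrow> bool" where
  "qmultipliable F G \<longleftrightarrow> (\<forall>x. finite {y. F y \<noteq> 0 \<and> G (x - y) \<noteq> 0})"

definition qmult :: "qseries \<Rightarrow> qseries \<Rightarrow> qseries" where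
  "qmult F G = (\<lambda>x. \<Sum>y\<in>{y. F y \<noteq> 0 \<and> G (x - y) \<noteq> 0}. F y * G (x - y))"

definition qseries_of_fps :: "rat fps \<Rightarrow> qseries" where
  "qseries_of_fps f = qsum (\<lambda>m. qscale (fps_nth f m) (qpow (of_nat m))) UNIV"

text \<open>\<open>(q)\<^sub>\<infinity>\<close>; the infinite product is taken in the \<open>q\<close>-adic topology.\<close>

definition qinf :: "rat fps" where
  "qinf = prodinf (\<lambda>m. 1 - fps_X ^ Suc m)"

definition pattern_term :: "nat \<Rightarrow> (int \<Rightarrow> int \<Rightarrow> nat) \<Rightarrow> qseries" where
  "pattern_term n d = qpow (of_nat (\<Sum>i=1..int n. row_sum d i))"

definition P_char :: "nat \<Rightarrow> avec \<Rightarrow> qseries" where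
  "P_char n \<Lambda> = qmult (qpow (- bform n \<Lambda> (rho n)))
                  (qsum (pattern_term n) (permitted_patterns n \<Lambda>))"

definition weyl_term :: "nat \<Rightarrow> avec \<Rightarrow> avec \<Rightarrow> (avec \<Rightarrow> avec) \<Rightarrow> qseries" where
  "weyl_term n \<xi> \<eta> w = qscale ((- 1) ^ weyl_length n w)
     (qpow (bform n (\<xi> + rho n - w (\<xi> + rho n)) (\<eta> + rho n)))"

end

theory Submission
  imports Defs "HOL-Combinatorics.Permutations"
begin

text \<open>
  The weight \<open>\<Lambda>\<close> enters the notion of a permitted pattern only through two increasing integer
  sequences.  Let \<open>g\<close> and \<open>A\<close> be the sequences with \<open>g 0 = A 0 = 0\<close> and increments \<open>b + 1\<close> and \<open>a + 1\<close>; they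
  are quasiperiodic, \<open>g (s + n) = g s + p' n\<close> and \<open>A (s + n) = A s + p\<close>.  By construction of \<open>\<gamma>\<close> the pairing of
  \<open>\<Lambda> + \<rho>\<close> with the root between \<open>g s\<close> and \<open>g t\<close> is \<open>A t - A s\<close> (\<open>Lambda_coords\<close>).  Since \<open>p\<close> and \<open>p'\<close> are
  coprime, all integral pairings that matter are of this form up to translation, and a pattern is
  permitted precisely if the columns \<open>g s\<close>, read as partitions \<open>\<mu> s\<close>, satisfy the Burge inequalities
  \<open>\<mu> s (k + b) \<le> \<mu> (s + 1) k + a\<close> (\<open>permitted_iff_burge\<close>).  So the left-hand side counts periodic families of
  partitions with these inequalities, by total size.

  These families are counted by an argument in the style of Lindstroem, Gessel and Viennot.  The partition
  \<open>\<mu> s\<close> is drawn as a lattice path that comes down in column \<open>g s\<close> and runs off to the right at height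
  \<open>A s\<close>.  Paths \<open>s\<close> and \<open>s + n\<close> are translates of each other, so \<open>n\<close> paths live on a cylinder.  The Burge
  inequalities say that the paths have no common vertex.  Now let path \<open>s\<close> start in column \<open>g (u s)\<close>
  instead, for an affine permutation \<open>u\<close>, and allow crossings.  Exchanging the initial parts of two paths at a common
  vertex multiplies \<open>u\<close> by a reflection, hence reverses the sign, and changes the total size by an
  amount that depends only on \<open>u\<close> and the two indices; it is compensated by a quadratic function of \<open>u\<close>, the energy
  (\<open>weight_swap\<close>).  A path never meets its own translates, and the exchange preserves the set of common
  vertices, so exchanging at a chosen common vertex is a sign-reversing involution.  What survives are
  the families of disjoint paths, and by planarity they occur only for \<open>u = id\<close>
  (\<open>crossings_empty_iff\<close>, \<open>signed_config_count\<close>).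

  Without a condition on crossings the \<open>n\<close> partitions are independent of each other and of \<open>u\<close>.  They contribute
  \<open>1 / (q)\<^sub>\<infinity>\<^sup>n\<close> (\<open>inverse_qinf_power\<close>, \<open>card_part_families\<close>), and \<open>u\<close> contributes its sign times \<open>q\<close> to the
  energy.  Finally affine permutations are the elements of the affine Weyl group, acting on the
  coordinates with respect to an extended basis \<open>\<epsilon> s\<close>, \<open>s \<in> \<int>\<close> (\<open>aff_act_bij\<close>, \<open>weyl_length_sign\<close>), and
  the energy of \<open>u\<close> is \<open>(\<xi> + \<rho> - w (\<xi> + \<rho>), \<eta> + \<rho>)\<close> (\<open>energy_bform\<close>).
\<close>

section \<open>Periodic sums and affine permutations\<close>

lemma periodic_mult:
  fixes h :: "int \<Rightarrow> 'a"
  assumes "\<And>s. h (s + n) = h s"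
  shows "h (s + n * k) = h s"
proof -
  have pos: "h (s + n * int k) = h s" for s k
  proof (induction k)
    case (Suc k)
    have "h (s + n * int (Suc k)) = h (s + n * int k + n)" by (simp add: algebra_simps)
    then show ?case using Suc assms by simp
  qed simp
  show ?thesis
  proof (cases "k \<ge> 0")
    case True then show ?thesis using pos[of s "nat k"] by simp
  next
    case False then show ?thesis using pos[of "s + n * k" "nat (- k)"] by simp
  qed
qed

lemma periodic_mod:
  fixes h :: "int \<Rightarrow> 'a"
  assumes "\<And>s. h (s + n) = h s"
  shows "h (s mod n) = h s"
  using periodic_mult[of h n "s mod n" "s div n", OF assms] by simp

text \<open>
  The values of \<open>f\<close> need only form a complete system of residues, so this covers affine permutations,
  shifted windows and the starting columns of the paths below.
\<close>

lemma sum_periodic_reindex: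
  fixes h :: "int \<Rightarrow> 'a::comm_monoid_add" and f :: "int \<Rightarrow> int"
  assumes "n > 0" and per: "\<And>s. h (s + n) = h s"
    and "finite W" "int (card W) = n" and inj: "inj_on (\<lambda>s. f s mod n) W"
  shows "(\<Sum>s\<in>W. h (f s)) = (\<Sum>s\<in>{0..<n}. h s)"
proof -
  have hmod: "h (s mod n) = h s" for s by (rule periodic_mod) (rule per)
  have "(\<lambda>s. f s mod n) ` W \<subseteq> {0..<n}" using \<open>n > 0\<close> by auto
  moreover have "card ((\<lambda>s. f s mod n) ` W) = card {0..<n}"
    using card_image[OF inj] assms(4) by simp
  ultimately have im: "(\<lambda>s. f s mod n) ` W = {0..<n}"
    by (simp add: card_subset_eq)
  have "(\<Sum>s\<in>W. h (f s)) = (\<Sum>s\<in>W. h (f s mod n))" by (simp add: hmod)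
  also have "\<dots> = (\<Sum>s\<in>(\<lambda>s. f s mod n) ` W. h s)"
    by (simp add: sum.reindex[OF inj])
  finally show ?thesis by (simp add: im)
qed

lemma inj_on_mod_window: "inj_on (\<lambda>s::int. s mod n) {m..<m + n}"
proof (rule inj_onI)
  fix x y assume *: "x \<in> {m..<m + n}" "y \<in> {m..<m + n}" "x mod n = y mod n"
  then obtain k where k: "x - y = n * k" by (metis mod_eq_dvd_iff dvdE)
  have "\<bar>n * k\<bar> < n" using * k by auto
  then have "k = 0"
    by (smt (verit, ccfv_SIG) mult_minus_right mult_left_le_imp_le mult_less_cancel_left1 mult_le_cancel_left1)
  then show "x = y" using k by simp
qed

lemma sum_periodic_window:
  fixes h :: "int \<Rightarrow> 'a::comm_monoid_add"
  assumes "n > 0" and "\<And>s. h (s + n) = h s"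
  shows "(\<Sum>s\<in>{m..<m + n}. h s) = (\<Sum>s\<in>{0..<n}. h s)"
  using sum_periodic_reindex[of n h "{m..<m + n}" "\<lambda>s. s"] assms inj_on_mod_window by simp

text \<open>
  The affine symmetric group, realised on \<open>\<int>\<close>.  The condition on the sum over a window removes the
  shifts \<open>s \<mapsto> s + c\<close>, so that the simple reflections generate.
\<close>

definition affine_perms :: "int \<Rightarrow> (int \<Rightarrow> int) set" where
  "affine_perms n = {u. bij u \<and> (\<forall>s. u (s + n) = u s + n) \<and> (\<Sum>s\<in>{0..<n}. u s - s) = 0}"

text \<open>
  For \<open>s\<close> and \<open>t\<close> in different classes this is an affine reflection: it interchanges
  \<open>s + n * k\<close> and \<open>t + n * k\<close> for every \<open>k\<close>.
\<close>

definition affine_transp :: "int \<Rightarrow> int \<Rightarrow> int \<Rightarrow> int \<Rightarrow> int" where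
  "affine_transp n s t r =
     (if r mod n = s mod n then r + (t - s) else if r mod n = t mod n then r + (s - t) else r)"

text \<open>
  The sign of the permutation induced on residues modulo \<open>n\<close>.  Every affine reflection, simple or
  not, induces a transposition of residues, so this is \<open>(-1)\<close> to the Coxeter length, in a form that
  makes the effect of an arbitrary reflection immediate.
\<close>

definition aperm_sign :: "int \<Rightarrow> (int \<Rightarrow> int) \<Rightarrow> int" where
  "aperm_sign n u = sign (\<lambda>r. if r \<in> {0..<n} then u r mod n else r)"

lemma quasiperiodic_multiple:
  fixes u :: "int \<Rightarrow> int"
  assumes "\<And>s. u (s + n) = u s + c"
  shows "u (s + n * k) = u s + c * k"
proof -
  have pos: "u (s + n * int k) = u s + c * int k" for s k
  proof (induction k)
    case (Suc k)
    have "u (s + n * int (Suc k)) = u (s + n * int k + n)" by (simp add: algebra_simps)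
    also have "\<dots> = u s + c * int k + c" using assms Suc by metis
    finally show ?case by (simp add: algebra_simps)
  qed simp
  show ?thesis
  proof (cases "k \<ge> 0")
    case True then show ?thesis using pos[of s "nat k"] by simp
  next
    case False then show ?thesis using pos[of "s + n * k" "nat (- k)"] by simp
  qed
qed

lemma affine_permsD:
  assumes "u \<in> affine_perms n"
  shows "bij u" "u (s + n) = u s + n" "u (s + n * k) = u s + n * k" "u s = u t \<longleftrightarrow> s = t"
    and "u s mod n = u t mod n \<longleftrightarrow> s mod n = t mod n"
proof -
  show b: "bij u" and "u (s + n) = u s + n"
    using assms by (auto simp: affine_perms_def)
  show *: "u (s + n * k) = u s + n * k" for s k
    by (rule quasiperiodic_multiple) (use assms in \<open>auto simp: affine_perms_def\<close>)
  show i: "u s = u t \<longleftrightarrow> s = t" for s t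
    using b by (auto simp: bij_def inj_def)
  show "u s mod n = u t mod n \<longleftrightarrow> s mod n = t mod n"
  proof
    assume "u s mod n = u t mod n"
    then obtain k where "u s = u t + n * k" by (metis mod_eqE)
    then have "s = t + n * k" using i * by metis
    then show "s mod n = t mod n" by simp
  next
    assume "s mod n = t mod n"
    then obtain k where "s = t + n * k" by (metis mod_eqE)
    then show "u s mod n = u t mod n" by (simp add: *)
  qed
qed

lemma id_affine_perm: "(\<lambda>s. s) \<in> affine_perms n"
  using bij_id by (simp add: affine_perms_def id_def)

lemma affine_transp_simps:
  assumes "s mod n \<noteq> t mod n"
  shows "affine_transp n s t (s + n * k) = t + n * k"
    and "affine_transp n s t (t + n * k) = s + n * k"
    and "r mod n \<noteq> s mod n \<Longrightarrow> r mod n \<noteq> t mod n \<Longrightarrow> affine_transp n s t r = r"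
    and "affine_transp n s t (r + n) = affine_transp n s t r + n"
    and "affine_transp n s t s = t" and "affine_transp n s t t = s"
  using assms by (auto simp: affine_transp_def)

lemma affine_transp_mod:
  "affine_transp n s t r mod n =
    (if r mod n = s mod n then t mod n else if r mod n = t mod n then s mod n else r mod n)"
proof -
  have "(r + (t - s)) mod n = t mod n" if "r mod n = s mod n"
    by (metis that add_diff_cancel_left' diff_add_eq mod_diff_eq add.commute diff_diff_eq2)
  moreover have "(r + (s - t)) mod n = s mod n" if "r mod n = t mod n"
    by (metis that add_diff_cancel_left' diff_add_eq mod_diff_eq add.commute diff_diff_eq2)
  ultimately show ?thesis by (simp add: affine_transp_def)
qed

lemma affine_transp_invol:
  assumes "s mod n \<noteq> t mod n"
  shows "affine_transp n s t (affine_transp n s t r) = r"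
proof -
  consider "r mod n = s mod n" | "r mod n \<noteq> s mod n" "r mod n = t mod n"
    | "r mod n \<noteq> s mod n" "r mod n \<noteq> t mod n" by blast
  then show ?thesis
  proof cases
    case 1
    then have a: "affine_transp n s t r = r + (t - s)" by (simp add: affine_transp_def)
    have "(r + (t - s)) mod n = t mod n" using affine_transp_mod[of n s t r] 1 a by simp
    then show ?thesis using a 1 assms by (auto simp: affine_transp_def)
  next
    case 2
    then have a: "affine_transp n s t r = r + (s - t)" by (simp add: affine_transp_def)
    have "(r + (s - t)) mod n = s mod n" using affine_transp_mod[of n s t r] 2 a by simp
    then show ?thesis using a 2 by (auto simp: affine_transp_def)
  next
    case 3 then show ?thesis by (simp add: affine_transp_def)
  qed
qed

lemma bij_affine_transp: "s mod n \<noteq> t mod n \<Longrightarrow> bij (affine_transp n s t)"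
  by (rule involuntory_imp_bij) (rule affine_transp_invol)

lemma two_residues_sum:
  fixes h :: "int \<Rightarrow> 'a::comm_monoid_add"
  assumes "n > 0" "s mod n \<noteq> t mod n"
  shows "(\<Sum>r\<in>{0..<n}. h r) = h (s mod n) + (h (t mod n) + (\<Sum>r\<in>{0..<n} - {s mod n, t mod n}. h r))"
proof -
  have "{0..<n} = insert (s mod n) (insert (t mod n) ({0..<n} - {s mod n, t mod n}))"
    using assms by auto
  then have "(\<Sum>r\<in>{0..<n}. h r) = sum h (insert (s mod n) (insert (t mod n) ({0..<n} - {s mod n, t mod n})))"
    by simp
  also have "\<dots> = h (s mod n) + (h (t mod n) + (\<Sum>r\<in>{0..<n} - {s mod n, t mod n}. h r))"
    using assms by (subst sum.insert, simp, simp, subst sum.insert, auto)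
  finally show ?thesis .
qed

lemma sum_affine_transp:
  fixes h :: "int \<Rightarrow> 'a::comm_monoid_add"
  assumes "n > 0" and "\<And>s. h (s + n) = h s"
  shows "(\<Sum>r\<in>{0..<n}. h (affine_transp n s t r)) = (\<Sum>r\<in>{0..<n}. h r)"
proof (rule sum_periodic_reindex)
  show "inj_on (\<lambda>r. affine_transp n s t r mod n) {0..<n}"
    by (rule inj_onI) (auto simp: affine_transp_mod split: if_splits)
qed (use assms in auto)

lemma affine_perm_transp:
  assumes u: "u \<in> affine_perms n" and n: "n > 0" and st: "s mod n \<noteq> t mod n"
  shows "u \<circ> affine_transp n s t \<in> affine_perms n"
proof -
  let ?\<rho> = "affine_transp n s t"
  have "(\<Sum>r\<in>{0..<n}. (u \<circ> ?\<rho>) r - r) = (\<Sum>r\<in>{0..<n}. u (?\<rho> r) - ?\<rho> r) + (\<Sum>r\<in>{0..<n}. ?\<rho> r - r)"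
    by (simp add: sum.distrib[symmetric])
  also have "(\<Sum>r\<in>{0..<n}. u (?\<rho> r) - ?\<rho> r) = (\<Sum>r\<in>{0..<n}. u r - r)"
    by (rule sum_affine_transp[where h = "\<lambda>r. u r - r"]) (use n affine_permsD(2)[OF u] in auto)
  also have "\<dots> = 0" using u by (simp add: affine_perms_def)
  also have "(\<Sum>r\<in>{0..<n}. ?\<rho> r - r) = 0"
    using st by (subst two_residues_sum[OF n st]) (auto simp: affine_transp_def intro: sum.neutral)
  finally have "(\<Sum>r\<in>{0..<n}. (u \<circ> ?\<rho>) r - r) = 0" by simp
  moreover have "bij (u \<circ> ?\<rho>)" using bij_affine_transp[OF st] affine_permsD(1)[OF u] by (rule bij_comp)
  ultimately show ?thesis
    using affine_permsD(2)[OF u] affine_transp_simps(4)[OF st] by (simp add: affine_perms_def)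
qed

lemma residue_permutes:
  assumes u: "u \<in> affine_perms n" and n: "n > 0"
  shows "(\<lambda>r. if r \<in> {0..<n} then u r mod n else r) permutes {0..<n}"
proof (rule bij_imp_permutes)
  have "inj_on (\<lambda>r. if r \<in> {0..<n} then u r mod n else r) {0..<n}"
    using affine_permsD(5)[OF u] by (auto intro!: inj_onI simp: mod_pos_pos_trivial)
  moreover have "(\<lambda>r. if r \<in> {0..<n} then u r mod n else r) ` {0..<n} \<subseteq> {0..<n}" using n by auto
  ultimately show "bij_betw (\<lambda>r. if r \<in> {0..<n} then u r mod n else r) {0..<n} {0..<n}"
    by (intro bij_betw_imageI card_subset_eq) (auto simp only: card_image finite_atLeastLessThan_int)
qed auto

lemma aperm_sign_transp:
  assumes u: "u \<in> affine_perms n" and n: "n > 0" and st: "s mod n \<noteq> t mod n"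
  shows "aperm_sign n (u \<circ> affine_transp n s t) = - aperm_sign n u"
proof -
  let ?R = "\<lambda>u r. if r \<in> {0..<n} then u r mod n else r"
  have eq: "?R (u \<circ> affine_transp n s t) = ?R u \<circ> Transposition.transpose (s mod n) (t mod n)"
  proof
    fix r
    consider "r \<notin> {0..<n}" | "r \<in> {0..<n}" "r = s mod n" | "r \<in> {0..<n}" "r = t mod n"
      | "r \<in> {0..<n}" "r \<noteq> s mod n" "r \<noteq> t mod n" by blast
    then show "?R (u \<circ> affine_transp n s t) r = (?R u \<circ> Transposition.transpose (s mod n) (t mod n)) r"
    proof cases
      case 1 then show ?thesis using n by (auto simp: Transposition.transpose_def)
    next
      case 2
      have "u (affine_transp n s t r) mod n = u (t mod n) mod n"
        using 2 affine_permsD(5)[OF u] affine_transp_mod[of n s t r] by simp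
      then show ?thesis using 2 n by (simp add: Transposition.transpose_def)
    next
      case 3
      have "u (affine_transp n s t r) mod n = u (s mod n) mod n"
        using 3 st affine_permsD(5)[OF u] affine_transp_mod[of n s t r] by simp
      then show ?thesis using 3 n by (simp add: Transposition.transpose_def)
    next
      case 4
      have "affine_transp n s t r = r" using 4 by (simp add: affine_transp_def mod_pos_pos_trivial)
      then show ?thesis using 4 by (simp add: Transposition.transpose_def)
    qed
  qed
  have "permutation (?R u)"
    using residue_permutes[OF u n] by (auto simp: permutation_permutes)
  then show ?thesis
    unfolding aperm_sign_def eq
    using st by (simp only: sign_compose permutation_swap_id sign_swap_id) simp
qed

lemma aperm_sign_id: "aperm_sign n (\<lambda>s. s) = 1"
proof -
  have "(\<lambda>r. if r \<in> {0..<n} then r mod n else r) = id"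
    by (auto simp: fun_eq_iff)
  then show ?thesis by (simp add: aperm_sign_def)
qed

lemma aperm_sign_cases: "aperm_sign n u = 1 \<or> aperm_sign n u = -1"
  by (auto simp: aperm_sign_def sign_def)

text \<open>
  The factors come in the order opposite to \<open>refl_word\<close>: a reflection acts on the coordinates of a
  vector by precomposition, so composition of reflections reverses.
\<close>

fun word_perm :: "int \<Rightarrow> nat list \<Rightarrow> int \<Rightarrow> int" where
  "word_perm n [] = (\<lambda>s. s)"
| "word_perm n (i # is) = word_perm n is \<circ> affine_transp n (int i) (int i + 1)"

lemma mod_Suc_neq: "n \<ge> 2 \<Longrightarrow> (i::int) mod n \<noteq> (i + 1) mod n"
  by (smt (verit, best) mod_eq_dvd_iff zdvd_not_zless)

lemma word_perm_affine: "n \<ge> 2 \<Longrightarrow> word_perm n is \<in> affine_perms n"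
  by (induction "is") (auto simp: id_affine_perm intro!: affine_perm_transp mod_Suc_neq)

lemma aperm_sign_word: "n \<ge> 2 \<Longrightarrow> aperm_sign n (word_perm n is) = (-1) ^ length is"
  by (induction "is") (auto simp: aperm_sign_id aperm_sign_transp word_perm_affine mod_Suc_neq)

text \<open>
  The squared distance to the identity.  It strictly drops when a descent is removed, which makes
  sorting by adjacent exchanges terminate.
\<close>

definition aperm_disorder :: "int \<Rightarrow> (int \<Rightarrow> int) \<Rightarrow> int" where
  "aperm_disorder n u = (\<Sum>s\<in>{0..<n}. (u s - s)\<^sup>2)"

lemma aperm_disorder_transp:
  assumes u: "u \<in> affine_perms n" and n: "n \<ge> 2" and inv: "u i > u (i + 1)"
  shows "aperm_disorder n (u \<circ> affine_transp n i (i + 1)) < aperm_disorder n u"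
proof -
  let ?u' = "u \<circ> affine_transp n i (i + 1)"
  have u': "?u' \<in> affine_perms n" using affine_perm_transp[OF u] n mod_Suc_neq by simp
  have d: "aperm_disorder n v = (v i - i)\<^sup>2 + (v (i + 1) - (i + 1))\<^sup>2 + (\<Sum>s\<in>{i+2..<i+n}. (v s - s)\<^sup>2)"
    if "v \<in> affine_perms n" for v
  proof -
    have "aperm_disorder n v = (\<Sum>s\<in>{i..<i + n}. (v s - s)\<^sup>2)"
      unfolding aperm_disorder_def
      by (rule sum_periodic_window[symmetric]) (use n affine_permsD(2)[OF that] in auto)
    also have "{i..<i + n} = insert i (insert (i + 1) {i+2..<i+n})" using n by auto
    finally show ?thesis by simp
  qed
  have "?u' s = u s" if "s \<in> {i+2..<i+n}" for s
  proof -
    have "s mod n \<noteq> i mod n" "s mod n \<noteq> (i + 1) mod n"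
      using inj_onD[OF inj_on_mod_window[of n i], of s i] that
        inj_onD[OF inj_on_mod_window[of n i], of s "i + 1"] n by auto
    then show ?thesis by (simp add: affine_transp_def)
  qed
  moreover have "?u' i = u (i + 1)" "?u' (i + 1) = u i"
    using affine_transp_simps(5,6)[OF mod_Suc_neq[OF n]] by simp_all
  \<comment> \<open>Exchanging the values \<open>a\<close> at \<open>i\<close> and \<open>b\<close> at \<open>i + 1\<close> changes only two squares, and their
    quadratic parts in \<open>a\<close> and \<open>b\<close> cancel.\<close>
  ultimately have "aperm_disorder n ?u' - aperm_disorder n u = 2 * (u (i + 1) - u i)"
    using d[OF u] d[OF u'] by (simp add: power2_eq_square algebra_simps)
  then show ?thesis using inv by simp
qed

text \<open>
  The set \<open>J\<close> of admitted exchanges is arbitrary.  With all of them this yields generation of the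
  affine group; with \<open>{1..<n}\<close> it yields generation of the finite Weyl group.
\<close>

lemma affine_perm_sort:
  assumes "n \<ge> 2" "u \<in> affine_perms n"
  shows "\<exists>is v. set is \<subseteq> J \<and> v \<in> affine_perms n \<and> (\<forall>i\<in>J. v (int i) < v (int i + 1)) \<and> u = v \<circ> word_perm n is"
  using assms(2)
proof (induction "nat (aperm_disorder n u)" arbitrary: u rule: less_induct)
  case less
  show ?case
  proof (cases "\<forall>i\<in>J. u (int i) < u (int i + 1)")
    case True
    then show ?thesis using less.prems by (intro exI[of _ "[]"] exI[of _ u]) auto
  next
    case False
    then obtain i where i: "i \<in> J" "u (int i) > u (int i + 1)"
      using affine_permsD(4)[OF less.prems] by (metis linorder_cases zless_add1_eq less_irrefl)
    let ?\<rho> = "affine_transp n (int i) (int i + 1)"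
    have u': "u \<circ> ?\<rho> \<in> affine_perms n"
      using affine_perm_transp[OF less.prems] assms(1) mod_Suc_neq by simp
    have "aperm_disorder n (u \<circ> ?\<rho>) \<ge> 0" by (simp add: aperm_disorder_def sum_nonneg)
    then have "nat (aperm_disorder n (u \<circ> ?\<rho>)) < nat (aperm_disorder n u)"
      using aperm_disorder_transp[OF less.prems assms(1) i(2)] by simp
    from less.hyps[OF this u'] obtain "is" v where *: "set is \<subseteq> J" "v \<in> affine_perms n"
      "\<forall>i\<in>J. v (int i) < v (int i + 1)" "u \<circ> ?\<rho> = v \<circ> word_perm n is" by blast
    have "u = (u \<circ> ?\<rho>) \<circ> ?\<rho>"
      using affine_transp_invol[OF mod_Suc_neq[OF assms(1)]] by (simp add: fun_eq_iff)
    also have "\<dots> = v \<circ> word_perm n (i # is)" by (simp add: *(4) comp_assoc)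
    finally show ?thesis using * i by (intro exI[of _ "i # is"] exI[of _ v]) auto
  qed
qed

lemma strict_mono_bij_int:
  fixes u :: "int \<Rightarrow> int"
  assumes "strict_mono u" "surj u"
  shows "u s = s + u 0"
proof -
  have step: "u (s + 1) = u s + 1" for s
  proof (rule antisym)
    obtain t where t: "u t = u s + 1" using \<open>surj u\<close> by (metis surjD)
    have "t > s" using t assms(1) by (metis strict_mono_less zless_add1_eq)
    then have "u (s + 1) \<le> u t" using assms(1) by (simp add: strict_mono_less_eq)
    then show "u (s + 1) \<le> u s + 1" using t by simp
    show "u s + 1 \<le> u (s + 1)" using assms(1) by (metis strict_mono_less zless_add1_eq zless_imp_add1_zle)
  qed
  have "u (0 + 1 * s) = u 0 + 1 * s"
    by (rule quasiperiodic_multiple) (rule step)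
  then show ?thesis by simp
qed

text \<open>
  An increasing bijection of \<open>\<int>\<close> is a shift, and the window sum forces the shift to be trivial.
\<close>

lemma strict_mono_affine_perm_id:
  assumes u: "u \<in> affine_perms n" "n > 0" and "strict_mono u"
  shows "u s = s"
proof -
  have *: "u s = s + u 0" for s
    using strict_mono_bij_int[of u s] assms affine_permsD(1) by (auto simp: bij_def)
  have "0 = (\<Sum>s\<in>{0..<n}. u s - s)" using u by (simp add: affine_perms_def)
  also have "\<dots> = (\<Sum>s\<in>{0..<n}. u 0)"
  proof (rule sum.cong)
    show "u s - s = u 0" for s using *[of s] by linarith
  qed simp
  finally have "u 0 = 0" using u(2) by simp
  then show ?thesis using *[of s] by linarith
qed

lemma strict_mono_int_stepI:
  fixes f :: "int \<Rightarrow> 'a::order"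
  assumes "\<And>s. f s < f (s + 1)"
  shows "strict_mono f"
proof (rule strict_monoI)
  fix x y :: int assume "x < y"
  then show "f x < f y"
    by (induction y rule: int_gr_induct) (use assms less_trans in blast)+
qed

lemma affine_perm_word:
  assumes n: "n \<ge> 2" and u: "u \<in> affine_perms n"
  shows "\<exists>is. set is \<subseteq> {0..<nat n} \<and> u = word_perm n is"
proof -
  obtain "is" v where *: "set is \<subseteq> {0..<nat n}" "v \<in> affine_perms n"
    "\<forall>i\<in>{0..<nat n}. v (int i) < v (int i + 1)" "u = v \<circ> word_perm n is"
    using affine_perm_sort[OF n u] by blast
  have "v s < v (s + 1)" for s
  proof -
    have "nat (s mod n) \<in> {0..<nat n}" "int (nat (s mod n)) = s mod n" using n by auto
    then have "v (s mod n) < v (s mod n + 1)" using *(3) by metis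
    moreover have "s = s mod n + n * (s div n)" "s + 1 = (s mod n + 1) + n * (s div n)" by simp_all
    ultimately show ?thesis using affine_permsD(3)[OF *(2)] by (metis add_less_cancel_right)
  qed
  then have "strict_mono v" by (rule strict_mono_int_stepI)
  then have "v s = s" for s
    using strict_mono_affine_perm_id[OF *(2)] n by auto
  then have "u = word_perm n is" using *(4) by (simp add: fun_eq_iff)
  then show ?thesis using *(1) by blast
qed

section \<open>Partitions and the Euler product\<close>

unbundle no vec_syntax
unbundle fps_syntax

definition is_part :: "(nat \<Rightarrow> nat) \<Rightarrow> bool" where
  "is_part f \<longleftrightarrow> antimono f \<and> finite {k. f k \<noteq> 0}"

definition psize :: "(nat \<Rightarrow> nat) \<Rightarrow> nat" where
  "psize f = (\<Sum>k | f k \<noteq> 0. f k)"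

lemma is_part_antimono: "is_part f \<Longrightarrow> i \<le> j \<Longrightarrow> f j \<le> f i"
  by (auto simp: is_part_def antimono_def)

lemma is_part_bound:
  assumes "is_part f" obtains K where "\<And>k. k \<ge> K \<Longrightarrow> f k = 0"
proof -
  obtain K where "\<forall>k\<in>{k. f k \<noteq> 0}. k < K"
    using assms finite_nat_set_iff_bounded by (auto simp: is_part_def)
  then show thesis by (intro that[of K]) force
qed

lemma is_partI:
  assumes "\<And>k. f (Suc k) \<le> f k" "\<And>k. k \<ge> K \<Longrightarrow> f k = 0"
  shows "is_part f"
proof -
  have "k < K" if "f k \<noteq> 0" for k
    using assms(2)[of k] that by linarith
  then have "{k. f k \<noteq> 0} \<subseteq> {..<K}" by blast
  moreover have "antimono f" using assms(1) by (simp add: antimono_iff_le_Suc)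
  ultimately show ?thesis by (auto simp: is_part_def intro: finite_subset)
qed

lemma psize_eq:
  assumes "\<And>k. k \<ge> K \<Longrightarrow> f k = 0"
  shows "psize f = (\<Sum>k<K. f k)"
proof -
  have "k < K" if "f k \<noteq> 0" for k
    using assms[of k] that by linarith
  then have "{k. f k \<noteq> 0} \<subseteq> {..<K}" by blast
  then show ?thesis unfolding psize_def by (intro sum.mono_neutral_left) auto
qed

lemma psize_split:
  assumes "is_part f"
  shows "psize f = (\<Sum>k<K. f k) + psize (\<lambda>k. f (k + K))"
proof -
  obtain M where M: "\<And>k. k \<ge> M \<Longrightarrow> f k = 0" using is_part_bound[OF assms] by blast
  have "psize f = (\<Sum>k<K + M. f k)" by (rule psize_eq) (use M in auto)
  also have "\<dots> = (\<Sum>k<K. f k) + (\<Sum>k=K..<K + M. f k)"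
    using sum.atLeastLessThan_concat[of 0 K "K + M" f] by (simp add: atLeast0LessThan)
  also have "(\<Sum>k=K..<K + M. f k) = (\<Sum>k<M. f (k + K))"
    using sum.shift_bounds_nat_ivl[of f 0 K M] by (simp add: atLeast0LessThan add.commute)
  also have "\<dots> = psize (\<lambda>k. f (k + K))" by (rule psize_eq[symmetric]) (use M in auto)
  finally show ?thesis .
qed

lemma is_part_shift:
  assumes "is_part f" shows "is_part (\<lambda>k. f (k + K))"
proof -
  obtain M where "\<And>k. k \<ge> M \<Longrightarrow> f k = 0" using is_part_bound[OF assms] by blast
  then show ?thesis
    using is_part_antimono[OF assms] by (intro is_partI[of _ M]) auto
qed

lemma part_le_psize: "is_part f \<Longrightarrow> f k \<le> psize f"
  unfolding psize_def is_part_def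
  by (cases "f k = 0") (auto intro!: member_le_sum)

lemma part_zero_beyond_psize:
  assumes "is_part f" "k \<ge> psize f"
  shows "f k = 0"
proof (rule ccontr)
  assume "f k \<noteq> 0"
  then have "1 \<le> f i" if "i < Suc k" for i
    using is_part_antimono[OF assms(1), of i k] that by simp
  then have "(\<Sum>i<Suc k. 1) \<le> (\<Sum>i<Suc k. f i)" by (intro sum_mono) auto
  also have "\<dots> \<le> psize f" using psize_split[OF assms(1), of "Suc k"] by simp
  finally show False using assms(2) by simp
qed

lemma finite_parts: "finite {f. is_part f \<and> psize f \<le> m}"
proof (rule finite_subset)
  show "finite {f::nat\<Rightarrow>nat. \<forall>k. (k \<in> {..<m} \<longrightarrow> f k \<in> {..m}) \<and> (k \<notin> {..<m} \<longrightarrow> f k = 0)}"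
    by (rule finite_set_of_finite_funs) auto
  show "{f. is_part f \<and> psize f \<le> m} \<subseteq> \<dots>"
    using part_le_psize part_zero_beyond_psize le_trans by (auto simp: not_less) (metis le_trans)+
qed

lemma finite_parts_of: "finite {f. is_part f \<and> psize f = m}"
  by (rule finite_subset[OF _ finite_parts[of m]]) auto

lemma is_part_zero: "is_part (\<lambda>_. 0)" by (auto simp: is_part_def antimono_def)

lemma psize_zero: "psize (\<lambda>_. 0) = 0" by (simp add: psize_def)

text \<open>
  Prepending a largest part: the recursion behind the generating function of partitions.
\<close>

lemma is_part_case_nat: "is_part (case_nat m h) \<longleftrightarrow> is_part h \<and> h 0 \<le> m"
proof
  assume a: "is_part (case_nat m h)"
  show "is_part h \<and> h 0 \<le> m"
    using is_part_shift[OF a, of 1] is_part_antimono[OF a, of 0 1] by simp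
next
  assume a: "is_part h \<and> h 0 \<le> m"
  then obtain K where K: "\<And>k. k \<ge> K \<Longrightarrow> h k = 0" using is_part_bound by blast
  show "is_part (case_nat m h)"
    by (rule is_partI[of _ "Suc K"])
      (use a K is_part_antimono[of h] in \<open>auto split: nat.splits\<close>)
qed

lemma psize_case_nat: "is_part (case_nat m h) \<Longrightarrow> psize (case_nat m h) = m + psize h"
  using psize_split[of "case_nat m h" 1] by simp

definition part_gf :: "rat fps" where
  "part_gf = Abs_fps (\<lambda>m. of_nat (card {f. is_part f \<and> psize f = m}))"

definition bounded_part_gf :: "nat \<Rightarrow> rat fps" where
  "bounded_part_gf k = Abs_fps (\<lambda>m. of_nat (card {f. is_part f \<and> f 0 \<le> k \<and> psize f = m}))"

lemma bounded_part_gf_0: "bounded_part_gf 0 = 1"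
proof (rule fps_ext)
  fix m
  have "{f. is_part f \<and> f 0 \<le> 0 \<and> psize f = m} = (if m = 0 then {\<lambda>_. 0} else {})"
  proof -
    have "f = (\<lambda>_. 0)" if "is_part f" "f 0 = 0" for f
    proof
      fix k show "f k = 0" using is_part_antimono[OF that(1), of 0 k] that(2) by simp
    qed
    then have "{f. is_part f \<and> f 0 \<le> 0 \<and> psize f = m} \<subseteq> {\<lambda>_. 0}" by blast
    moreover have "(\<lambda>_. 0) \<in> {f. is_part f \<and> f 0 \<le> 0 \<and> psize f = m} \<longleftrightarrow> m = 0"
      using is_part_zero psize_zero by auto
    ultimately show ?thesis by (cases "m = 0") auto
  qed
  then show "bounded_part_gf 0 $ m = 1 $ m" by (simp add: bounded_part_gf_def)
qed

text \<open>
  A partition with parts at most \<open>Suc k\<close> either has no part \<open>Suc k\<close>, or arises by prepending such a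
  part.
\<close>

lemma bounded_part_gf_Suc:
  "bounded_part_gf (Suc k) = bounded_part_gf k + fps_X ^ Suc k * bounded_part_gf (Suc k)"
proof (rule fps_ext)
  fix m
  let ?P = "\<lambda>k m. {f. is_part f \<and> f 0 \<le> k \<and> psize f = m}"
  let ?R = "{f. is_part f \<and> f 0 = Suc k \<and> psize f = m}"
  have fin: "finite (?P k m)" "finite ?R" for k
    by (rule finite_subset[OF _ finite_parts_of[of m]]; auto)+
  have "?P (Suc k) m = ?P k m \<union> ?R" by auto
  then have "card (?P (Suc k) m) = card (?P k m) + card ?R"
    by (simp only:) (rule card_Un_disjoint, use fin in auto)
  moreover have "card ?R = (if m < Suc k then 0 else card (?P (Suc k) (m - Suc k)))"
  proof (cases "m < Suc k")
    case True
    have "?R = {}" using part_le_psize[of _ 0] True by fastforce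
    then have "card ?R = 0" by (simp only: card.empty)
    then show ?thesis using True by simp
  next
    case False
    have "bij_betw (case_nat (Suc k)) (?P (Suc k) (m - Suc k)) ?R"
    proof (rule bij_betw_byWitness[where f' = "\<lambda>f i. f (Suc i)"])
      show "\<forall>f\<in>?P (Suc k) (m - Suc k). (\<lambda>i. case_nat (Suc k) f (Suc i)) = f" by simp
      show "\<forall>f\<in>?R. case_nat (Suc k) (\<lambda>i. f (Suc i)) = f"
        by (auto simp: fun_eq_iff split: nat.splits)
      show "case_nat (Suc k) ` ?P (Suc k) (m - Suc k) \<subseteq> ?R"
        using False by (auto simp: is_part_case_nat psize_case_nat)
      show "(\<lambda>f i. f (Suc i)) ` ?R \<subseteq> ?P (Suc k) (m - Suc k)"
      proof (intro image_subsetI)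
        fix f assume f: "f \<in> ?R"
        have *: "case_nat (Suc k) (\<lambda>i. f (Suc i)) = f" using f by (auto simp: fun_eq_iff split: nat.splits)
        have p: "is_part (case_nat (Suc k) (\<lambda>i. f (Suc i)))" using f * by simp
        with psize_case_nat[OF p] is_part_case_nat[THEN iffD1, OF p] show "(\<lambda>i. f (Suc i)) \<in> ?P (Suc k) (m - Suc k)"
          using f * by auto
      qed
    qed
    then show ?thesis using False by (simp add: bij_betw_same_card)
  qed
  ultimately show "bounded_part_gf (Suc k) $ m = (bounded_part_gf k + fps_X ^ Suc k * bounded_part_gf (Suc k)) $ m"
    unfolding fps_add_nth fps_X_power_mult_nth by (simp add: bounded_part_gf_def)
qed

lemma bounded_part_gf_prod: "(\<Prod>i<k. 1 - fps_X ^ Suc i) * bounded_part_gf k = 1"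
proof (induction k)
  case (Suc k)
  have "(1 - fps_X ^ Suc k) * bounded_part_gf (Suc k) = bounded_part_gf k"
    using bounded_part_gf_Suc[of k] by (simp only: ring_distribs) (metis add_diff_cancel_right' mult_1)
  then show ?case using Suc by (simp only: prod.lessThan_Suc mult.assoc)
qed (simp add: bounded_part_gf_0)

lemma bounded_part_gf_nth: "m \<le> k \<Longrightarrow> bounded_part_gf k $ m = part_gf $ m"
proof -
  assume "m \<le> k"
  then have "{f. is_part f \<and> f 0 \<le> k \<and> psize f = m} = {f. is_part f \<and> psize f = m}"
    using part_le_psize[of _ 0] le_trans by blast
  then show ?thesis by (simp add: bounded_part_gf_def part_gf_def)
qed

lemma euler_prod_nth_stable:
  assumes "m \<le> k"
  shows "(\<Prod>i<k. 1 - fps_X ^ Suc i) $ m = (\<Prod>i<m. 1 - fps_X ^ Suc i :: rat fps) $ m"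
  using assms
proof (induction k rule: dec_induct)
  case (step k)
  have "(\<Prod>i<Suc k. 1 - fps_X ^ Suc i) = (\<Prod>i<k. 1 - fps_X ^ Suc i) - fps_X ^ Suc k * (\<Prod>i<k. 1 - fps_X ^ Suc i :: rat fps)"
    by (simp only: prod.lessThan_Suc algebra_simps mult_1)
  then show ?case using step by (simp only: fps_sub_nth fps_X_power_mult_nth) simp
qed simp

text \<open>
  The coefficient of degree \<open>m\<close> of the finite product, and that of the generating function of
  partitions with parts at most \<open>k\<close>, no longer change once \<open>k \<ge> m\<close>.  Hence the finite identities
  of \<open>bounded_part_gf_prod\<close> pass to the limit.
\<close>

lemma qinf_part_gf: "qinf * part_gf = 1"
proof -
  define L :: "rat fps" where "L = Abs_fps (\<lambda>m. (\<Prod>i<m. 1 - fps_X ^ Suc i) $ m)"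
  have L1: "L * part_gf = 1"
  proof (rule fps_ext)
    fix m
    have "(L * part_gf) $ m = (\<Sum>i=0..m. (\<Prod>j<m. 1 - fps_X ^ Suc j) $ i * bounded_part_gf m $ (m - i))"
      unfolding fps_mult_nth
    proof (rule sum.cong)
      fix i assume "i \<in> {0..m}"
      then show "L $ i * part_gf $ (m - i) = (\<Prod>j<m. 1 - fps_X ^ Suc j) $ i * bounded_part_gf m $ (m - i)"
        using bounded_part_gf_nth[of "m - i" m] euler_prod_nth_stable[of i m] by (simp add: L_def)
    qed simp
    also have "\<dots> = 1 $ m" by (simp only: fps_mult_nth[symmetric] bounded_part_gf_prod)
    finally show "(L * part_gf) $ m = 1 $ m" .
  qed
  have "(\<lambda>k. \<Prod>i\<le>k. 1 - fps_X ^ Suc i) \<longlonglongrightarrow> L"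
  proof (rule tendsto_fpsI)
    fix m
    show "\<forall>\<^sub>F k in sequentially. (\<Prod>i\<le>k. 1 - fps_X ^ Suc i) $ m = L $ m"
      using eventually_ge_at_top[of m]
    proof eventually_elim
      case (elim k)
      then show ?case using euler_prod_nth_stable[of m "Suc k"]
        by (simp only: L_def fps_nth_Abs_fps lessThan_Suc_atMost)
    qed
  qed
  moreover have "L \<noteq> 0" using L1 by auto
  ultimately have "(\<lambda>m. 1 - fps_X ^ Suc m) has_prod L"
    by (simp add: has_prod_def raw_has_prod_def)
  then have "qinf = L" unfolding qinf_def by (rule has_prod_unique[symmetric])
  then show ?thesis using L1 by simp
qed

lemma inverse_qinf_power: "inverse (qinf ^ n) = part_gf ^ n"
  by (rule fps_inverse_unique) (simp add: power_mult_distrib[symmetric] qinf_part_gf)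

definition part_tuples :: "nat \<Rightarrow> nat \<Rightarrow> (nat \<Rightarrow> nat \<Rightarrow> nat) set" where
  "part_tuples n m = {h. (\<forall>i<n. is_part (h i)) \<and> (\<forall>i\<ge>n. h i = (\<lambda>_. 0)) \<and> (\<Sum>i<n. psize (h i)) = m}"

lemma part_tuples_Suc:
  "bij_betw (\<lambda>h. (psize (h n), h n, h(n := \<lambda>_. 0))) (part_tuples (Suc n) m)
     (SIGMA i:{0..m}. {f. is_part f \<and> psize f = i} \<times> part_tuples n (m - i))"
proof (rule bij_betw_byWitness[where f' = "\<lambda>(i, f, h). h(n := f)"])
  show "(\<lambda>h. (psize (h n), h n, h(n := \<lambda>_. 0))) ` part_tuples (Suc n) m
     \<subseteq> (SIGMA i:{0..m}. {f. is_part f \<and> psize f = i} \<times> part_tuples n (m - i))"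
    by (auto simp: part_tuples_def)
  show "(\<lambda>(i, f, h). h(n := f)) ` (SIGMA i:{0..m}. {f. is_part f \<and> psize f = i} \<times> part_tuples n (m - i))
     \<subseteq> part_tuples (Suc n) m"
    by (auto simp: part_tuples_def less_Suc_eq)
qed (auto simp: part_tuples_def fun_eq_iff)

lemma part_gf_power_nth:
  "finite (part_tuples n m) \<and> (part_gf ^ n) $ m = of_nat (card (part_tuples n m))"
proof (induction n arbitrary: m)
  case 0
  have "part_tuples 0 m = (if m = 0 then {\<lambda>_ _. 0} else {})"
    by (auto simp: part_tuples_def)
  then show ?case by simp
next
  case (Suc n)
  let ?S = "SIGMA i:{0..m}. {f. is_part f \<and> psize f = i} \<times> part_tuples n (m - i)"
  have fin: "finite ?S"
    using Suc finite_parts_of by (intro finite_SigmaI finite_cartesian_product) auto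
  have "(part_gf ^ Suc n) $ m = (\<Sum>i=0..m. part_gf $ i * (part_gf ^ n) $ (m - i))"
    by (simp add: fps_mult_nth)
  also have "\<dots> = of_nat (\<Sum>i=0..m. card ({f. is_part f \<and> psize f = i} \<times> part_tuples n (m - i)))"
    using Suc by (simp add: part_gf_def card_cartesian_product)
  also have "\<dots> = of_nat (card ?S)"
    using Suc finite_parts_of by (subst card_SigmaI) auto
  also have "card ?S = card (part_tuples (Suc n) m)"
    using bij_betw_same_card[OF part_tuples_Suc] by simp
  finally show ?case using bij_betw_finite[OF part_tuples_Suc] fin by blast
qed

text \<open>
  An \<open>n\<close>-tuple of partitions, extended periodically to all of \<open>\<int>\<close> so that rows with arbitrary
  integer indices can be exchanged.
\<close>

definition part_families :: "int \<Rightarrow> (int \<Rightarrow> nat \<Rightarrow> nat) set" where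
  "part_families n = {\<mu>. (\<forall>s. \<mu> (s + n) = \<mu> s) \<and> (\<forall>s. is_part (\<mu> s))}"

definition family_size :: "int \<Rightarrow> (int \<Rightarrow> nat \<Rightarrow> nat) \<Rightarrow> nat" where
  "family_size n \<mu> = (\<Sum>s\<in>{0..<n}. psize (\<mu> s))"

lemma part_familiesD:
  assumes "\<mu> \<in> part_families n"
  shows "is_part (\<mu> s)" "\<mu> (s + n) = \<mu> s" "\<mu> (s + n * k) = \<mu> s" "s mod n = t mod n \<Longrightarrow> \<mu> s = \<mu> t"
proof -
  have per: "\<mu> (s + n) = \<mu> s" for s using assms by (auto simp: part_families_def)
  show mult: "\<mu> (s + n * k) = \<mu> s" for s k by (rule periodic_mult) (rule per)
  show "s mod n = t mod n \<Longrightarrow> \<mu> s = \<mu> t" using mult by (metis mod_eqE)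
  show "is_part (\<mu> s)" "\<mu> (s + n) = \<mu> s" using assms per by (auto simp: part_families_def)
qed

lemma card_part_families:
  assumes "n > 0"
  shows "finite {\<mu> \<in> part_families (int n). family_size (int n) \<mu> = m}"
    and "(part_gf ^ n) $ m = of_nat (card {\<mu> \<in> part_families (int n). family_size (int n) \<mu> = m})"
proof -
  let ?S = "{\<mu> \<in> part_families (int n). family_size (int n) \<mu> = m}"
  have win: "(\<Sum>i<n. F (int i)) = (\<Sum>s\<in>{0..<int n}. F s)" for F :: "int \<Rightarrow> nat"
    by (rule sum.reindex_bij_witness[of _ nat int]) auto
  have bij: "bij_betw (\<lambda>\<mu> i. if i < n then \<mu> (int i) else (\<lambda>_. 0)) ?S (part_tuples n m)"
  proof (rule bij_betw_byWitness[where f' = "\<lambda>h s. h (nat (s mod int n))"])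
    show "\<forall>\<mu>\<in>?S. (\<lambda>s. if nat (s mod int n) < n then \<mu> (int (nat (s mod int n))) else (\<lambda>_. 0)) = \<mu>"
    proof (intro ballI ext)
      fix \<mu> s k assume "\<mu> \<in> ?S"
      then have "\<mu> (s mod int n) = \<mu> s" by (intro part_familiesD(4)[of \<mu> "int n"]) auto
      then show "(if nat (s mod int n) < n then \<mu> (int (nat (s mod int n))) else (\<lambda>_. 0)) k = \<mu> s k"
        using assms by (simp add: nat_less_iff)
    qed
    show "\<forall>h\<in>part_tuples n m. (\<lambda>i. if i < n then h (nat (int i mod int n)) else (\<lambda>_. 0)) = h"
      by (auto simp: part_tuples_def fun_eq_iff)
    show "(\<lambda>\<mu> i. if i < n then \<mu> (int i) else (\<lambda>_. 0)) ` ?S \<subseteq> part_tuples n m"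
      by (auto simp: part_tuples_def part_families_def family_size_def win[symmetric])
    show "(\<lambda>h s. h (nat (s mod int n))) ` part_tuples n m \<subseteq> ?S"
      using assms by (auto simp: part_tuples_def part_families_def family_size_def win[symmetric] nat_less_iff)
  qed
  show "finite ?S" using bij_betw_finite[OF bij] part_gf_power_nth by blast
  show "(part_gf ^ n) $ m = of_nat (card ?S)"
    using bij_betw_same_card[OF bij] part_gf_power_nth by simp
qed

section \<open>Families of lattice paths on a cylinder\<close>

text \<open>
  A partition \<open>f\<close> is drawn as a lattice path: it comes down from infinity in column \<open>x\<close>, and its
  horizontal step out of column \<open>x + k\<close> runs at height \<open>a + f k\<close>, so that it finally runs off to
  the right at height \<open>a\<close>.  The predicate describes the region to the left of and below this path.
  In terms of the region the infinite initial part of the path needs no special treatment.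
\<close>

definition below :: "int \<Rightarrow> int \<Rightarrow> (nat \<Rightarrow> nat) \<Rightarrow> int \<Rightarrow> int \<Rightarrow> bool" where
  "below x a f i y \<longleftrightarrow> i < x \<or> y < a + int (f (nat (i - x)))"

text \<open>
  The vertices of the path are the points outside the region whose diagonal predecessor is inside.
\<close>

definition on_path :: "int \<Rightarrow> int \<Rightarrow> (nat \<Rightarrow> nat) \<Rightarrow> int \<Rightarrow> int \<Rightarrow> bool" where
  "on_path x a f i y \<longleftrightarrow> \<not> below x a f i y \<and> below x a f (i - 1) (y - 1)"

text \<open>
  The path that follows the second path before column \<open>i0\<close> and the first path from there on.  It
  starts in column \<open>x'\<close> and ends at height \<open>a\<close>, so its parts are those of \<open>f'\<close> raised by \<open>a' - a\<close>,
  followed by the remaining parts of \<open>f\<close>.  The conversion to \<open>nat\<close> truncates nothing if the two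
  paths meet in column \<open>i0\<close>.
\<close>

definition splice ::
    "int \<Rightarrow> int \<Rightarrow> (nat \<Rightarrow> nat) \<Rightarrow> int \<Rightarrow> int \<Rightarrow> (nat \<Rightarrow> nat) \<Rightarrow> int \<Rightarrow> nat \<Rightarrow> nat" where
  "splice x a f x' a' f' i0 = (\<lambda>k. if int k < i0 - x' then nat (a' + int (f' k) - a)
     else f (nat (int k + x' - x)))"

lemma below_antimono:
  assumes "is_part f" "below x a f i y" "i' \<le> i" "y' \<le> y"
  shows "below x a f i' y'"
proof (cases "i' < x")
  case False
  then have "f (nat (i - x)) \<le> f (nat (i' - x))"
    using assms(3) by (intro is_part_antimono[OF assms(1)]) auto
  then show ?thesis using assms False by (auto simp: below_def)
qed (simp add: below_def)

context
  fixes x a x' a' i0 y0 :: int and f f' :: "nat \<Rightarrow> nat"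
  assumes f: "is_part f" and f': "is_part f'"
    and on: "on_path x a f i0 y0" and on': "on_path x' a' f' i0 y0"
begin

lemma splice_start: "x \<le> i0" "x' \<le> i0"
  using on on' by (auto simp: on_path_def below_def)

lemma splice_tail_le: "a + int (f (nat (i0 - x))) \<le> y0"
  using on by (auto simp: on_path_def below_def)

lemma splice_head_ge:
  assumes "int k < i0 - x'"
  shows "y0 \<le> a' + int (f' k)"
proof -
  have "y0 \<le> a' + int (f' (nat (i0 - 1 - x')))"
    using on' assms by (auto simp: on_path_def below_def)
  also have "f' (nat (i0 - 1 - x')) \<le> f' k"
    using assms by (intro is_part_antimono[OF f']) auto
  finally show ?thesis by simp
qed

lemma splice_head:
  assumes "int k < i0 - x'"
  shows "int (splice x a f x' a' f' i0 k) = a' + int (f' k) - a"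
  using splice_head_ge[OF assms] splice_tail_le assms by (simp add: splice_def)

lemma splice_tail: "\<not> int k < i0 - x' \<Longrightarrow> splice x a f x' a' f' i0 k = f (nat (int k + x' - x))"
  by (simp add: splice_def)

text \<open>
  Splicing paths is splicing regions along a vertical line.
\<close>

lemma below_splice:
  "below x' a (splice x a f x' a' f' i0) i y \<longleftrightarrow> (if i < i0 then below x' a' f' i y else below x a f i y)"
proof (cases "i < x'")
  case True
  then show ?thesis using splice_start by (auto simp: below_def)
next
  case False
  show ?thesis
  proof (cases "i < i0")
    case True
    then show ?thesis using False splice_head[of "nat (i - x')"] by (simp add: below_def)
  next
    case ni: False
    then show ?thesis using False splice_tail[of "nat (i - x')"] splice_start by (simp add: below_def)
  qed
qed

text \<open>
  The vertices in column \<open>i0\<close> at or above the meeting point come from the path that supplies the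
  initial part, the ones below it from the other path; at the meeting point itself both agree.  So
  exchanging initial parts preserves the multiset of vertices of the two paths.
\<close>

lemma on_path_splice:
  "on_path x' a (splice x a f x' a' f' i0) i y \<longleftrightarrow>
     (if i < i0 \<or> i = i0 \<and> y0 \<le> y then on_path x' a' f' i y else on_path x a f i y)"
proof -
  consider "i < i0" | "i > i0" | "i = i0" "y0 \<le> y" | "i = i0" "y < y0" by linarith
  then show ?thesis
  proof cases
    case 3
    have "\<not> below x a f i0 y" "\<not> below x' a' f' i0 y"
      using below_antimono[OF f _ order_refl 3(2)] below_antimono[OF f' _ order_refl 3(2)] on on'
      by (auto simp: on_path_def)
    then show ?thesis using 3 by (auto simp: on_path_def below_splice)
  next
    case 4
    have "below x a f (i0 - 1) (y - 1)" "below x' a' f' (i0 - 1) (y - 1)"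
      using on on' 4 by (auto simp: on_path_def intro: below_antimono[OF f] below_antimono[OF f'])
    then show ?thesis using 4 by (auto simp: on_path_def below_splice)
  qed (auto simp: on_path_def below_splice)
qed

lemma is_part_splice: "is_part (splice x a f x' a' f' i0)"
proof -
  obtain K where K: "\<And>k. k \<ge> K \<Longrightarrow> f k = 0" using is_part_bound[OF f] by blast
  show ?thesis
  proof (rule is_partI)
    fix k
    consider "int (Suc k) < i0 - x'" | "int k = i0 - x' - 1" | "int k \<ge> i0 - x'" by linarith
    then show "splice x a f x' a' f' i0 (Suc k) \<le> splice x a f x' a' f' i0 k"
    proof cases
      case 1
      then show ?thesis
        using splice_head[of k] splice_head[of "Suc k"] is_part_antimono[OF f', of k "Suc k"] by simp
    next
      case 2
      then have "int (Suc k) + x' - x = i0 - x" by simp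
      then have "splice x a f x' a' f' i0 (Suc k) = f (nat (i0 - x))"
        using splice_tail[of "Suc k"] 2 by simp
      then show ?thesis using 2 splice_head[of k] splice_head_ge[of k] splice_tail_le by simp
    next
      case 3
      then show ?thesis
        using splice_tail[of k] splice_tail[of "Suc k"]
        by (auto intro!: is_part_antimono[OF f] nat_mono)
    qed
  next
    fix k assume "k \<ge> nat (i0 - x') + K + nat \<bar>x' - x\<bar>"
    then show "splice x a f x' a' f' i0 k = 0" by (auto simp: splice_tail intro!: K)
  qed
qed

lemma psize_splice_half:
  "int (psize (splice x a f x' a' f' i0)) =
     (i0 - x') * (a' - a) + (\<Sum>k<nat (i0 - x'). int (f' k)) + int (psize (\<lambda>k. f (k + nat (i0 - x))))"
proof -
  let ?K = "nat (i0 - x')"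
  have "(\<Sum>k<?K. int (splice x a f x' a' f' i0 k)) = (\<Sum>k<?K. (a' - a) + int (f' k))"
    by (rule sum.cong) (auto simp: splice_head)
  also have "\<dots> = (i0 - x') * (a' - a) + (\<Sum>k<?K. int (f' k))"
    using splice_start by (simp add: sum.distrib)
  finally have h: "(\<Sum>k<?K. int (splice x a f x' a' f' i0 k)) = \<dots>" .
  have "(\<lambda>k. splice x a f x' a' f' i0 (k + ?K)) = (\<lambda>k. f (k + nat (i0 - x)))"
  proof
    fix k
    have "nat (int (k + ?K) + x' - x) = k + nat (i0 - x)" using splice_start by simp
    then show "splice x a f x' a' f' i0 (k + ?K) = f (k + nat (i0 - x))"
      using splice_tail[of "k + ?K"] splice_start by simp
  qed
  then show ?thesis using psize_split[OF is_part_splice, of ?K] h by (simp add: of_nat_sum)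
qed

end

text \<open>
  Cutting at column \<open>i0\<close>, the two initial parts contain \<open>i0 - x'\<close> and \<open>i0 - x\<close> parts, which are
  shifted by opposite amounts.  The position \<open>i0\<close> of the cut cancels.
\<close>

lemma psize_splice:
  assumes "is_part f" "is_part f'" "on_path x a f i0 y0" "on_path x' a' f' i0 y0"
  shows "int (psize (splice x a f x' a' f' i0)) + int (psize (splice x' a' f' x a f i0)) =
     int (psize f) + int (psize f') + (a' - a) * (x - x')"
  using psize_splice_half[OF assms] psize_splice_half[OF assms(2,1,4,3)]
    psize_split[OF assms(1), of "nat (i0 - x)"] psize_split[OF assms(2), of "nat (i0 - x')"]
  by (simp add: of_nat_sum algebra_simps)

lemma splice_splice:
  assumes "is_part f" "is_part f'" "on_path x a f i0 y0" "on_path x' a' f' i0 y0"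
  shows "splice x' a (splice x a f x' a' f' i0) x a' (splice x' a' f' x a f i0) i0 = f"
proof
  fix k
  show "splice x' a (splice x a f x' a' f' i0) x a' (splice x' a' f' x a f i0) i0 k = f k"
  proof (cases "int k < i0 - x")
    case True
    then show ?thesis using splice_head[OF assms(2,1,4,3) True] by (simp add: splice_def)
  next
    case False
    then have "int (nat (int k + x - x')) = int k + x - x'"
      using splice_start[OF assms] by simp
    then show ?thesis using False splice_start[OF assms] by (simp add: splice_def)
  qed
qed

type_synonym config = "(int \<Rightarrow> int) \<times> (int \<Rightarrow> nat \<Rightarrow> nat)"

text \<open>
  Row \<open>s\<close> of a configuration is a path ending at height \<open>A s\<close>.  Rows \<open>s\<close> and \<open>s + n\<close> differ by the
  translation \<open>(N, p)\<close>, so a configuration lives on a cylinder.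
\<close>

locale cylinder =
  fixes n N p :: int and g A :: "int \<Rightarrow> int"
  assumes n_ge_2: "n \<ge> 2" and N_pos: "N > 0" and p_pos: "p > 0"
    and g_step: "g s < g (s + 1)" and g_period: "g (s + n) = g s + N"
    and A_step: "A s < A (s + 1)" and A_period: "A (s + n) = A s + p"
begin

lemma strict_mono_g: "strict_mono g" and strict_mono_A: "strict_mono A"
  using g_step A_step by (auto intro: strict_mono_int_stepI)

lemma g_less: "g s < g t \<longleftrightarrow> s < t" and A_less: "A s < A t \<longleftrightarrow> s < t"
  using strict_mono_g strict_mono_A by (auto simp: strict_mono_less)

lemma g_mult: "g (s + n * k) = g s + N * k" and A_mult: "A (s + n * k) = A s + p * k"
  by (rule quasiperiodic_multiple, rule g_period) (rule quasiperiodic_multiple, rule A_period)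

abbreviation configs :: "config set" where
  "configs \<equiv> affine_perms n \<times> part_families n"

definition passes :: "config \<Rightarrow> int \<Rightarrow> int \<Rightarrow> int \<Rightarrow> bool" where
  "passes c s i y \<longleftrightarrow> on_path (g (fst c s)) (A s) (snd c s) i y"

lemma passes_shift:
  assumes "c \<in> configs"
  shows "passes c (s + n * k) i y \<longleftrightarrow> passes c s (i - N * k) (y - p * k)"
proof -
  have u: "fst c (s + n * k) = fst c s + n * k" and m: "snd c (s + n * k) = snd c s"
    using assms affine_permsD(3) part_familiesD(3) by auto
  have d: "i - N * k - g (fst c s) = i - (g (fst c s) + N * k)"
    "i - N * k - 1 - g (fst c s) = i - 1 - (g (fst c s) + N * k)" by simp_all
  show ?thesis
    unfolding passes_def on_path_def below_def u m g_mult A_mult d by auto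
qed

text \<open>
  A path never meets its own translates: these are displaced upwards and to the right, or downwards
  and to the left, whereas the path runs downwards and to the right.
\<close>

lemma passes_congruent:
  assumes c: "c \<in> configs" and "passes c s i y" "passes c t i y" "s mod n = t mod n"
  shows "s = t"
proof -
  have less: False if st: "s < t" "s mod n = t mod n" and s: "passes c s i y" and t: "passes c t i y" for s t
  proof -
    obtain k where k: "t = s + n * k" using st by (metis mod_eqE)
    then have "k > 0" using st n_ge_2 by (simp add: zero_less_mult_iff)
    then have le: "i - N * k \<le> i - 1" "y - p * k \<le> y - 1"
      using N_pos p_pos by (simp_all add: Suc_le_eq int_one_le_iff_zero_less)
    have "passes c s (i - N * k) (y - p * k)" using t passes_shift[OF c] k by simp
    moreover have "is_part (snd c s)" using c part_familiesD(1) by auto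
    ultimately show False
      using s below_antimono[OF _ _ le, of "snd c s" "g (fst c s)" "A s"]
      by (auto simp: passes_def on_path_def)
  qed
  then show ?thesis using assms by (metis linorder_neqE)
qed

text \<open>
  Exchange of the parts of rows \<open>s\<close> and \<open>t\<close> before column \<open>i0\<close>, and simultaneously of all their
  translates.  The ends stay in place; the starting columns are exchanged, which multiplies the
  affine permutation by a reflection.
\<close>

definition swap_heads ::
    "config \<Rightarrow> int \<Rightarrow> int \<Rightarrow> int \<Rightarrow> config" where
  "swap_heads c s t i0 = (let u = fst c; \<mu> = snd c in
     (u \<circ> affine_transp n s t,
      \<lambda>r. if r mod n = s mod n then splice (g (u s)) (A s) (\<mu> s) (g (u t)) (A t) (\<mu> t) i0
          else if r mod n = t mod n then splice (g (u t)) (A t) (\<mu> t) (g (u s)) (A s) (\<mu> s) i0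
          else \<mu> r))"

definition crossings :: "config \<Rightarrow> (int \<times> int) set" where
  "crossings c = {(i, y). \<exists>s t. s \<noteq> t \<and> passes c s i y \<and> passes c t i y}"

text \<open>
  The quantity \<open>p x - N y\<close> is invariant under the translation \<open>(N, p)\<close>, so its square, evaluated at
  \<open>x = g (u s)\<close> and \<open>y = A s\<close>, is a well-defined function on the cylinder.  Its mixed term is, after
  the normalisation, \<open>- x y\<close>, and this compensates the change of area in an exchange of initial
  parts.
\<close>

definition energy :: "(int \<Rightarrow> int) \<Rightarrow> real" where
  "energy u = (\<Sum>s\<in>{0..<n}. ((p * g (u s) - N * A s)\<^sup>2 - (p * g s - N * A s)\<^sup>2) / (2 * p * N))"

definition weight :: "config \<Rightarrow> real" where
  "weight c = real (family_size n (snd c)) + energy (fst c)"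

context
  fixes c s t i0 y0
  assumes c: "c \<in> configs" and st: "s \<noteq> t" and s: "passes c s i0 y0" and t: "passes c t i0 y0"
begin

lemma swap_noncongruent: "s mod n \<noteq> t mod n"
  using passes_congruent[OF c s t] st by blast

lemma swap_parts: "is_part (snd c r)"
  using c part_familiesD(1) by auto

lemmas swap_on = swap_parts swap_parts s[unfolded passes_def] t[unfolded passes_def]
lemmas swap_on' = swap_parts swap_parts t[unfolded passes_def] s[unfolded passes_def]

lemma swap_configs: "swap_heads c s t i0 \<in> configs"
proof -
  have "fst c \<in> affine_perms n" "n > 0" using c n_ge_2 by auto
  then have "fst c \<circ> affine_transp n s t \<in> affine_perms n"
    using affine_perm_transp swap_noncongruent by blast
  moreover have "snd c (r + n) = snd c r" for r
    using c by (auto simp: part_families_def)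
  ultimately show ?thesis
    using is_part_splice[OF swap_on] is_part_splice[OF swap_on'] swap_parts
    by (simp add: swap_heads_def Let_def part_families_def)
qed

lemma swap_fst: "fst (swap_heads c s t i0) = fst c \<circ> affine_transp n s t"
  by (simp add: swap_heads_def Let_def)

lemma swap_snd:
  "r mod n = s mod n \<Longrightarrow> snd (swap_heads c s t i0) r =
     splice (g (fst c s)) (A s) (snd c s) (g (fst c t)) (A t) (snd c t) i0"
  "r mod n = t mod n \<Longrightarrow> snd (swap_heads c s t i0) r =
     splice (g (fst c t)) (A t) (snd c t) (g (fst c s)) (A s) (snd c s) i0"
  "r mod n \<noteq> s mod n \<Longrightarrow> r mod n \<noteq> t mod n \<Longrightarrow> snd (swap_heads c s t i0) r = snd c r"
  using swap_noncongruent by (auto simp: swap_heads_def Let_def)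

text \<open>
  Which row of the original configuration passes through \<open>(i, y)\<close> where row \<open>r\<close> does after the
  exchange.  The exchange of the \<open>k\<close>-th translates of \<open>s\<close> and \<open>t\<close> affects the vertices that precede
  the \<open>k\<close>-th translate of the crossing point, so the map depends on \<open>k\<close> and is not an affine
  permutation; it is an involution for each fixed vertex.
\<close>

definition reroute :: "int \<Rightarrow> int \<Rightarrow> int \<Rightarrow> int" where
  "reroute i y r =
    (let ahead = (\<lambda>k. i < i0 + N * k \<or> i = i0 + N * k \<and> y0 + p * k \<le> y) in
     if r mod n = s mod n \<and> ahead ((r - s) div n) \<or> r mod n = t mod n \<and> ahead ((r - t) div n)
     then affine_transp n s t r else r)"

lemma reroute_simps:
  "reroute i y (s + n * k) = (if i < i0 + N * k \<or> i = i0 + N * k \<and> y0 + p * k \<le> y then t + n * k else s + n * k)"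
  "reroute i y (t + n * k) = (if i < i0 + N * k \<or> i = i0 + N * k \<and> y0 + p * k \<le> y then s + n * k else t + n * k)"
  "r mod n \<noteq> s mod n \<Longrightarrow> r mod n \<noteq> t mod n \<Longrightarrow> reroute i y r = r"
  using swap_noncongruent n_ge_2 affine_transp_simps[OF swap_noncongruent]
  by (simp_all add: reroute_def Let_def)

lemma row_cases:
  obtains k where "r = s + n * k" | k where "r = t + n * k" | "r mod n \<noteq> s mod n" "r mod n \<noteq> t mod n"
  by (metis mod_eqE)

lemma reroute_invol: "reroute i y (reroute i y r) = r"
  by (rule row_cases[of r]) (auto simp: reroute_simps)

lemma passes_swap: "passes (swap_heads c s t i0) r i y \<longleftrightarrow> passes c (reroute i y r) i y"
proof (rule row_cases[of r])
  fix k assume r: "r = s + n * k"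
  have "passes (swap_heads c s t i0) r i y \<longleftrightarrow> passes (swap_heads c s t i0) s (i - N * k) (y - p * k)"
    unfolding r by (rule passes_shift[OF swap_configs])
  also have "\<dots> \<longleftrightarrow> on_path (g (fst c t)) (A s)
      (splice (g (fst c s)) (A s) (snd c s) (g (fst c t)) (A t) (snd c t) i0) (i - N * k) (y - p * k)"
    unfolding passes_def by (simp add: swap_snd swap_fst affine_transp_simps[OF swap_noncongruent])
  also have "\<dots> \<longleftrightarrow> (if i < i0 + N * k \<or> i = i0 + N * k \<and> y0 + p * k \<le> y
      then passes c t (i - N * k) (y - p * k) else passes c s (i - N * k) (y - p * k))"
    unfolding on_path_splice[OF swap_on] passes_def by (auto simp: algebra_simps)
  also have "\<dots> \<longleftrightarrow> passes c (reroute i y r) i y"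
    unfolding r reroute_simps by (simp add: passes_shift[OF c])
  finally show ?thesis .
next
  fix k assume r: "r = t + n * k"
  have "passes (swap_heads c s t i0) r i y \<longleftrightarrow> passes (swap_heads c s t i0) t (i - N * k) (y - p * k)"
    unfolding r by (rule passes_shift[OF swap_configs])
  also have "\<dots> \<longleftrightarrow> on_path (g (fst c s)) (A t)
      (splice (g (fst c t)) (A t) (snd c t) (g (fst c s)) (A s) (snd c s) i0) (i - N * k) (y - p * k)"
    unfolding passes_def by (simp add: swap_snd swap_fst affine_transp_simps[OF swap_noncongruent])
  also have "\<dots> \<longleftrightarrow> (if i < i0 + N * k \<or> i = i0 + N * k \<and> y0 + p * k \<le> y
      then passes c s (i - N * k) (y - p * k) else passes c t (i - N * k) (y - p * k))"
    unfolding on_path_splice[OF swap_on'] passes_def by (auto simp: algebra_simps)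
  also have "\<dots> \<longleftrightarrow> passes c (reroute i y r) i y"
    unfolding r reroute_simps by (simp add: passes_shift[OF c])
  finally show ?thesis .
next
  assume "r mod n \<noteq> s mod n" "r mod n \<noteq> t mod n"
  then show ?thesis
    by (simp add: passes_def swap_snd swap_fst reroute_simps affine_transp_simps[OF swap_noncongruent])
qed

lemma swap_passes_s: "passes (swap_heads c s t i0) s i0 y0"
  and swap_passes_t: "passes (swap_heads c s t i0) t i0 y0"
  using reroute_simps(1)[of i0 y0 0] reroute_simps(2)[of i0 y0 0] s t by (simp_all add: passes_swap)

lemma swap_heads_swap_heads: "swap_heads (swap_heads c s t i0) s t i0 = c"
proof (rule prod_eqI)
  show "fst (swap_heads (swap_heads c s t i0) s t i0) = fst c"
    by (simp add: fun_eq_iff swap_heads_def Let_def affine_transp_invol[OF swap_noncongruent])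
  have "snd (swap_heads (swap_heads c s t i0) s t i0) r = snd c r" for r
  proof (rule row_cases[of r])
    fix k assume r: "r = s + n * k"
    have "snd (swap_heads (swap_heads c s t i0) s t i0) r = snd c s"
      using swap_noncongruent splice_splice[OF swap_on] affine_transp_simps[OF swap_noncongruent]
      by (simp add: swap_heads_def Let_def r)
    moreover have "snd c r = snd c s" unfolding r by (rule part_familiesD(3)) (use c in auto)
    ultimately show ?thesis by simp
  next
    fix k assume r: "r = t + n * k"
    have "snd (swap_heads (swap_heads c s t i0) s t i0) r = snd c t"
      using swap_noncongruent splice_splice[OF swap_on'] affine_transp_simps[OF swap_noncongruent]
      by (simp add: swap_heads_def Let_def r)
    moreover have "snd c r = snd c t" unfolding r by (rule part_familiesD(3)) (use c in auto)
    ultimately show ?thesis by simp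
  qed (simp add: swap_heads_def Let_def)
  then show "snd (swap_heads (swap_heads c s t i0) s t i0) = snd c" by blast
qed

text \<open>
  Through each vertex pass as many rows as before, since \<open>reroute\<close> is injective.
\<close>

lemma crossings_swap_subset: "crossings (swap_heads c s t i0) \<subseteq> crossings c"
proof -
  have "reroute i y r \<noteq> reroute i y r'" if "r \<noteq> r'" for i y r r'
    using that reroute_invol by metis
  then show ?thesis unfolding crossings_def passes_swap by blast
qed

text \<open>
  Apart from \<open>s\<close> and \<open>t\<close>, which pass through the crossing point before and after the exchange, only
  rows congruent to them could be affected there, and these are kept away by \<open>passes_congruent\<close>.
\<close>

lemma rows_swap_subset:
  assumes "passes (swap_heads c s t i0) r i0 y0"
  shows "passes c r i0 y0"
proof (rule row_cases[of r])
  fix k assume "r = s + n * k"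
  then have "r = s" using passes_congruent[OF swap_configs assms swap_passes_s] by simp
  then show ?thesis using s by simp
next
  fix k assume "r = t + n * k"
  then have "r = t" using passes_congruent[OF swap_configs assms swap_passes_t] by simp
  then show ?thesis using t by simp
qed (use assms passes_swap reroute_simps(3) in auto)

lemma aperm_sign_swap: "aperm_sign n (fst (swap_heads c s t i0)) = - aperm_sign n (fst c)"
  unfolding swap_fst by (rule aperm_sign_transp) (use c n_ge_2 swap_noncongruent in auto)

text \<open>
  The area changes by \<open>(A t - A s) * (g (u s) - g (u t))\<close>, by \<open>psize_splice\<close>.  In the energy only the
  mixed terms of the two squares of rows \<open>s\<close> and \<open>t\<close> change, by the opposite amount.
\<close>

lemma weight_swap: "weight (swap_heads c s t i0) = weight c"
proof -
  let ?c' = "swap_heads c s t i0"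
  have n: "n > 0" using n_ge_2 by simp
  let ?x = "g (fst c s)" and ?x' = "g (fst c t)"
  have size: "int (family_size n (snd ?c')) = int (family_size n (snd c)) + (A t - A s) * (?x - ?x')"
  proof -
    have "family_size n (snd ?c') = psize (snd ?c' (s mod n)) + (psize (snd ?c' (t mod n)) +
       (\<Sum>r\<in>{0..<n} - {s mod n, t mod n}. psize (snd ?c' r)))"
      unfolding family_size_def by (rule two_residues_sum[OF n swap_noncongruent])
    moreover have "family_size n (snd c) = psize (snd c (s mod n)) + (psize (snd c (t mod n)) +
       (\<Sum>r\<in>{0..<n} - {s mod n, t mod n}. psize (snd c r)))"
      unfolding family_size_def by (rule two_residues_sum[OF n swap_noncongruent])
    moreover have "(\<Sum>r\<in>{0..<n} - {s mod n, t mod n}. psize (snd ?c' r))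
        = (\<Sum>r\<in>{0..<n} - {s mod n, t mod n}. psize (snd c r))"
      by (rule sum.cong) (auto simp: swap_snd)
    moreover have "snd c (s mod n) = snd c s" "snd c (t mod n) = snd c t"
      by (rule part_familiesD(4)[of _ n]; use c in auto)+
    moreover have "int (psize (snd ?c' (s mod n))) + int (psize (snd ?c' (t mod n))) =
       int (psize (snd c s)) + int (psize (snd c t)) + (A t - A s) * (?x - ?x')"
      using psize_splice[OF swap_on] by (simp add: swap_snd)
    ultimately show ?thesis by simp
  qed
  define H where "H = (\<lambda>(u :: int \<Rightarrow> int) r. ((p * g (u r) - N * A r)\<^sup>2 - (p * g r - N * A r)\<^sup>2) / (2 * p * N) :: real)"
  have H_per: "H u (r + n) = H u r" if "u \<in> affine_perms n" for u r
  proof -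
    have "p * g (u (r + n)) - N * A (r + n) = p * g (u r) - N * A r"
      "p * g (r + n) - N * A (r + n) = p * g r - N * A r"
      unfolding affine_permsD(2)[OF that] g_period A_period by (simp_all add: algebra_simps)
    then show ?thesis by (simp only: H_def)
  qed
  have u: "fst c \<in> affine_perms n" and u': "fst ?c' \<in> affine_perms n" using c swap_configs by auto
  have en: "energy u = H u s + (H u t + (\<Sum>r\<in>{0..<n} - {s mod n, t mod n}. H u r))"
    if "u \<in> affine_perms n" for u
  proof -
    have "energy u = (\<Sum>r\<in>{0..<n}. H u r)" by (simp add: energy_def H_def)
    also have "\<dots> = H u (s mod n) + (H u (t mod n) + (\<Sum>r\<in>{0..<n} - {s mod n, t mod n}. H u r))"
      by (rule two_residues_sum[OF n swap_noncongruent])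
    also have "H u (s mod n) = H u s" by (rule periodic_mod, rule H_per[OF that])
    also have "H u (t mod n) = H u t" by (rule periodic_mod, rule H_per[OF that])
    finally show ?thesis .
  qed
  have "(\<Sum>r\<in>{0..<n} - {s mod n, t mod n}. H (fst ?c') r) = (\<Sum>r\<in>{0..<n} - {s mod n, t mod n}. H (fst c) r)"
    by (rule sum.cong) (auto simp: H_def swap_fst affine_transp_simps[OF swap_noncongruent])
  then have "energy (fst ?c') - energy (fst c) = H (fst ?c') s + H (fst ?c') t - H (fst c) s - H (fst c) t"
    using en[OF u] en[OF u'] by simp
  also have "\<dots> = ((p * ?x' - N * A s)\<^sup>2 + (p * ?x - N * A t)\<^sup>2 - (p * ?x - N * A s)\<^sup>2 - (p * ?x' - N * A t)\<^sup>2) / (2 * p * N)"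
    by (simp add: H_def swap_fst affine_transp_simps[OF swap_noncongruent] add_divide_distrib diff_divide_distrib)
  also have "real_of_int ((p * ?x' - N * A s)\<^sup>2 + (p * ?x - N * A t)\<^sup>2 - (p * ?x - N * A s)\<^sup>2 - (p * ?x' - N * A t)\<^sup>2)
      = - real_of_int ((A t - A s) * (?x - ?x')) * (2 * p * N)"
    by (simp add: power2_eq_square algebra_simps)
  also have "\<dots> / (2 * p * N) = - real_of_int ((A t - A s) * (?x - ?x'))"
    using N_pos p_pos by simp
  finally have "energy (fst ?c') - energy (fst c) = - real_of_int ((A t - A s) * (?x - ?x'))" .
  moreover have "real (family_size n (snd ?c')) - real (family_size n (snd c)) = real_of_int ((A t - A s) * (?x - ?x'))"
    using arg_cong[OF size, of real_of_int] by simp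
  ultimately show ?thesis by (simp add: weight_def)
qed

end

lemma crossings_swap:
  assumes "c \<in> configs" "s \<noteq> t" "passes c s i0 y0" "passes c t i0 y0"
  shows "crossings (swap_heads c s t i0) = crossings c"
  using crossings_swap_subset[OF assms]
    crossings_swap_subset[OF swap_configs[OF assms] assms(2) swap_passes_s[OF assms] swap_passes_t[OF assms]]
  by (simp add: swap_heads_swap_heads[OF assms])

lemma rows_swap:
  assumes "c \<in> configs" "s \<noteq> t" "passes c s i0 y0" "passes c t i0 y0"
  shows "passes (swap_heads c s t i0) r i0 y0 \<longleftrightarrow> passes c r i0 y0"
  using rows_swap_subset[OF assms]
    rows_swap_subset[OF swap_configs[OF assms] assms(2) swap_passes_s[OF assms] swap_passes_t[OF assms]]
  by (auto simp: swap_heads_swap_heads[OF assms])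

text \<open>
  Any choice is as good as any other, provided that it depends only on the set of crossings, which
  the exchange preserves; likewise for the pair of rows through the chosen point.  This is why
  \<open>uncross\<close> below is an involution.
\<close>

definition chosen_crossing :: "config \<Rightarrow> int \<times> int" where
  "chosen_crossing c = (SOME z. z \<in> crossings c)"

definition chosen_rows :: "config \<Rightarrow> int \<times> int" where
  "chosen_rows c = (let (i, y) = chosen_crossing c in
     SOME (s, t). s \<noteq> t \<and> passes c s i y \<and> passes c t i y)"

definition uncross :: "config \<Rightarrow> config" where
  "uncross c = swap_heads c (fst (chosen_rows c)) (snd (chosen_rows c)) (fst (chosen_crossing c))"

lemma chosen_rows_pass:
  assumes "crossings c \<noteq> {}"
  shows "fst (chosen_rows c) \<noteq> snd (chosen_rows c)"
    "passes c (fst (chosen_rows c)) (fst (chosen_crossing c)) (snd (chosen_crossing c))"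
    "passes c (snd (chosen_rows c)) (fst (chosen_crossing c)) (snd (chosen_crossing c))"
proof -
  have "chosen_crossing c \<in> crossings c"
    unfolding chosen_crossing_def using assms some_in_eq by blast
  then obtain i y s t where z: "chosen_crossing c = (i, y)"
    and st: "s \<noteq> t \<and> passes c s i y \<and> passes c t i y"
    unfolding crossings_def by blast
  have "case chosen_rows c of (s, t) \<Rightarrow> s \<noteq> t \<and> passes c s i y \<and> passes c t i y"
    unfolding chosen_rows_def z Let_def prod.case by (rule someI[of _ "(s, t)"]) (simp add: st)
  then show "fst (chosen_rows c) \<noteq> snd (chosen_rows c)"
    "passes c (fst (chosen_rows c)) (fst (chosen_crossing c)) (snd (chosen_crossing c))"
    "passes c (snd (chosen_rows c)) (fst (chosen_crossing c)) (snd (chosen_crossing c))"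
    by (auto simp: z case_prod_beta)
qed

lemma uncross:
  assumes "c \<in> configs" "crossings c \<noteq> {}"
  shows "uncross c \<in> configs" "crossings (uncross c) = crossings c" "uncross (uncross c) = c"
    "weight (uncross c) = weight c" "aperm_sign n (fst (uncross c)) = - aperm_sign n (fst c)"
proof -
  note h = assms(1) chosen_rows_pass[OF assms(2)]
  show "uncross c \<in> configs" "weight (uncross c) = weight c"
    "aperm_sign n (fst (uncross c)) = - aperm_sign n (fst c)"
    using swap_configs[OF h] weight_swap[OF h] aperm_sign_swap[OF h] by (auto simp: uncross_def)
  show X: "crossings (uncross c) = crossings c"
    using crossings_swap[OF h] by (simp add: uncross_def)
  then have "chosen_crossing (uncross c) = chosen_crossing c" by (simp add: chosen_crossing_def)
  moreover from this have "chosen_rows (uncross c) = chosen_rows c"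
    using rows_swap[OF h] by (simp add: chosen_rows_def uncross_def case_prod_beta)
  ultimately show "uncross (uncross c) = c"
    using swap_heads_swap_heads[OF h] by (simp add: uncross_def)
qed

text \<open>
  Row \<open>s\<close> leaves column \<open>i\<close> strictly below the height at which row \<open>s + 1\<close> leaves column \<open>i + 1\<close>,
  from the start of row \<open>s + 1\<close> on.  For \<open>A (s + 1) - A s = a + 1\<close> and \<open>g (s + 1) - g s = b + 1\<close> this is the Burge inequality
  \<open>\<mu> s (k + b) \<le> \<mu> (s + 1) k + a\<close>.
\<close>

definition burge :: "(int \<Rightarrow> nat \<Rightarrow> nat) \<Rightarrow> bool" where
  "burge \<mu> \<longleftrightarrow> (\<forall>s i. g (s + 1) - 1 \<le> i \<longrightarrow>
     A s + int (\<mu> s (nat (i - g s))) < A (s + 1) + int (\<mu> (s + 1) (nat (i + 1 - g (s + 1)))))"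

definition height :: "config \<Rightarrow> int \<Rightarrow> int \<Rightarrow> int" where
  "height c s i = A s + int (snd c s (nat (i - g (fst c s))))"

lemma passes_height:
  "passes c s i y \<longleftrightarrow> g (fst c s) \<le> i \<and> height c s i \<le> y \<and> (g (fst c s) < i \<longrightarrow> y \<le> height c s (i - 1))"
  by (auto simp: passes_def on_path_def below_def height_def)

lemma height_antimono:
  assumes c: "c \<in> configs" and "i \<le> j"
  shows "height c s j \<le> height c s i"
proof -
  have "is_part (snd c s)" using part_familiesD(1)[of "snd c" n] c by auto
  then have "snd c s (nat (j - g (fst c s))) \<le> snd c s (nat (i - g (fst c s)))"
    by (rule is_part_antimono) (use assms(2) in auto)
  then show ?thesis by (simp add: height_def)
qed

text \<open>
  Planarity: a path that starts further to the left stays below a path that starts further to the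
  right, because the first violation would be a common vertex.
\<close>

lemma no_crossing_separated:
  assumes c: "c \<in> configs" and none: "crossings c = {}" and rr': "g (fst c r) < g (fst c r')"
    and "i \<ge> g (fst c r')"
  shows "height c r (i - 1) < height c r' i"
  using assms(4)
proof (induction i rule: int_ge_induct)
  have no: False if "passes c r i y" "passes c r' i y" for i y
    using none that rr' by (fastforce simp: crossings_def)
  {
    case base
    show ?case
    proof (rule ccontr)
      let ?i = "g (fst c r')"
      assume "\<not> ?thesis"
      then have "passes c r ?i (height c r (?i - 1))" "passes c r' ?i (height c r (?i - 1))"
        using rr' height_antimono[OF c, of "?i - 1" ?i r] by (auto simp: passes_height)
      then show False using no by blast
    qed
  next
    case (step i)
    show ?case
    proof (rule ccontr)
      assume "\<not> ?thesis"
      then have "passes c r (i + 1) (height c r i)" "passes c r' (i + 1) (height c r i)"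
        using rr' step height_antimono[OF c, of i "i + 1" r] height_antimono[OF c, of "i - 1" i r]
        by (auto simp: passes_height)
      then show False using no by blast
    qed
  }
qed

lemma height_eventually: 
  assumes "c \<in> configs"
  obtains K where "\<And>i. i \<ge> K \<Longrightarrow> height c s i = A s"
proof -
  have "is_part (snd c s)" using assms part_familiesD(1) by auto
  then obtain K where "\<And>k. k \<ge> K \<Longrightarrow> snd c s k = 0" using is_part_bound by blast
  then show thesis by (intro that[of "g (fst c s) + int K"]) (auto simp: height_def)
qed

lemma burge_chain:
  assumes \<mu>: "\<mu> \<in> part_families n" and "burge \<mu>" and "s < t" "i \<ge> g t"
  shows "A s + int (\<mu> s (nat (i - 1 - g s))) < A t + int (\<mu> t (nat (i - g t)))"
  using assms(3,4)
proof (induction t rule: int_gr_induct)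
  case base
  then show ?case
    using \<open>burge \<mu>\<close>[unfolded burge_def, rule_format, of s "i - 1"] by simp
next
  case (step t)
  have "i \<ge> g t" using step.prems g_step[of t] by simp
  then have "A s + int (\<mu> s (nat (i - 1 - g s))) < A t + int (\<mu> t (nat (i - g t)))" using step by simp
  also have "\<mu> t (nat (i - g t)) \<le> \<mu> t (nat (i - 1 - g t))"
    by (rule is_part_antimono[OF part_familiesD(1)[OF \<mu>]]) simp
  also have "A t + int (\<mu> t (nat (i - 1 - g t))) < A (t + 1) + int (\<mu> (t + 1) (nat (i - g (t + 1))))"
    using \<open>burge \<mu>\<close>[unfolded burge_def, rule_format, of t "i - 1"] step.prems by simp
  finally show ?case by simp
qed

text \<open>
  Disjoint paths end in the order in which they start, so their affine permutation is increasing,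
  hence trivial; by planarity consecutive rows are then separated.  Conversely separation of
  consecutive rows propagates to all pairs of rows.
\<close>

lemma crossings_empty_iff:
  assumes c: "c \<in> configs"
  shows "crossings c = {} \<longleftrightarrow> fst c = (\<lambda>s. s) \<and> burge (snd c)"
proof
  assume none: "crossings c = {}"
  have u: "fst c \<in> affine_perms n" using c by auto
  have order: "r < r'" if "fst c r < fst c r'" for r r'
  proof -
    obtain K where K: "\<And>i. i \<ge> K \<Longrightarrow> height c r i = A r" using height_eventually[OF c, of r] by blast
    obtain K' where K': "\<And>i. i \<ge> K' \<Longrightarrow> height c r' i = A r'" using height_eventually[OF c, of r'] by blast
    let ?i = "max (max (K + 1) K') (g (fst c r'))"
    have "height c r (?i - 1) < height c r' ?i"
      by (rule no_crossing_separated[OF c none]) (use that g_less in auto)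
    then show ?thesis using K K' A_less by simp
  qed
  have "strict_mono (fst c)"
  proof (rule strict_monoI)
    fix x y :: int assume "x < y"
    then show "fst c x < fst c y"
      using order[of y x] affine_permsD(4)[OF u] by (metis less_asym linorder_neqE)
  qed
  then have id: "fst c = (\<lambda>s. s)"
    using strict_mono_affine_perm_id[OF u] n_ge_2 by auto
  moreover have "burge (snd c)"
    unfolding burge_def
  proof (intro allI impI)
    fix s i assume "g (s + 1) - 1 \<le> i"
    then have "height c s (i + 1 - 1) < height c (s + 1) (i + 1)"
      by (intro no_crossing_separated[OF c none]) (auto simp: id g_less)
    then show "A s + int (snd c s (nat (i - g s))) < A (s + 1) + int (snd c (s + 1) (nat (i + 1 - g (s + 1))))"
      by (simp add: height_def id)
  qed
  ultimately show "fst c = (\<lambda>s. s) \<and> burge (snd c)" by simp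
next
  assume *: "fst c = (\<lambda>s. s) \<and> burge (snd c)"
  have sep: "height c s (i - 1) < height c t i" if "s < t" "i \<ge> g t" for s t i
    using burge_chain[of "snd c" s t i] c * that by (auto simp: height_def)
  have no: False if "s < t" "passes c s i y" "passes c t i y" for s t i y
  proof -
    have "g s < g t" using that g_less by simp
    then show False using sep[of s t i] that * by (auto simp: passes_height)
  qed
  then show "crossings c = {}"
    unfolding crossings_def by (auto, metis linorder_neqE)
qed

text \<open>
  The energy is a sum of squares up to a constant, and \<open>g\<close> is unbounded in both directions, so a
  bound on the energy leaves finitely many values of \<open>u\<close> on a window.
\<close>

lemma energy_bound_finite: "finite {u \<in> affine_perms n. energy u \<le> B}"
proof -
  define C where "C = (\<Sum>s\<in>{0..<n}. real_of_int ((p * g s - N * A s)\<^sup>2))"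
  define D where "D = B * (2 * p * N) + C"
  define M where "M = \<lceil>D\<rceil> + (\<Sum>s\<in>{0..<n}. \<bar>N * A s\<bar>) + \<bar>g 0\<bar>"
  have pN: "real_of_int (2 * p * N) > 0" using p_pos N_pos by simp
  have bound: "u r \<in> {- M..M}" if u: "u \<in> affine_perms n" "energy u \<le> B" and r: "r \<in> {0..<n}" for u r
  proof -
    have "energy u = ((\<Sum>s\<in>{0..<n}. real_of_int ((p * g (u s) - N * A s)\<^sup>2)) - C) / (2 * p * N)"
      unfolding energy_def C_def by (simp add: sum_divide_distrib[symmetric] sum_subtractf)
    then have "(\<Sum>s\<in>{0..<n}. real_of_int ((p * g (u s) - N * A s)\<^sup>2)) \<le> D"
      using u(2) pN by (simp add: D_def pos_divide_le_eq algebra_simps)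
    moreover have "real_of_int ((p * g (u r) - N * A r)\<^sup>2) \<le> (\<Sum>s\<in>{0..<n}. real_of_int ((p * g (u s) - N * A s)\<^sup>2))"
      by (rule member_le_sum) (use r in auto)
    ultimately have "real_of_int ((p * g (u r) - N * A r)\<^sup>2) \<le> D" by simp
    then have "(p * g (u r) - N * A r)\<^sup>2 \<le> \<lceil>D\<rceil>" by linarith
    moreover have "\<bar>z\<bar> \<le> z\<^sup>2" for z :: int
      by (metis abs_le_square_iff abs_of_nonneg abs_power2 abs_idempotent power2_abs self_le_power
          abs_ge_zero zero_less_numeral int_one_le_iff_zero_less less_le power_zero_numeral)
    ultimately have 1: "\<bar>p * g (u r) - N * A r\<bar> \<le> \<lceil>D\<rceil>" by (meson order_trans)
    have "\<bar>N * A r\<bar> \<le> (\<Sum>s\<in>{0..<n}. \<bar>N * A s\<bar>)" by (rule member_le_sum) (use r in auto)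
    then have "\<bar>p * g (u r)\<bar> \<le> \<lceil>D\<rceil> + (\<Sum>s\<in>{0..<n}. \<bar>N * A s\<bar>)" using 1 by linarith
    moreover have "\<bar>g (u r)\<bar> \<le> \<bar>p * g (u r)\<bar>"
      using p_pos by (simp add: abs_mult mult_le_cancel_right1)
    ultimately have 2: "\<bar>g (u r)\<bar> + \<bar>g 0\<bar> \<le> M" by (simp add: M_def)
    have grow: "s \<le> t \<Longrightarrow> t - s \<le> g t - g s" for s t
    proof (induction t rule: int_ge_induct)
      case (step t) then show ?case using g_step[of t] by simp
    qed simp
    show ?thesis using grow[of 0 "u r"] grow[of "u r" 0] 2 by (cases "u r \<ge> 0") auto
  qed
  have "inj_on (\<lambda>u. restrict u {0..<n}) {u \<in> affine_perms n. energy u \<le> B}"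
  proof (rule inj_onI, rule ext)
    fix u v r assume uv: "u \<in> {u \<in> affine_perms n. energy u \<le> B}" "v \<in> {u \<in> affine_perms n. energy u \<le> B}"
      "restrict u {0..<n} = restrict v {0..<n}"
    have "u (r mod n) = v (r mod n)"
      using fun_cong[OF uv(3), of "r mod n"] n_ge_2 by simp
    moreover have "w r = w (r mod n) + n * (r div n)" if "w \<in> affine_perms n" for w
      using affine_permsD(3)[OF that, of "r mod n" "r div n"] by simp
    moreover have "u \<in> affine_perms n" "v \<in> affine_perms n" using uv by auto
    ultimately show "u r = v r" by metis
  qed
  moreover have "(\<lambda>u. restrict u {0..<n}) ` {u \<in> affine_perms n. energy u \<le> B} \<subseteq> {0..<n} \<rightarrow>\<^sub>E {- M..M}"
    using bound by auto
  moreover have "finite ({0..<n} \<rightarrow>\<^sub>E {- M..M})" by (rule finite_PiE) auto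
  ultimately show ?thesis by (meson finite_imageD finite_subset)
qed

lemma energy_lower: "\<exists>C\<ge>0. \<forall>u. - C \<le> energy u"
proof -
  define C where "C = (\<Sum>s\<in>{0..<n}. real_of_int ((p * g s - N * A s)\<^sup>2) / (2 * p * N))"
  have "- C \<le> energy u" for u
  proof -
    have "0 \<le> (\<Sum>s\<in>{0..<n}. real_of_int ((p * g (u s) - N * A s)\<^sup>2) / (2 * p * N))"
      using p_pos N_pos by (intro sum_nonneg divide_nonneg_pos) auto
    then show ?thesis by (simp add: energy_def C_def diff_divide_distrib sum_subtractf)
  qed
  moreover have "C \<ge> 0" unfolding C_def using p_pos N_pos by (intro sum_nonneg divide_nonneg_pos) auto
  ultimately show ?thesis by blast
qed

lemma finite_family_size_le: "finite {\<mu> \<in> part_families n. family_size n \<mu> \<le> m}"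
proof -
  have "{\<mu> \<in> part_families n. family_size n \<mu> \<le> m}
      = (\<Union>j\<in>{..m}. {\<mu> \<in> part_families (int (nat n)). family_size (int (nat n)) \<mu> = j})"
    using n_ge_2 by auto
  then show ?thesis using card_part_families(1)[of "nat n"] n_ge_2 by simp
qed

lemma finite_configs_weight: "finite {c \<in> configs. weight c = x}"
proof -
  obtain C where C: "C \<ge> 0" "\<And>u. - C \<le> energy u" using energy_lower by blast
  have "{c \<in> configs. weight c = x} \<subseteq>
      {u \<in> affine_perms n. energy u \<le> x} \<times> {\<mu> \<in> part_families n. family_size n \<mu> \<le> nat \<lceil>x + C\<rceil>}"
  proof
    fix c assume c: "c \<in> {c \<in> configs. weight c = x}"
    then have "real (family_size n (snd c)) + energy (fst c) = x" by (simp add: weight_def)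
    then have "energy (fst c) \<le> x" "real (family_size n (snd c)) \<le> x + C" using C(2)[of "fst c"] by simp_all
    moreover from this have "family_size n (snd c) \<le> nat \<lceil>x + C\<rceil>" by linarith
    ultimately show "c \<in> {u \<in> affine_perms n. energy u \<le> x} \<times> {\<mu> \<in> part_families n. family_size n \<mu> \<le> nat \<lceil>x + C\<rceil>}"
      using c by (auto simp: mem_Times_iff)
  qed
  then show ?thesis using energy_bound_finite finite_family_size_le by (meson finite_SigmaI finite_subset)
qed

lemma energy_id: "energy (\<lambda>s. s) = 0" by (simp add: energy_def)

text \<open>
  The involution \<open>uncross\<close> cancels all configurations with a crossing.
\<close>

theorem signed_config_count:
  "(\<Sum>c\<in>{c \<in> configs. weight c = x}. aperm_sign n (fst c)) =
     int (card {\<mu> \<in> part_families n. burge \<mu> \<and> real (family_size n \<mu>) = x})"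
proof -
  let ?X = "{c \<in> configs. weight c = x}"
  let ?Y = "{c \<in> ?X. crossings c = {}}" and ?Z = "{c \<in> ?X. crossings c \<noteq> {}}"
  have "(\<Sum>c\<in>?Z. aperm_sign n (fst c)) = (\<Sum>c\<in>?Z. aperm_sign n (fst (uncross c)))"
    by (rule sum.reindex_bij_witness[of _ uncross uncross]) (auto simp: uncross)
  also have "\<dots> = - (\<Sum>c\<in>?Z. aperm_sign n (fst c))"
    by (simp add: sum_negf[symmetric] uncross)
  finally have Z: "(\<Sum>c\<in>?Z. aperm_sign n (fst c)) = 0" by simp
  have "?Y = Pair (\<lambda>s. s) ` {\<mu> \<in> part_families n. burge \<mu> \<and> real (family_size n \<mu>) = x}"
    using crossings_empty_iff id_affine_perm energy_id by (fastforce simp: weight_def)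
  then have "(\<Sum>c\<in>?Y. aperm_sign n (fst c)) = int (card {\<mu> \<in> part_families n. burge \<mu> \<and> real (family_size n \<mu>) = x})"
    by (simp add: sum.reindex inj_on_def aperm_sign_id)
  moreover have "(\<Sum>c\<in>?X. aperm_sign n (fst c)) = (\<Sum>c\<in>?Y. aperm_sign n (fst c)) + (\<Sum>c\<in>?Z. aperm_sign n (fst c))"
  proof (subst sum.union_disjoint[symmetric])
    show "finite ?Y" "finite ?Z" by (rule finite_subset[OF _ finite_configs_weight[of x]]; blast)+
  qed (auto intro: sum.cong)
  ultimately show ?thesis using Z by simp
qed

end

section \<open>The affine Weyl group acting on coordinates\<close>

lemma bform_sym: "bform n u v = bform n v u"
  by (cases u; cases v) (simp add: mult.commute add_ac)

lemma bform_add_left: "bform n (u + v) w = bform n u w + bform n v w"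
  by (cases u; cases v; cases w) (simp add: sum.distrib algebra_simps)

lemma bform_diff_left: "bform n (u - v) w = bform n u w - bform n v w"
  by (cases u; cases v; cases w) (simp add: sum_subtractf algebra_simps)

lemma bform_smul_left: "bform n (smul z u) w = z * bform n u w"
  by (cases u; cases w) (simp add: sum_distrib_left algebra_simps)

lemma bform_add_right: "bform n w (u + v) = bform n w u + bform n w v"
  by (metis bform_sym bform_add_left)

lemma bform_diff_right: "bform n w (u - v) = bform n w u - bform n w v"
  by (metis bform_sym bform_diff_left)

lemma bform_smul_right: "bform n w (smul z u) = z * bform n w u"
  by (metis bform_sym bform_smul_left)

lemma bform_zsmul: "bform n (zsmul k u) w = of_int k * bform n u w"
  "bform n w (zsmul k u) = of_int k * bform n w u"
  by (simp_all add: zsmul_def bform_smul_left bform_smul_right)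

lemma bform_zero_left: "bform n 0 w = 0"
  using bform_diff_left[of n w w w] by simp

lemma bform_sum_left: "bform n (\<Sum>i\<in>S. f i) w = (\<Sum>i\<in>S. bform n (f i) w)"
  by (induction S rule: infinite_finite_induct) (simp_all add: bform_add_left bform_zero_left)

lemmas bform_bilinear = bform_add_left bform_diff_left bform_smul_left bform_add_right
  bform_diff_right bform_smul_right bform_zsmul bform_zero_left

lemma smul_algebra:
  "smul z (u + v) = smul z u + smul z v" "smul z (u - v) = smul z u - smul z v"
  "smul (y + z) u = smul y u + smul z u" "smul (y - z) u = smul y u - smul z u"
  "smul y (smul z u) = smul (y * z) u" "smul 1 u = u" "smul 0 u = 0"
  by (cases u; cases v; simp add: fun_eq_iff algebra_simps zero_prod_def)+

lemma smul_minus: "smul (- z) u = - smul z u"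
  by (cases u) (simp add: fun_eq_iff)

lemma bform_delta: "bform n v delta = snd (snd v)" and bform_omega0: "bform n v omega0 = fst (snd v)"
  by (cases v; simp add: delta_def omega0_def)+

lemma bform_eps: "1 \<le> i \<Longrightarrow> i \<le> n \<Longrightarrow> bform n v (eps i) = fst v i"
  by (cases v) (simp add: eps_def if_distrib[of "\<lambda>x. _ * x"] cong: if_cong)

text \<open>
  The extension of \<open>\<epsilon>\<^sub>1, \<dots>, \<epsilon>\<^sub>n\<close> to all integer indices by the rule \<open>\<epsilon> (s + n) = \<epsilon> s - \<delta>\<close>.  With it
  each simple root, \<open>\<alpha>\<^sub>0\<close> included, is a difference of neighbours, and the affine reflections permute
  the indices.
\<close>

definition epsx :: "nat \<Rightarrow> int \<Rightarrow> avec" where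
  "epsx n s = eps (nat ((s - 1) mod int n) + 1) - zsmul ((s - 1) div int n) delta"

lemma zsmul_delta: "zsmul k delta = (0, of_int k, 0)"
  by (simp add: zsmul_def delta_def fun_eq_iff)

lemma epsx_mult: "n > 0 \<Longrightarrow> epsx n (s + int n * k) = epsx n s - zsmul k delta"
proof -
  assume n: "n > 0"
  have e: "s + int n * k - 1 = (s - 1) + k * int n" by simp
  have "(s + int n * k - 1) mod int n = (s - 1) mod int n"
    "(s + int n * k - 1) div int n = (s - 1) div int n + k" unfolding e using n by simp_all
  then show ?thesis by (simp add: epsx_def zsmul_delta)
qed

lemma epsx_nat: "1 \<le> i \<Longrightarrow> i \<le> n \<Longrightarrow> epsx n (int i) = eps i"
proof -
  assume i: "1 \<le> i" "i \<le> n"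
  then have "(int i - 1) mod int n = int i - 1" "(int i - 1) div int n = 0" by auto
  then show ?thesis using i by (simp add: epsx_def zsmul_delta zero_prod_def[symmetric] nat_diff_distrib')
qed

lemma alpha_epsx:
  assumes "n > 0"
  shows "alpha n s = epsx n s - epsx n (s + 1)"
proof -
  have s: "s = s mod int n + int n * (s div int n)" by simp
  show ?thesis
  proof (cases "s mod int n = 0")
    case True
    have "epsx n s = epsx n (int n + int n * (s div int n - 1))"
      using s True by (simp add: algebra_simps)
    also have "\<dots> = eps n - zsmul (s div int n - 1) delta"
      using assms by (subst epsx_mult, simp, subst epsx_nat) auto
    finally have 1: "epsx n s = \<dots>" .
    have "epsx n (s + 1) = epsx n (int 1 + int n * (s div int n))"
      using s True by (simp add: algebra_simps)
    also have "\<dots> = eps 1 - zsmul (s div int n) delta"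
      using assms by (subst epsx_mult, simp, subst epsx_nat) auto
    finally show ?thesis using 1 True by (simp add: alpha_def zsmul_def delta_def fun_eq_iff)
  next
    case False
    define r where "r = nat (s mod int n)"
    have "0 \<le> s mod int n" "s mod int n < int n" using assms by simp_all
    then have r: "1 \<le> r" "Suc r \<le> n" "s mod int n = int r"
      using False unfolding r_def by linarith+
    have "epsx n s = epsx n (int r + int n * (s div int n))" using s r by simp
    also have "\<dots> = eps r - zsmul (s div int n) delta"
      using assms r by (subst epsx_mult, simp, subst epsx_nat) auto
    finally have 1: "epsx n s = \<dots>" .
    have "s + 1 = int (Suc r) + int n * (s div int n)" using s r by simp
    then have "epsx n (s + 1) = eps (Suc r) - zsmul (s div int n) delta"
      using assms r epsx_nat[of "Suc r" n] by (simp only: epsx_mult)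
    then show ?thesis using 1 False r by (simp add: alpha_def)
  qed
qed

lemma alpha_seg_epsx:
  assumes "n > 0" "l \<le> r"
  shows "alpha_seg n l r = epsx n l - epsx n r"
  using assms(2)
proof (induction r rule: int_ge_induct)
  case (step r)
  have "{l..<r + 1} = insert r {l..<r}" using step.hyps by auto
  then show ?case using step by (simp add: alpha_seg_def alpha_epsx[OF assms(1)])
qed (simp add: alpha_seg_def)

definition coord :: "nat \<Rightarrow> avec \<Rightarrow> int \<Rightarrow> complex" where
  "coord n v s = bform n v (epsx n s)"

lemma coord_mult: "n > 0 \<Longrightarrow> coord n v (s + int n * k) = coord n v s - of_int k * bform n v delta"
  by (simp add: coord_def epsx_mult bform_bilinear)

lemma coord_nat: "1 \<le> i \<Longrightarrow> i \<le> n \<Longrightarrow> coord n v (int i) = fst v i"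
  by (simp add: coord_def epsx_nat bform_eps)

lemma bform_alpha: "n > 0 \<Longrightarrow> bform n v (alpha n s) = coord n v s - coord n v (s + 1)"
  by (simp add: alpha_epsx bform_bilinear coord_def)

lemma bform_alpha_seg:
  "n > 0 \<Longrightarrow> l \<le> r \<Longrightarrow> bform n (alpha_seg n l r) v = coord n v l - coord n v r"
  by (simp add: alpha_seg_epsx coord_def bform_bilinear bform_sym[of n "epsx n l"] bform_sym[of n "epsx n r"])

lemma bform_coord:
  "bform n v w = (\<Sum>i=1..n. coord n v (int i) * coord n w (int i))
     + bform n v omega0 * bform n w delta + bform n v delta * bform n w omega0"
  by (cases v; cases w) (simp add: coord_nat bform_delta bform_omega0)

lemma coord_diff: "coord n (u - v) s = coord n u s - coord n v s"
  by (simp add: coord_def bform_bilinear)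

lemma window_decomp:
  assumes "n > 0"
  obtains i where "s = int i + int n * ((s - 1) div int n)" "1 \<le> i" "i \<le> n" "(s - 1) mod int n = int i - 1"
proof -
  have nn: "0 \<le> (s - 1) mod int n" "(s - 1) mod int n < int n" using assms by simp_all
  have "s - 1 = int n * ((s - 1) div int n) + (s - 1) mod int n" by simp
  then have "s = int (nat ((s - 1) mod int n) + 1) + int n * ((s - 1) div int n)" using nn by linarith
  then show thesis using nn by (intro that[of "nat ((s - 1) mod int n) + 1"]) auto
qed

lemma bform_epsx:
  assumes "n > 0"
  shows "bform n (epsx n s) (epsx n t) = (if s mod int n = t mod int n then 1 else 0)"
proof -
  have red: "\<exists>i k. s = int i + int n * k \<and> 1 \<le> i \<and> i \<le> n \<and> (s - 1) mod int n = int i - 1" for s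
    by (rule window_decomp[OF assms, of s]) blast
  obtain i k where s: "s = int i + int n * k" "1 \<le> i" "i \<le> n" "(s - 1) mod int n = int i - 1" using red by blast
  obtain j m where t: "t = int j + int n * m" "1 \<le> j" "j \<le> n" "(t - 1) mod int n = int j - 1" using red by blast
  have "bform n (epsx n s) (epsx n t) = bform n (eps i) (eps j)"
    using assms s(2,3) t(2,3) unfolding s(1) t(1)
    by (simp add: epsx_mult epsx_nat bform_bilinear bform_delta bform_sym[of n delta])
       (simp add: eps_def delta_def zsmul_def)
  also have "\<dots> = (if i = j then 1 else 0)"
    using t(2,3) by (simp add: bform_eps) (simp add: eps_def)
  also have "i = j \<longleftrightarrow> (s - 1) mod int n = (t - 1) mod int n" using s(4) t(4) by simp
  also have "\<dots> \<longleftrightarrow> s mod int n = t mod int n" by (simp add: mod_eq_dvd_iff)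
  finally show ?thesis .
qed

lemma bform_epsx_delta: "bform n (epsx n s) delta = 0" "bform n delta (epsx n s) = 0" "bform n delta delta = 0"
proof -
  have "snd (snd (epsx n s)) = 0" by (simp add: epsx_def eps_def zsmul_delta)
  then show "bform n (epsx n s) delta = 0" "bform n delta (epsx n s) = 0"
    by (simp_all only: bform_sym[of n delta "epsx n s"] bform_delta)
qed (simp add: delta_def)

lemma avec_eqI:
  assumes "\<And>i. i \<notin> {1..n} \<Longrightarrow> fst v i = fst w i" "\<And>s. coord n v s = coord n w s"
    and "bform n v delta = bform n w delta" "bform n v omega0 = bform n w omega0"
  shows "v = w"
proof -
  have "fst v i = fst w i" for i
    using assms(1)[of i] assms(2)[of "int i"] by (cases "i \<in> {1..n}") (auto simp: coord_nat)
  then show ?thesis using assms(3,4) by (auto simp: prod_eq_iff fun_eq_iff bform_delta bform_omega0)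
qed

context
  fixes n :: nat
  assumes n: "n \<ge> 2"
begin

lemma n_pos: "n > 0" and n_int: "int n \<ge> 2" "int n > 0" using n by auto

lemma bform_alpha_alpha: "bform n (alpha n s) (alpha n s) = 2"
  and bform_alpha_delta: "bform n (alpha n s) delta = 0"
  using mod_Suc_neq[OF n_int(1), of s]
  by (simp_all add: alpha_epsx n_pos bform_bilinear bform_epsx bform_epsx_delta eq_commute)

lemma simple_refl_linear:
  "simple_refl n i (u + v) = simple_refl n i u + simple_refl n i v"
  "simple_refl n i (u - v) = simple_refl n i u - simple_refl n i v"
  "simple_refl n i (smul z u) = smul z (simple_refl n i u)"
  by (simp_all add: simple_refl_def bform_bilinear smul_algebra)

lemma simple_refl_isometry: "bform n (simple_refl n i u) (simple_refl n i v) = bform n u v"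
  using bform_alpha_alpha[of "int i"]
  by (simp add: simple_refl_def bform_bilinear bform_sym[of n "alpha n (int i)" v] algebra_simps)

lemma simple_refl_delta: "simple_refl n i delta = delta"
  by (simp add: simple_refl_def bform_sym[of n delta] bform_alpha_delta smul_algebra)

lemma simple_refl_level: "bform n (simple_refl n i v) delta = bform n v delta"
  by (simp add: simple_refl_def bform_bilinear bform_alpha_delta)

lemma simple_refl_outer: "j \<notin> {1..n} \<Longrightarrow> fst (simple_refl n i v) j = fst v j"
proof -
  assume j: "j \<notin> {1..n}"
  have "fst (epsx n s) j = 0" for s
  proof -
    have "nat ((s - 1) mod int n) + 1 \<in> {1..n}"
      using n_pos by (auto simp: Suc_le_eq nat_less_iff)
    then have "j \<noteq> nat ((s - 1) mod int n) + 1" using j by metis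
    then show ?thesis by (simp add: epsx_def eps_def zsmul_delta)
  qed
  then have "fst (alpha n (int i)) j = 0" by (simp add: alpha_epsx n_pos)
  then show ?thesis
    by (cases "alpha n (int i)") (simp add: simple_refl_def)
qed

lemma simple_refl_epsx: "simple_refl n i (epsx n r) = epsx n (affine_transp (int n) (int i) (int i + 1) r)"
proof -
  note neq = mod_Suc_neq[OF n_int(1), of "int i"]
  consider k where "r = int i + int n * k" | k where "r = int i + 1 + int n * k"
    | "r mod int n \<noteq> int i mod int n" "r mod int n \<noteq> (int i + 1) mod int n"
    by (metis mod_eqE)
  then show ?thesis
  proof cases
    case 1
    have "bform n (epsx n r) (alpha n (int i)) = 1"
      using neq 1 by (simp add: alpha_epsx n_pos bform_bilinear bform_epsx)
    then show ?thesis unfolding simple_refl_def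
      using affine_transp_simps(1)[OF neq, of k] 1 by (simp add: smul_algebra alpha_epsx n_pos epsx_mult)
  next
    case 2
    have "bform n (epsx n r) (alpha n (int i)) = - 1"
      using neq 2 by (simp add: alpha_epsx n_pos bform_bilinear bform_epsx)
    moreover have "smul (- 1) u = - u" for u by (cases u) (simp add: fun_eq_iff)
    ultimately show ?thesis unfolding simple_refl_def
      using affine_transp_simps(2)[OF neq, of k] 2 by (simp add: alpha_epsx n_pos epsx_mult)
  next
    case 3
    have "bform n (epsx n r) (alpha n (int i)) = 0"
      using 3 by (simp add: alpha_epsx n_pos bform_bilinear bform_epsx)
    then show ?thesis unfolding simple_refl_def
      using affine_transp_simps(3)[OF neq] 3 by (simp add: smul_algebra)
  qed
qed

lemma simple_refl_invol: "simple_refl n i (simple_refl n i v) = v"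
  using bform_alpha_alpha[of "int i"]
  by (simp add: simple_refl_def bform_bilinear smul_algebra[symmetric])
     (simp add: smul_algebra smul_minus)

lemma coord_simple_refl:
  "coord n (simple_refl n i v) r = coord n v (affine_transp (int n) (int i) (int i + 1) r)"
  using simple_refl_isometry[of i "simple_refl n i v" "epsx n r"]
  by (simp add: coord_def simple_refl_invol simple_refl_epsx)

lemma refl_word_simps [simp]: "refl_word n [] = id" "refl_word n (i # is) = simple_refl n i \<circ> refl_word n is"
  by (simp_all add: refl_word_def)

lemma refl_word_linear:
  "refl_word n is (u + v) = refl_word n is u + refl_word n is v"
  "refl_word n is (u - v) = refl_word n is u - refl_word n is v"
  "refl_word n is (smul z u) = smul z (refl_word n is u)"
  by (induction "is") (simp_all add: simple_refl_linear)

lemma refl_word_isometry: "bform n (refl_word n is u) (refl_word n is v) = bform n u v"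
  by (induction "is") (simp_all add: simple_refl_isometry)

lemma refl_word_delta: "refl_word n is delta = delta"
  by (induction "is") (simp_all add: simple_refl_delta)

lemma refl_word_level: "bform n (refl_word n is v) delta = bform n v delta"
  by (induction "is") (simp_all add: simple_refl_level)

lemma refl_word_outer: "j \<notin> {1..n} \<Longrightarrow> fst (refl_word n is v) j = fst v j"
  by (induction "is") (simp_all add: simple_refl_outer del: atLeastAtMost_iff)

lemma coord_refl_word: "coord n (refl_word n is v) r = coord n v (word_perm (int n) is r)"
  by (induction "is" arbitrary: r) (simp_all add: coord_simple_refl)

lemma refl_word_epsx: "refl_word n is (epsx n (word_perm (int n) is r)) = epsx n r"
  by (induction "is" arbitrary: r)
     (simp_all add: simple_refl_epsx affine_transp_invol[OF mod_Suc_neq[OF n_int(1)]])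

text \<open>
  The permutation determines the coordinates \<open>(v, \<epsilon> s)\<close> of the image, and the level is invariant.
  If the level does not vanish, the remaining coefficient of \<open>\<delta>\<close> follows from the invariance of the
  norm.  Vectors of level zero are differences of vectors of level one.
\<close>

lemma refl_word_eqI:
  assumes eq: "word_perm (int n) is = word_perm (int n) is'"
  shows "refl_word n is = refl_word n is'"
proof -
  have level: "refl_word n is v = refl_word n is' v" if v: "bform n v delta \<noteq> 0" for v
  proof (rule avec_eqI)
    have norm: "2 * bform n (refl_word n js v) omega0 * bform n v delta
        = bform n v v - (\<Sum>i=1..n. (coord n v (word_perm (int n) js (int i)))\<^sup>2)" for js
      using refl_word_isometry[of js v v] bform_coord[of n "refl_word n js v" "refl_word n js v"]
      by (simp add: refl_word_level coord_refl_word power2_eq_square algebra_simps)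
    have "2 * bform n (refl_word n is v) omega0 * bform n v delta
        = 2 * bform n (refl_word n is' v) omega0 * bform n v delta"
      unfolding norm eq ..
    then show "bform n (refl_word n is v) omega0 = bform n (refl_word n is' v) omega0" using v by simp
  qed (simp_all add: refl_word_outer coord_refl_word refl_word_level eq del: atLeastAtMost_iff)
  show ?thesis
  proof
    fix v
    show "refl_word n is v = refl_word n is' v"
    proof (cases "bform n v delta = 0")
      case True
      have o: "bform n omega0 delta = 1" by (simp add: bform_delta omega0_def)
      have "refl_word n js v = refl_word n js (v + omega0) - refl_word n js omega0" for js
        by (simp add: refl_word_linear)
      moreover have "bform n (v + omega0) delta \<noteq> 0" "bform n omega0 delta \<noteq> 0"
        using True o by (simp_all add: bform_bilinear)
      ultimately show ?thesis using level by metis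
    qed (rule level)
  qed
qed

definition aff_act :: "(int \<Rightarrow> int) \<Rightarrow> avec \<Rightarrow> avec" where
  "aff_act u = refl_word n (SOME is. set is \<subseteq> {0..<n} \<and> word_perm (int n) is = u)"

lemma aff_act_word:
  assumes "u \<in> affine_perms (int n)"
  obtains "is" where "set is \<subseteq> {0..<n}" "word_perm (int n) is = u" "aff_act u = refl_word n is"
proof -
  have "\<exists>is. set is \<subseteq> {0..<n} \<and> word_perm (int n) is = u"
    using affine_perm_word[OF n_int(1) assms] by auto
  from someI_ex[OF this] show thesis using that unfolding aff_act_def by blast
qed

lemma aff_act_word_perm: "aff_act (word_perm (int n) is) = refl_word n is"
  using aff_act_word[OF word_perm_affine[OF n_int(1)]] refl_word_eqI by metis

lemma coord_aff_act:
  "u \<in> affine_perms (int n) \<Longrightarrow> coord n (aff_act u v) s = coord n v (u s)"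
  using aff_act_word coord_refl_word by metis

text \<open>
  Injectivity is tested on a vector whose coordinates at all integer indices are distinct.
\<close>

lemma aff_act_bij: "bij_betw aff_act (affine_perms (int n)) (aff_weyl n)"
  unfolding bij_betw_def
proof
  \<comment> \<open>Its coordinate at every integer \<open>s\<close> is \<open>- s\<close>.\<close>
  define v :: avec where "v = ((\<lambda>i. - of_nat i), 0, of_nat n)"
  have v: "coord n v s = - of_int s" for s
  proof -
    obtain i where s: "s = int i + int n * ((s - 1) div int n)" and i: "1 \<le> i" "i \<le> n"
      using window_decomp[OF n_pos] by blast
    then have "coord n v s = - of_nat i - of_int ((s - 1) div int n) * of_nat n"
      using coord_mult[OF n_pos, of v "int i" "(s - 1) div int n"] coord_nat[OF i, of v]
      by (simp add: v_def bform_delta)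
    also have "\<dots> = - of_int (int i + int n * ((s - 1) div int n))" by simp
    finally show ?thesis using s by simp
  qed
  show "inj_on aff_act (affine_perms (int n))"
  proof (rule inj_onI, rule ext)
    fix u u' s assume "u \<in> affine_perms (int n)" "u' \<in> affine_perms (int n)" "aff_act u = aff_act u'"
    then have "coord n v (u s) = coord n v (u' s)" by (metis coord_aff_act)
    then show "u s = u' s" by (simp add: v)
  qed
  show "aff_act ` affine_perms (int n) = aff_weyl n"
  proof
    show "aff_act ` affine_perms (int n) \<subseteq> aff_weyl n"
      unfolding aff_weyl_def by (auto elim!: aff_act_word)
    show "aff_weyl n \<subseteq> aff_act ` affine_perms (int n)"
    proof
      fix w assume "w \<in> aff_weyl n"
      then obtain "is" where "is": "w = refl_word n is" by (auto simp: aff_weyl_def)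
      then have "aff_act (word_perm (int n) is) = w" by (simp add: aff_act_word_perm)
      then show "w \<in> aff_act ` affine_perms (int n)" using word_perm_affine[OF n_int(1)] by blast
    qed
  qed
qed

lemma weyl_length_sign:
  assumes u: "u \<in> affine_perms (int n)"
  shows "(- 1) ^ weyl_length n (aff_act u) = aperm_sign (int n) u"
proof -
  have "\<exists>k is. length is = k \<and> set is \<subseteq> {0..<n} \<and> refl_word n is = aff_act u"
    using aff_act_word[OF u] by metis
  from LeastI_ex[OF this] obtain "is" where
    "is": "length is = weyl_length n (aff_act u)" "refl_word n is = aff_act u"
    unfolding weyl_length_def by blast
  then have "aff_act (word_perm (int n) is) = aff_act u" by (simp add: aff_act_word_perm)
  then have "word_perm (int n) is = u"
    using aff_act_bij u word_perm_affine[OF n_int(1)] by (auto simp: bij_betw_def inj_on_def)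
  then show ?thesis using aperm_sign_word[OF n_int(1), of "is"] "is"(1) by simp
qed

text \<open>
  Equal pairings with all simple roots make the coordinates of the difference constant over a whole
  period.  So its level vanishes, and the constant is zero because the coordinate sum is.
\<close>

lemma htilde_eqI:
  assumes v: "v \<in> htilde n" and w: "w \<in> htilde n"
    and \<alpha>: "\<And>j. j < n \<Longrightarrow> bform n v (alpha n (int j)) = bform n w (alpha n (int j))"
    and \<omega>: "bform n v omega0 = bform n w omega0"
  shows "v = w"
proof -
  define d where "d = v - w"
  have step: "coord n d (int j) = coord n d (int (Suc j))" if "j < n" for j
    using \<alpha>[OF that] by (simp add: d_def bform_alpha n_pos coord_diff algebra_simps)
  have const: "coord n d (int j) = coord n d 0" if "j \<le> n" for j
    using that by (induction j) (use step in auto)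
  have "coord n d (0 + int n * 1) = coord n d 0" using const[of n] by simp
  then have level: "bform n d delta = 0" by (subst (asm) coord_mult[OF n_pos]) simp
  have "(\<Sum>i=1..n. fst d i) = 0" "\<And>i. i \<notin> {1..n} \<Longrightarrow> fst d i = 0"
    using v w by (auto simp: htilde_def d_def sum_subtractf)
  moreover have "(\<Sum>i=1..n. fst d i) = (\<Sum>i=1..n. coord n d 0)"
    by (rule sum.cong) (auto simp: const coord_nat[symmetric])
  ultimately have c0: "coord n d 0 = 0" using n_pos by simp
  have "coord n d s = 0" for s
  proof -
    have "coord n d (s mod int n) = 0"
      using const[of "nat (s mod int n)"] c0 n_pos by (simp add: nat_le_iff less_imp_le)
    then show ?thesis
      using coord_mult[OF n_pos, of d "s mod int n" "s div int n"] level by simp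
  qed
  moreover have "coord n 0 s = 0" for s by (simp add: coord_def bform_zero_left)
  ultimately have "d = 0"
    using \<open>\<And>i. i \<notin> {1..n} \<Longrightarrow> fst d i = 0\<close> level \<omega>
    by (intro avec_eqI[of n]) (auto simp: bform_zero_left d_def bform_bilinear)
  then show ?thesis by (simp add: d_def)
qed

text \<open>
  The explicit vector is \<open>\<omega>\<^sub>0\<close> plus \<open>\<epsilon>\<^sub>1 + \<dots> + \<epsilon>\<^sub>i\<close>, projected to coordinate sum zero.
\<close>

lemma omega_props:
  assumes "i < n"
  shows "omega n i \<in> htilde n" "bform n (omega n i) omega0 = 0"
    and "j < n \<Longrightarrow> bform n (omega n i) (alpha n (int j)) = (if i = j then 1 else 0)"
    and "bform n (omega n i) delta = 1"
proof -
  define v :: avec where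
    "v = ((\<lambda>j. if j \<in> {1..n} then (if j \<le> i then 1 else 0) - of_nat i / of_nat n else 0), 0, 1)"
  have "(\<Sum>j=1..n. (if j \<le> i then 1 else 0) - of_nat i / (of_nat n :: complex)) = 0"
  proof -
    have "{1..n} \<inter> {j. j \<le> i} = {1..i}" using assms by auto
    then have "(\<Sum>j=1..n. (if j \<le> i then 1 else 0 :: complex)) = of_nat i"
      by (simp add: sum.If_cases)
    then show ?thesis using n_pos by (simp add: sum_subtractf)
  qed
  then have h: "v \<in> htilde n" unfolding htilde_def v_def by auto
  have \<omega>: "bform n v omega0 = 0" and lv: "bform n v delta = 1"
    by (simp_all add: v_def bform_omega0 bform_delta)
  have \<alpha>: "bform n v (alpha n (int j)) = (if i = j then 1 else 0)" if j: "j < n" for j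
  proof (cases "j = 0")
    case True
    have "coord n v 0 = coord n v (int n) + 1"
      using coord_mult[OF n_pos, of v 0 1] lv by simp
    then have "bform n v (alpha n (int j)) = fst v n + 1 - fst v 1"
      using True coord_nat[of n n v] coord_nat[of 1 n v] n_pos by (simp add: bform_alpha)
    then show ?thesis using True assms n by (auto simp: v_def)
  next
    case False
    have "bform n v (alpha n (int j)) = fst v j - fst v (Suc j)"
      using False j coord_nat[of j n v] coord_nat[of "Suc j" n v] by (simp add: bform_alpha n_pos add.commute)
    then show ?thesis using False assms j by (auto simp: v_def)
  qed
  have "omega n i = v" unfolding omega_def
  proof (rule the_equality)
    show "v \<in> htilde n \<and> (\<forall>j<n. bform n v (alpha n (int j)) = (if i = j then 1 else 0)) \<and> bform n v omega0 = 0"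
      using h \<omega> \<alpha> by blast
  next
    fix v' assume "v' \<in> htilde n \<and> (\<forall>j<n. bform n v' (alpha n (int j)) = (if i = j then 1 else 0)) \<and> bform n v' omega0 = 0"
    then show "v' = v" using h \<omega> \<alpha> by (intro htilde_eqI) auto
  qed
  then show "omega n i \<in> htilde n" "bform n (omega n i) omega0 = 0"
    "j < n \<Longrightarrow> bform n (omega n i) (alpha n (int j)) = (if i = j then 1 else 0)"
    "bform n (omega n i) delta = 1"
    using h \<omega> \<alpha> lv by simp_all
qed

lemma dominant_vector_props:
  fixes a :: "nat \<Rightarrow> nat"
  defines "v \<equiv> (\<Sum>i<n. smul (of_nat (a i)) (omega n i)) + rho n"
  shows "j < n \<Longrightarrow> bform n v (alpha n (int j)) = of_nat (a j) + 1"
    and "bform n v delta = of_nat ((\<Sum>i<n. a i) + n)"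
    and "bform n v omega0 = 0"
proof -
  assume j: "j < n"
  have "bform n v (alpha n (int j)) = (\<Sum>i<n. of_nat (a i) * (if i = j then 1 else 0)) + (\<Sum>i<n. if i = j then 1 else 0)"
    using j by (simp add: v_def rho_def bform_bilinear bform_sum_left omega_props)
  also have "\<dots> = of_nat (a j) + 1"
    using j by (simp add: sum.delta' if_distrib[of "\<lambda>x. _ * x"] cong: if_cong)
  finally show "bform n v (alpha n (int j)) = of_nat (a j) + 1" .
qed (simp_all add: v_def rho_def bform_bilinear bform_sum_left omega_props of_nat_sum)

lemma alpha_mod: "alpha n s = alpha n (s mod int n)"
  by (simp add: alpha_def)

end

lemma gseq_0: "gseq n b 0 = 0" by (simp add: gseq_def)

lemma gseq_step: "gseq n b (s + 1) = gseq n b s + int (b (nat (s mod int n))) + 1"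
proof (cases "s \<ge> 0")
  case True
  then have "{0..<s + 1} = insert s {0..<s}" by auto
  then show ?thesis using True by (simp add: gseq_def)
next
  case False
  then have "{s..<0} = insert s {s + 1..<0}" by auto
  then show ?thesis using False by (simp add: gseq_def)
qed

lemma gseq_period:
  assumes "n > 0"
  shows "gseq n b (s + int n) = gseq n b s + int (\<Sum>i<n. b i) + int n"
proof -
  have sum: "gseq n b (s + int k) = gseq n b s + (\<Sum>t\<in>{s..<s + int k}. int (b (nat (t mod int n))) + 1)" for k
  proof (induction k)
    case (Suc k)
    have "{s..<s + int (Suc k)} = insert (s + int k) {s..<s + int k}" by auto
    then show ?case using Suc gseq_step[of n b "s + int k"] by (simp add: add_ac)
  qed simp
  have "(\<Sum>t\<in>{s..<s + int n}. int (b (nat (t mod int n))) + 1) = (\<Sum>t\<in>{0..<int n}. int (b (nat (t mod int n))) + 1)"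
    by (rule sum_periodic_window) (use assms in auto)
  also have "\<dots> = (\<Sum>i<n. int (b i) + 1)"
    by (rule sum.reindex_bij_witness[of _ int nat]) auto
  finally show ?thesis using sum[of n] by (simp add: sum.distrib)
qed

text \<open>
  The coordinates of \<open>\<xi> + \<rho>\<close> and \<open>\<eta> + \<rho>\<close> are, up to a constant, the negatives of the starting columns
  and of the end heights of the paths.
\<close>

lemma coord_dominant_vector:
  fixes a :: "nat \<Rightarrow> nat"
  assumes n: "n \<ge> 2"
  defines "v \<equiv> (\<Sum>i<n. smul (of_nat (a i)) (omega n i)) + rho n"
  shows "coord n v s = coord n v 0 - of_int (gseq n a s)"
proof -
  have step: "coord n v (s + 1) = coord n v s - of_int (gseq n a (s + 1) - gseq n a s)" for s
  proof -
    have s: "nat (s mod int n) < n" "int (nat (s mod int n)) = s mod int n"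
      using n by (auto simp: nat_less_iff)
    have "coord n v s - coord n v (s + 1) = bform n v (alpha n (s mod int n))"
      using n bform_alpha[of n v s] alpha_mod[OF n, of s] by simp
    also have "\<dots> = of_nat (a (nat (s mod int n))) + 1"
      using dominant_vector_props(1)[OF n s(1), of a] s(2) by (simp add: v_def)
    finally show ?thesis unfolding gseq_step by (simp add: algebra_simps)
  qed
  define h where "h = (\<lambda>s. coord n v s + of_int (gseq n a s))"
  have "h (s + 1) = h s" for s using step[of s] by (simp add: h_def)
  then have "h (s mod 1) = h s" by (rule periodic_mod)
  then show ?thesis by (simp add: h_def gseq_0 algebra_simps)
qed

lemma sum_nat_int_window: "(\<Sum>i=1..n. f (int i)) = (\<Sum>s\<in>{1..<1 + int n}. f s)"
  by (rule sum.reindex_bij_witness[of _ nat int]) auto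

context cylinder
begin

text \<open>
  The function \<open>n * g s - N * s\<close> is periodic, and the sum of \<open>s\<close> over a window is invariant by the
  definition of an affine permutation.
\<close>

lemma sum_g_perm:
  assumes u: "u \<in> affine_perms n"
  shows "(\<Sum>s\<in>{0..<n}. g (u s) - g s) = 0"
proof -
  define h where "h = (\<lambda>s. n * g s - N * s)"
  have hp: "h (s + n) = h s" for s unfolding h_def g_period by (simp add: algebra_simps)
  have n0: "n > 0" using n_ge_2 by simp
  have "(\<Sum>s\<in>{0..<n}. h (u s)) = (\<Sum>s\<in>{0..<n}. h s)"
  proof (rule sum_periodic_reindex[of n h, OF n0 hp])
    show "inj_on (\<lambda>s. u s mod n) {0..<n}"
      by (rule inj_onI) (simp add: affine_permsD(5)[OF u])
  qed (use n0 in auto)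
  then have "0 = (\<Sum>s\<in>{0..<n}. h (u s) - h s)" by (simp add: sum_subtractf)
  also have "\<dots> = (\<Sum>s\<in>{0..<n}. n * (g (u s) - g s) - N * (u s - s))"
    by (simp add: h_def algebra_simps)
  also have "\<dots> = n * (\<Sum>s\<in>{0..<n}. g (u s) - g s) - N * (\<Sum>s\<in>{0..<n}. u s - s)"
    by (simp add: sum_subtractf sum_distrib_left[symmetric])
  also have "(\<Sum>s\<in>{0..<n}. u s - s) = 0" using u by (simp add: affine_perms_def)
  finally show ?thesis using n0 by simp
qed

end

section \<open>The energy as an inner product\<close>

text \<open>
  With \<open>w\<close> acting on coordinates by \<open>u\<close>, the finite part of the pairing is the sum of
  \<open>(g s - g (u s)) * A s\<close>, and the coefficient of \<open>\<delta>\<close> in \<open>v - w v\<close>, found from the invariance of the norm,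
  contributes \<open>p / (2 N)\<close> times the change of the sum of the \<open>(g s)\<^sup>2\<close>.  Together these are the
  expanded squares in the energy.  The unknown constants \<open>cv\<close> and \<open>cz\<close> drop out because the sum of
  \<open>g\<close> over a window is invariant under \<open>u\<close>.
\<close>

lemma energy_bform:
  assumes n: "n \<ge> 2" and cyl: "cylinder (int n) N p g A" and u: "u \<in> affine_perms (int n)"
    and v: "\<And>s. coord n v s = cv - of_int (g s)" and z: "\<And>s. coord n z s = cz - of_int (A s)"
    and lv: "bform n v delta = of_int N" and lz: "bform n z delta = of_int p"
  shows "bform n (v - aff_act n u v) z = of_real (cylinder.energy (int n) N p g A u)"
proof -
  interpret cylinder "int n" N p g A by (rule cyl)
  let ?W = "{1..<1 + int n}"
  obtain "is" where "is": "word_perm (int n) is = u" "aff_act n u = refl_word n is"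
    using aff_act_word[OF n u] by blast
  let ?w = "aff_act n u"
  have cw: "coord n (?w v) s = coord n v (u s)" for s using coord_aff_act[OF n u] .
  have lw: "bform n (?w v) delta = of_int N" using refl_word_level[OF n] "is" lv by simp
  have norm: "bform n (?w v) (?w v) = bform n v v" using refl_word_isometry[OF n] "is" by simp
  define T where "T = (\<Sum>s\<in>?W. (g (u s) - g s) * A s)"
  define U where "U = (\<Sum>s\<in>?W. (g (u s))\<^sup>2 - (g s)\<^sup>2)"
  have n0: "int n > 0" using n by simp
  have S0: "(\<Sum>s\<in>?W. g (u s) - g s) = 0"
    using sum_periodic_window[OF n0, of "\<lambda>s. g (u s) - g s" 1] sum_g_perm[OF u]
    by (simp add: g_period affine_permsD(2)[OF u])
  have "(\<Sum>i=1..n. (coord n v (int i) - coord n v (u (int i))) * coord n z (int i))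
      = (\<Sum>s\<in>?W. (coord n v s - coord n v (u s)) * coord n z s)"
    by (rule sum_nat_int_window)
  also have "\<dots> = (\<Sum>s\<in>?W. cz * of_int (g (u s) - g s) - of_int ((g (u s) - g s) * A s))"
    by (rule sum.cong) (auto simp: v z algebra_simps)
  also have "\<dots> = cz * of_int (\<Sum>s\<in>?W. g (u s) - g s) - of_int T"
    by (simp only: sum_subtractf[symmetric] of_int_sum sum_distrib_left T_def)
  also have "\<dots> = - of_int T" by (simp only: S0) simp
  finally have S1: "(\<Sum>i=1..n. (coord n v (int i) - coord n v (u (int i))) * coord n z (int i)) = - of_int T" .
  have "(\<Sum>i=1..n. (coord n v (u (int i)))\<^sup>2 - (coord n v (int i))\<^sup>2)
      = (\<Sum>s\<in>?W. (coord n v (u s))\<^sup>2 - (coord n v s)\<^sup>2)"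
    by (rule sum_nat_int_window)
  also have "\<dots> = (\<Sum>s\<in>?W. of_int ((g (u s))\<^sup>2 - (g s)\<^sup>2) - 2 * cv * of_int (g (u s) - g s))"
    by (rule sum.cong) (auto simp: v algebra_simps power2_eq_square)
  also have "\<dots> = of_int U - 2 * cv * of_int (\<Sum>s\<in>?W. g (u s) - g s)"
    by (simp only: sum_subtractf[symmetric] of_int_sum sum_distrib_left U_def)
  also have "\<dots> = of_int U" by (simp only: S0) simp
  finally have S2: "(\<Sum>i=1..n. (coord n v (u (int i)))\<^sup>2 - (coord n v (int i))\<^sup>2) = of_int U" .
  define D where "D = bform n v omega0 - bform n (?w v) omega0"
  have "2 * of_int N * D = (\<Sum>i=1..n. (coord n v (u (int i)))\<^sup>2 - (coord n v (int i))\<^sup>2)"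
    using norm bform_coord[of n v v] bform_coord[of n "?w v" "?w v"]
    by (simp add: cw lv lw D_def power2_eq_square sum_subtractf algebra_simps)
  then have "2 * of_int N * D = of_int U" using S2 by simp
  moreover have "(of_int N :: complex) \<noteq> 0" using N_pos by simp
  ultimately have D: "D = of_int U / (2 * of_int N)" by (simp add: field_simps)
  have "bform n (v - ?w v) z = - of_int T + of_int p * D"
    using bform_coord[of n v z] bform_coord[of n "?w v" z] S1
    by (simp add: bform_bilinear cw lv lw lz D_def sum_subtractf algebra_simps)
  also have "\<dots> = of_real (real_of_int p / (2 * N) * U - T)" by (simp add: D)
  also have "real_of_int p / (2 * N) * U - T = (\<Sum>s\<in>?W. real_of_int p / (2 * N) * ((g (u s))\<^sup>2 - (g s)\<^sup>2) - (g (u s) - g s) * A s)"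
    by (simp only: sum_subtractf[symmetric] of_int_sum sum_distrib_left U_def T_def)
  also have "\<dots> = (\<Sum>s\<in>?W. ((p * g (u s) - N * A s)\<^sup>2 - (p * g s - N * A s)\<^sup>2) / (2 * p * N))"
    using N_pos p_pos by (intro sum.cong) (auto simp: field_simps power2_eq_square)
  also have "\<dots> = energy u" unfolding energy_def
  proof (rule sum_periodic_window[OF n0])
    fix s
    have "p * g (u (s + int n)) - N * A (s + int n) = p * g (u s) - N * A s"
      "p * g (s + int n) - N * A (s + int n) = p * g s - N * A s"
      unfolding affine_permsD(2)[OF u] g_period A_period by (simp_all add: algebra_simps)
    then show "real_of_int ((p * g (u (s + int n)) - N * A (s + int n))\<^sup>2 - (p * g (s + int n) - N * A (s + int n))\<^sup>2) / real_of_int (2 * p * N)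
       = real_of_int ((p * g (u s) - N * A s)\<^sup>2 - (p * g s - N * A s)\<^sup>2) / real_of_int (2 * p * N)"
      by (simp only:)
  qed
  finally show ?thesis .
qed

section \<open>The extended affine Weyl group\<close>

lemma affine_permI:
  assumes n: "n > 0" and per: "\<And>s. \<pi> (s + n) = \<pi> s + n"
    and inj: "inj_on (\<lambda>s. \<pi> s mod n) {0..<n}" and sum: "(\<Sum>s\<in>{0..<n}. \<pi> s - s) = 0"
  shows "\<pi> \<in> affine_perms n"
proof -
  have mult: "\<pi> (s + n * k) = \<pi> s + n * k" for s k by (rule quasiperiodic_multiple) (rule per)
  have red: "\<pi> s = \<pi> (s mod n) + n * (s div n)" for s using mult[of "s mod n" "s div n"] by simp
  have "inj \<pi>"
  proof (rule injI)
    fix s t assume eq: "\<pi> s = \<pi> t"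
    then have "\<pi> (s mod n) mod n = \<pi> (t mod n) mod n"
      using red[of s] red[of t] by (metis mod_mult_self2)
    then have m: "s mod n = t mod n" using inj n by (auto dest: inj_onD)
    then have "n * (s div n) = n * (t div n)" using red[of s] red[of t] eq unfolding m by linarith
    then show "s = t" using m by (metis mod_mult_div_eq)
  qed
  moreover have "surj \<pi>"
    unfolding surj_def
  proof
    fix y
    have "(\<lambda>s. \<pi> s mod n) ` {0..<n} = {0..<n}"
      using n card_image[OF inj] by (intro card_subset_eq) auto
    moreover have "y mod n \<in> {0..<n}" using n by simp
    ultimately obtain s where "y mod n = \<pi> s mod n" by (metis (no_types, lifting) imageE)
    then obtain k where "y = \<pi> s + n * k" by (metis mod_eqE)
    then show "\<exists>x. y = \<pi> x" using mult by metis
  qed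
  ultimately show ?thesis using per sum by (simp add: affine_perms_def bij_def)
qed

lemma word_perm_append: "word_perm n (xs @ ys) = word_perm n ys \<circ> word_perm n xs"
  by (induction xs) (simp_all add: comp_assoc id_def[symmetric])

lemma word_perm_rev:
  assumes "n \<ge> 2"
  shows "word_perm n (rev is) (word_perm n is s) = s"
  by (induction "is" arbitrary: s)
    (simp_all add: word_perm_append affine_transp_invol[OF mod_Suc_neq[OF assms]])

lemma word_perm_window:
  assumes "n \<ge> 2" "set is \<subseteq> {1..<n}" "s \<in> {1..int n}"
  shows "word_perm (int n) is s \<in> {1..int n}"
  using assms(2,3)
proof (induction "is" arbitrary: s)
  case (Cons i "is")
  have i: "1 \<le> i" "i < n" using Cons.prems by auto
  have "affine_transp (int n) (int i) (int i + 1) s \<in> {1..int n}"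
  proof -
    have "(x mod int n = y mod int n) = (x = y)" if "x \<in> {1..<1 + int n}" "y \<in> {1..<1 + int n}" for x y
      using inj_onD[OF inj_on_mod_window[of "int n" 1]] that by blast
    from this[of s "int i"] this[of s "int i + 1"] show ?thesis
      using i Cons.prems by (auto simp: affine_transp_def)
  qed
  then show ?case using Cons by simp
qed simp

context
  fixes n :: nat
  assumes n: "n \<ge> 2"
begin

text \<open>
  After sorting with the exchanges inside the window, the permutation still preserves the window, so
  it is increasing also across the border between two windows, hence trivial.
\<close>

lemma finite_window_perm_word:
  assumes \<pi>: "\<pi> \<in> affine_perms (int n)" and win: "\<And>s. s \<in> {1..int n} \<Longrightarrow> \<pi> s \<in> {1..int n}"
  shows "\<exists>is. set is \<subseteq> {1..<n} \<and> \<pi> = word_perm (int n) is"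
proof -
  have n2: "int n \<ge> 2" using n by simp
  obtain "is" v where *: "set is \<subseteq> {1..<n}" "v \<in> affine_perms (int n)"
    "\<forall>i\<in>{1..<n}. v (int i) < v (int i + 1)" "\<pi> = v \<circ> word_perm (int n) is"
    using affine_perm_sort[OF n2 \<pi>] by blast
  have vw: "v s \<in> {1..int n}" if "s \<in> {1..int n}" for s
  proof -
    have r: "word_perm (int n) (rev is) s \<in> {1..int n}"
      using word_perm_window[OF n _ that, of "rev is"] *(1) by simp
    have "word_perm (int n) is (word_perm (int n) (rev is) s) = s"
      using word_perm_rev[OF n2, of "rev is" s] by simp
    then have "v s = \<pi> (word_perm (int n) (rev is) s)" using *(4) by simp
    then show ?thesis using win[OF r] by simp
  qed
  have step1: "v s < v (s + 1)" if "s \<in> {1..int n}" for s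
  proof (cases "s = int n")
    case True
    have "v (s + 1) = v 1 + int n" using affine_permsD(2)[OF *(2), of 1] True by (simp add: add.commute)
    then show ?thesis using vw[of 1] vw[OF that] n by auto
  next
    case False
    then have "nat s \<in> {1..<n}" "int (nat s) = s" using that by auto
    then show ?thesis using *(3) by metis
  qed
  have "v s < v (s + 1)" for s
  proof -
    obtain i where i: "s = int i + int n * ((s - 1) div int n)" "1 \<le> i" "i \<le> n"
      using window_decomp[of n s] n by auto
    have "v (int i) < v (int i + 1)" using step1 i by simp
    moreover have "s + 1 = (int i + 1) + int n * ((s - 1) div int n)" using i(1) by simp
    ultimately show ?thesis using affine_permsD(3)[OF *(2)] i(1) by (metis add_less_cancel_right)
  qed
  then have "strict_mono v" by (rule strict_mono_int_stepI)
  then have "v s = s" for s using strict_mono_affine_perm_id[OF *(2)] n by auto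
  then have "\<pi> = word_perm (int n) is" using *(4) by (simp add: fun_eq_iff)
  then show ?thesis using *(1) by blast
qed

lemma transl_linear:
  "transl n V (u + v) = transl n V u + transl n V v"
  "transl n V (u - v) = transl n V u - transl n V v"
  "transl n V (smul z u) = smul z (transl n V u)"
  by (simp_all add: transl_def Let_def bform_bilinear smul_algebra algebra_simps add_divide_distrib diff_divide_distrib)

lemma transl_isometry:
  assumes "bform n V delta = 0"
  shows "bform n (transl n V u) (transl n V v) = bform n u v"
  using assms
  by (simp add: transl_def Let_def bform_bilinear bform_epsx_delta bform_sym[of n delta] bform_sym[of n V v] algebra_simps)

lemma transl_level_zero: "bform n v delta = 0 \<Longrightarrow> transl n V v = v - smul (bform n v V) delta"
  by (simp add: transl_def smul_algebra)

lemma htilde_closed: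
  "0 \<in> htilde n" "u \<in> htilde n \<Longrightarrow> v \<in> htilde n \<Longrightarrow> u + v \<in> htilde n"
  "u \<in> htilde n \<Longrightarrow> v \<in> htilde n \<Longrightarrow> u - v \<in> htilde n"
  "u \<in> htilde n \<Longrightarrow> zsmul k u \<in> htilde n" "omega0 \<in> htilde n"
  by (auto simp: htilde_def zsmul_def omega0_def zero_prod_def sum.distrib sum_subtractf sum_distrib_left[symmetric])

lemma weight_lattice_props:
  assumes "V \<in> weight_lattice n"
  shows "V \<in> htilde n" "bform n V delta = 0" "bform n V omega0 = 0"
proof -
  let ?T = "{v \<in> htilde n. bform n v delta = 0 \<and> bform n v omega0 = 0}"
  have "weight_lattice n \<subseteq> ?T"
    unfolding weight_lattice_def
  proof (rule zmod.span_minimal)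
    have "bform n omega0 delta = 1" "bform n omega0 omega0 = 0"
      by (simp_all add: bform_delta bform_omega0 omega0_def)
    then show "(\<lambda>i. omega n i - omega0) ` {1..<n} \<subseteq> ?T"
      using omega_props[OF n] htilde_closed(5) by (auto simp: bform_bilinear intro!: htilde_closed(3))
    show "zmod.subspace ?T"
      by (auto simp: zmod.subspace_def bform_bilinear htilde_closed)
  qed
  then show "V \<in> htilde n" "bform n V delta = 0" "bform n V omega0 = 0" using assms by auto
qed

lemma ext_weyl_props:
  assumes "\<gamma> \<in> ext_weyl n"
  shows "\<gamma> (u + v) = \<gamma> u + \<gamma> v" "\<gamma> (u - v) = \<gamma> u - \<gamma> v" "\<gamma> (smul z u) = smul z (\<gamma> u)"
    "bform n (\<gamma> u) (\<gamma> v) = bform n u v" "\<gamma> delta = delta"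
proof -
  obtain "is" V where \<gamma>: "\<gamma> = refl_word n is \<circ> transl n V" "V \<in> weight_lattice n"
    using assms by (auto simp: ext_weyl_def fin_weyl_def)
  show "\<gamma> (u + v) = \<gamma> u + \<gamma> v" "\<gamma> (u - v) = \<gamma> u - \<gamma> v" "\<gamma> (smul z u) = smul z (\<gamma> u)"
    "bform n (\<gamma> u) (\<gamma> v) = bform n u v"
    using weight_lattice_props[OF \<gamma>(2)]
    by (simp_all add: \<gamma>(1) transl_linear refl_word_linear[OF n] refl_word_isometry[OF n] transl_isometry)
  have "transl n V delta = delta"
    using weight_lattice_props[OF \<gamma>(2)] bform_epsx_delta(3)[of n]
    by (simp add: transl_level_zero bform_sym[of n delta V] smul_algebra)
  then show "\<gamma> delta = delta" by (simp add: \<gamma>(1) refl_word_delta[OF n])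
qed

lemma sum_bform_alpha: "(\<Sum>j<n. bform n v (alpha n (int j))) = bform n v delta"
proof -
  have "(\<Sum>j<n. bform n v (alpha n (int j))) = (\<Sum>j<n. coord n v (int j) - coord n v (int (Suc j)))"
    using n by (simp add: bform_alpha add.commute)
  also have "\<dots> = coord n v 0 - coord n v (int n)" using sum_lessThan_telescope'[of "\<lambda>j. coord n v (int j)" n] by simp
  also have "\<dots> = bform n v delta" using coord_mult[of n v 0 1] n by simp
  finally show ?thesis .
qed

lemma htilde_level_zero_eqI:
  assumes "v \<in> htilde n" "w \<in> htilde n" "bform n v delta = 0" "bform n w delta = 0"
    and "bform n v omega0 = bform n w omega0"
    and \<alpha>: "\<And>j. 1 \<le> j \<Longrightarrow> j < n \<Longrightarrow> bform n v (alpha n (int j)) = bform n w (alpha n (int j))"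
  shows "v = w"
proof (rule htilde_eqI[OF n assms(1,2)])
  fix j assume j: "j < n"
  have split: "(\<Sum>j<n. f j) = f 0 + (\<Sum>j=1..<n. f j)" for f :: "nat \<Rightarrow> complex"
    using n by (simp add: lessThan_atLeast0 sum.atLeast_Suc_lessThan)
  have "(\<Sum>j=1..<n. bform n v (alpha n (int j))) = (\<Sum>j=1..<n. bform n w (alpha n (int j)))"
    using \<alpha> by (intro sum.cong) auto
  then have "bform n v (alpha n (int 0)) = bform n w (alpha n (int 0))"
    using sum_bform_alpha[of v] sum_bform_alpha[of w] assms(3,4) unfolding split by (metis add_right_cancel)
  then show "bform n v (alpha n (int j)) = bform n w (alpha n (int j))"
    using \<alpha>[of j] j by (cases "j = 0") auto
qed (rule assms(5))

lemma bform_omega0_alpha: "1 \<le> i \<Longrightarrow> i < n \<Longrightarrow> bform n omega0 (alpha n (int i)) = 0"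
  using coord_nat[of i n omega0] coord_nat[of "Suc i" n omega0] n
  by (simp add: bform_alpha omega0_def add.commute)

lemma fin_word_omega0: "set is \<subseteq> {1..<n} \<Longrightarrow> refl_word n is omega0 = omega0"
  by (induction "is") (auto simp: refl_word_simps[OF n] simple_refl_def bform_omega0_alpha smul_algebra)

text \<open>
  The coefficient of \<open>\<delta>\<close> in the images of the finite simple roots determines the translation, because
  the finite Weyl group does not change it.  The rest of the images determines the finite part:
  the coordinates of a simple root are \<open>1\<close> and \<open>-1\<close> at two neighbouring places, from which the
  permutation can be read off.
\<close>

lemma ext_weyl_eqI:
  assumes \<gamma>: "\<gamma> \<in> ext_weyl n" and \<gamma>': "\<gamma>' \<in> ext_weyl n"
    and eq: "\<And>i. 1 \<le> i \<Longrightarrow> i < n \<Longrightarrow> \<gamma> (alpha n (int i)) = \<gamma>' (alpha n (int i))"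
  shows "\<gamma> = \<gamma>'"
proof -
  obtain "is" V where is_V: "\<gamma> = refl_word n is \<circ> transl n V" "set is \<subseteq> {1..<n}" "V \<in> weight_lattice n"
    using \<gamma> by (auto simp: ext_weyl_def fin_weyl_def)
  obtain is' V' where is_V': "\<gamma>' = refl_word n is' \<circ> transl n V'" "set is' \<subseteq> {1..<n}" "V' \<in> weight_lattice n"
    using \<gamma>' by (auto simp: ext_weyl_def fin_weyl_def)
  have ev: "(refl_word n js \<circ> transl n U) (alpha n (int i))
      = refl_word n js (alpha n (int i)) - smul (bform n U (alpha n (int i))) delta" for js U i
    using bform_alpha_delta[OF n, of "int i"]
    by (simp add: transl_level_zero refl_word_linear[OF n] refl_word_delta[OF n] bform_sym[of n U])
  have md: "bform n (refl_word n js v) omega0 = bform n v omega0" if "set js \<subseteq> {1..<n}" for js v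
    using refl_word_isometry[OF n, of js v omega0] fin_word_omega0[OF that] by simp
  have V: "bform n V (alpha n (int i)) = bform n V' (alpha n (int i))" if i: "1 \<le> i" "i < n" for i
  proof -
    have "bform n (\<gamma> (alpha n (int i))) omega0 = bform n (\<gamma>' (alpha n (int i))) omega0" using eq[OF i] by simp
    moreover have "bform n delta omega0 = 1" by (simp add: bform_omega0 delta_def)
    ultimately show ?thesis
      unfolding is_V(1) is_V'(1) ev using md is_V(2) is_V'(2) by (simp add: bform_bilinear)
  qed
  then have VV: "V = V'"
    using weight_lattice_props[OF is_V(3)] weight_lattice_props[OF is_V'(3)]
    by (intro htilde_level_zero_eqI) auto
  have w: "refl_word n is (alpha n (int i)) = refl_word n is' (alpha n (int i))" if i: "1 \<le> i" "i < n" for i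
    using eq[OF i] V[OF i] unfolding is_V(1) is_V'(1) ev by simp
  let ?u = "word_perm (int n) is" and ?u' = "word_perm (int n) is'"
  have cmp: "?u s = ?u' s" if s: "s \<in> {1..int n}" for s
  proof -
    have us: "?u s \<in> {1..int n}" "?u' s \<in> {1..int n}"
      using word_perm_window[OF n is_V(2) s] word_perm_window[OF n is_V'(2) s] by auto
    have ind: "(x mod int n = y mod int n) = (x = y)" if "x \<in> {1..int n}" "y \<in> {1..int n}" for x y
      using inj_onD[OF inj_on_mod_window[of "int n" 1], of x y] that by auto
    have c: "coord n (alpha n (int i)) t = (if int i = t then 1 else 0) - (if int i + 1 = t then 1 else 0)"
      if "1 \<le> i" "i < n" "t \<in> {1..int n}" for i t
      using that ind[of "int i" t] ind[of "int i + 1" t] n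
      by (simp add: coord_def alpha_epsx bform_bilinear bform_epsx)
    have e: "coord n (alpha n (int i)) (?u s) = coord n (alpha n (int i)) (?u' s)" if "1 \<le> i" "i < n" for i
      using w[OF that] coord_refl_word[OF n] by metis
    show ?thesis
    proof (cases "?u s < int n")
      case True
      define i where "i = nat (?u s)"
      have i: "1 \<le> i" "i < n" "int i = ?u s" using True us by (auto simp: i_def)
      then show ?thesis using e[OF i(1,2)] c[OF i(1,2) us(1)] c[OF i(1,2) us(2)] by (auto split: if_splits)
    next
      case False
      then have un: "?u s = int n" using us by simp
      define i where "i = n - 1"
      have i: "1 \<le> i" "i < n" "int i + 1 = int n" using n by (auto simp: i_def)
      then show ?thesis using e[OF i(1,2)] c[OF i(1,2) us(1)] c[OF i(1,2) us(2)] un by (auto split: if_splits)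
    qed
  qed
  have "?u = ?u'"
  proof
    fix s
    obtain i where i: "s = int i + int n * ((s - 1) div int n)" "1 \<le> i" "i \<le> n"
      using window_decomp[of n s] n by auto
    have "?u (int i) = ?u' (int i)" using cmp i by simp
    then show "?u s = ?u' s"
      using affine_permsD(3)[OF word_perm_affine[of "int n"]] n i(1) by (metis of_nat_le_iff of_nat_numeral)
  qed
  then have "refl_word n is = refl_word n is'" by (rule refl_word_eqI[OF n])
  then show ?thesis using VV is_V(1) is_V'(1) by simp
qed

text \<open>
  On the extended basis the required map is \<open>\<epsilon> i \<mapsto> \<epsilon> (g i)\<close> up to a common multiple of \<open>\<delta>\<close>.  Writing
  \<open>g i\<close> as a residue in \<open>{1..n}\<close> plus \<open>n\<close> times a quotient, the residues give the finite Weyl group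
  element and the quotients, corrected by their mean so that the coordinate sum vanishes, give the
  translation.
\<close>

lemma ext_weyl_exists:
  fixes g :: "int \<Rightarrow> int"
  assumes per: "\<And>s. g (s + int n) = g s + int n * int p'"
    and inj: "inj_on (\<lambda>s. g s mod int n) {0..<int n}" and mono: "\<And>s. g s \<le> g (s + 1)"
  shows "\<exists>\<gamma>\<in>ext_weyl n. \<forall>i<n. \<gamma> (alpha' n p' i) = alpha_seg n (g (int i)) (g (int i + 1))"
proof -
  have n0: "int n > 0" "n > 0" using n by auto
  define \<pi> where "\<pi> s = (g s - 1) mod int n + 1 + int n * ((s - 1) div int n)" for s
  define m where "m i = (g (int i) - 1) div int n" for i :: nat
  have g_\<pi>: "g (int i) = \<pi> (int i) + int n * m i" if "i \<in> {1..n}" for i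
  proof -
    have "(int i - 1) div int n = 0" using that by auto
    then show ?thesis by (simp add: \<pi>_def m_def)
  qed
  have \<pi>_mod: "\<pi> s mod int n = g s mod int n" for s
    by (simp add: \<pi>_def) (simp add: mod_simps)
  have \<pi>_win: "\<pi> s \<in> {1..int n}" if "s \<in> {1..int n}" for s
  proof -
    have "(s - 1) div int n = 0" using that by auto
    moreover have "0 \<le> (g s - 1) mod int n" "(g s - 1) mod int n < int n" using n0 by simp_all
    ultimately show ?thesis by (simp add: \<pi>_def)
  qed
  have \<pi>_per: "\<pi> (s + int n) = \<pi> s + int n" for s
  proof -
    have e: "s + int n - 1 = (s - 1) + int n" "g s + int n * int p' - 1 = (g s - 1) + int n * int p'" by simp_all
    have "(s + int n - 1) div int n = (s - 1) div int n + 1"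
      "(g s + int n * int p' - 1) mod int n = (g s - 1) mod int n"
      unfolding e using n0 by simp_all
    then show ?thesis unfolding \<pi>_def per by (simp add: distrib_left)
  qed
  have \<pi>_inj: "inj_on (\<lambda>s. \<pi> s mod int n) {0..<int n}" using inj by (simp add: \<pi>_mod)
  have \<pi>: "\<pi> \<in> affine_perms (int n)"
  proof (rule affine_permI[OF n0(1) \<pi>_per \<pi>_inj])
    have inj_win: "inj_on \<pi> {1..int n}"
    proof (rule inj_onI)
      fix x y assume xy: "x \<in> {1..int n}" "y \<in> {1..int n}" "\<pi> x = \<pi> y"
      define h where "h s = g (s mod int n) mod int n" for s
      have hg: "g s mod int n = h s" for s
      proof -
        have "g (s mod int n + int n * (s div int n)) = g (s mod int n) + int n * int p' * (s div int n)"
          by (rule quasiperiodic_multiple) (rule per)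
        then show ?thesis by (simp add: h_def mult.assoc)
      qed
      have "h x = h y" using xy(3) \<pi>_mod[of x] \<pi>_mod[of y] hg by simp
      then have "x mod int n = y mod int n"
        using inj n0 unfolding h_def by (auto dest!: inj_onD)
      then show "x = y" using inj_onD[OF inj_on_mod_window[of "int n" 1], of x y] xy by auto
    qed
    have im: "\<pi> ` {1..int n} = {1..int n}"
      using \<pi>_win card_image[OF inj_win] by (intro card_subset_eq) auto
    have "(\<Sum>s\<in>{0..<int n}. \<pi> s - s) = (\<Sum>s\<in>{1..<1 + int n}. \<pi> s - s)"
      by (rule sum_periodic_window[symmetric]) (use n0 \<pi>_per in auto)
    also have "{1..<1 + int n} = {1..int n}" by auto
    also have "(\<Sum>s\<in>{1..int n}. \<pi> s - s) = (\<Sum>s\<in>{1..int n}. \<pi> s) - (\<Sum>s\<in>{1..int n}. s)"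
      by (simp add: sum_subtractf)
    also have "(\<Sum>s\<in>{1..int n}. \<pi> s) = (\<Sum>s\<in>\<pi> ` {1..int n}. s)" by (simp add: sum.reindex[OF inj_win])
    finally show "(\<Sum>s\<in>{0..<int n}. \<pi> s - s) = 0" by (simp add: im)
  qed
  obtain "is" where "is": "set is \<subseteq> {1..<n}" "\<pi> = word_perm (int n) is"
    using finite_window_perm_word[OF \<pi> \<pi>_win] by blast
  let ?w = "refl_word n (rev is)"
  \<comment> \<open>A word acts on the extended basis by the inverse of its permutation, hence the reversed word.\<close>
  have w_epsx: "?w (epsx n r) = epsx n (\<pi> r)" for r
    using refl_word_epsx[OF n, of "rev is" "\<pi> r"] word_perm_rev[of "int n" "is" r] n "is"(2) by simp
  define mean :: complex where "mean = (\<Sum>i=1..n. of_int (m i)) / of_nat n"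
  define V :: avec where "V = ((\<lambda>i. if i \<in> {1..n} then of_int (m i) - mean else 0), 0, 0)"
  have V_h: "V \<in> htilde n" using n0 by (simp add: htilde_def V_def sum_subtractf mean_def)
  have V_d: "bform n V delta = 0" "bform n V omega0 = 0" by (simp_all add: V_def bform_delta bform_omega0)
  have V_c: "coord n V (int i) = of_int (m i) - mean" if "i \<in> {1..n}" for i
    using that by (simp add: coord_nat) (simp add: V_def)
  define V' where "V' = (\<Sum>i\<in>{1..<n}. zsmul (m i - m (Suc i)) (omega n i - omega0))"
  have V'_l: "V' \<in> weight_lattice n"
    unfolding V'_def weight_lattice_def
    by (intro zmod.span_sum zmod.span_scale zmod.span_base) auto
  have "V = V'"
  proof (rule htilde_level_zero_eqI)
    fix j assume j: "1 \<le> j" "j < n"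
    have "bform n V (alpha n (int j)) = of_int (m j - m (Suc j))"
      using V_c[of j] V_c[of "Suc j"] j n0 by (simp add: bform_alpha add.commute)
    moreover have "bform n V' (alpha n (int j)) = (\<Sum>i\<in>{1..<n}. of_int (m i - m (Suc i)) * (if i = j then 1 else 0))"
      unfolding V'_def bform_sum_left
    proof (rule sum.cong)
      fix i assume "i \<in> {1..<n}"
      then have "i < n" by simp
      then show "bform n (zsmul (m i - m (Suc i)) (omega n i - omega0)) (alpha n (int j))
          = of_int (m i - m (Suc i)) * (if i = j then 1 else 0)"
        using j omega_props(3)[OF n, of i j] by (simp add: bform_bilinear bform_omega0_alpha)
    qed simp
    moreover have "\<dots> = of_int (m j - m (Suc j))"
      using j by (simp add: if_distrib[of "\<lambda>x. _ * x"] del: of_int_diff cong: if_cong)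
    ultimately show "bform n V (alpha n (int j)) = bform n V' (alpha n (int j))" by simp
  qed (use V_h V_d weight_lattice_props[OF V'_l] in auto)
  then have V_l: "V \<in> weight_lattice n" using V'_l by simp
  define \<gamma> where "\<gamma> = ?w \<circ> transl n V"
  have "?w \<in> fin_weyl n" unfolding fin_weyl_def using "is"(1) by (auto intro!: exI[of _ "rev is"])
  then have \<gamma>_ext: "\<gamma> \<in> ext_weyl n"
    unfolding ext_weyl_def \<gamma>_def using V_l by blast
  note lin = ext_weyl_props[OF \<gamma>_ext]
  have \<gamma>_epsx: "\<gamma> (epsx n (int i)) = epsx n (g (int i)) + smul mean delta" if i: "i \<in> {1..n}" for i
  proof -
    have "\<gamma> (epsx n (int i)) = ?w (epsx n (int i) - smul (of_int (m i) - mean) delta)"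
      using V_c[OF i] by (simp add: \<gamma>_def transl_level_zero bform_epsx_delta coord_def bform_sym[of n "epsx n (int i)" V])
    also have "\<dots> = epsx n (\<pi> (int i)) - smul (of_int (m i) - mean) delta"
      by (simp add: refl_word_linear[OF n] refl_word_delta[OF n] w_epsx)
    also have "\<dots> = epsx n (g (int i)) + smul mean delta"
      using g_\<pi>[OF i] epsx_mult[OF n0(2), of "\<pi> (int i)" "m i"] by (simp add: zsmul_def smul_algebra)
    finally show ?thesis .
  qed
  have "\<gamma> (alpha' n p' i) = alpha_seg n (g (int i)) (g (int i + 1))" if i: "i < n" for i
  proof (cases "i = 0")
    case False
    have "\<gamma> (alpha n (int i)) = \<gamma> (epsx n (int i)) - \<gamma> (epsx n (int (Suc i)))"
      using n0 by (simp add: alpha_epsx lin add.commute)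
    also have "\<dots> = epsx n (g (int i)) - epsx n (g (int (Suc i)))"
      using \<gamma>_epsx[of i] \<gamma>_epsx[of "Suc i"] i False by simp
    finally show ?thesis using False alpha_seg_epsx[OF n0(2) mono[of "int i"]] by (simp add: alpha'_def add.commute)
  next
    case True
    have "epsx n 0 = epsx n (int n) + delta"
      using epsx_mult[OF n0(2), of 0 1] by (simp add: zsmul_def smul_algebra)
    then have a: "alpha' n p' 0 = epsx n (int n) - epsx n (int 1) + smul (of_nat p') delta"
      using alpha_epsx[OF n0(2), of 0] by (simp add: alpha'_def zsmul_def smul_algebra)
    have gn: "epsx n (g (int n)) = epsx n (g 0) - smul (of_nat p') delta"
      using per[of 0] epsx_mult[OF n0(2), of "g 0" "int p'"] by (simp add: zsmul_def)
    have "\<gamma> (alpha' n p' 0) = \<gamma> (epsx n (int n)) - \<gamma> (epsx n (int 1)) + smul (of_nat p') delta"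
      unfolding a lin ..
    also have "\<dots> = epsx n (g (int n)) - epsx n (g (int 1)) + smul (of_nat p') delta"
      using \<gamma>_epsx[of n] \<gamma>_epsx[of 1] n0 by simp
    also have "\<dots> = epsx n (g 0) - epsx n (g (0 + 1))" by (simp add: gn)
    finally show ?thesis using True alpha_seg_epsx[OF n0(2) mono[of 0]] by simp
  qed
  then show ?thesis using \<gamma>_ext by blast
qed

end

section \<open>Permitted patterns as Burge families\<close>

text \<open>
  The element \<open>\<gamma>\<close> is an isometry that maps the roots \<open>\<alpha>'\<close> to the differences of the extended basis at
  \<open>g s\<close> and \<open>g (s + 1)\<close>.  So these pair with \<open>\<Lambda> + \<rho>\<close> as the \<open>\<alpha>'\<close> do with the vector before applying
  \<open>\<gamma>\<close>, and the multiple of \<open>\<omega>\<^sub>0\<close> in that vector is such that all these pairings are \<open>a + 1\<close>.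
\<close>

lemma Lambda_coords:
  assumes n: "n \<ge> 2" and par: "admissible_params n p p' a b" and \<Lambda>: "\<Lambda> = Lambda_ab n p p' a b"
  shows "coord n (\<Lambda> + rho n) (gseq n b s) = coord n (\<Lambda> + rho n) 0 - of_int (gseq n a s)"
    and "bform n (\<Lambda> + rho n) delta = of_nat p / of_nat p'"
proof -
  have n0: "n > 0" "int n > 0" using n by auto
  have par': "p > 0" "p' > 0" "int (\<Sum>i<n. a i) = int p - int n"
    "int (\<Sum>i<n. b i) = int p' * int n - int n" "inj_on (\<lambda>s. gseq n b s mod int n) {0..<int n}"
    using par by (auto simp: admissible_params_def)
  have per: "gseq n b (s + int n) = gseq n b s + int n * int p'" for s
    using gseq_period[OF n0(1), of b s] par'(4) by (simp add: mult.commute)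
  have mono: "gseq n b s \<le> gseq n b (s + 1)" for s by (simp add: gseq_step)
  let ?P = "\<lambda>\<gamma>. \<gamma> \<in> ext_weyl n \<and>
     (\<forall>i<n. \<gamma> (alpha' n p' i) = alpha_seg n (gseq n b (int i)) (gseq n b (int i + 1)))"
  have "\<exists>!\<gamma>. ?P \<gamma>"
  proof (rule ex_ex1I)
    show "\<exists>\<gamma>. ?P \<gamma>" using ext_weyl_exists[OF n per par'(5) mono] by blast
  next
    fix \<gamma> \<gamma>' assume P: "?P \<gamma>" "?P \<gamma>'"
    have "\<gamma> (alpha n (int i)) = \<gamma>' (alpha n (int i))" if "1 \<le> i" "i < n" for i
    proof -
      have "alpha' n p' i = alpha n (int i)" using that by (simp add: alpha'_def)
      then show ?thesis using P that by metis
    qed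
    then show "\<gamma> = \<gamma>'" using P by (intro ext_weyl_eqI[OF n]) auto
  qed
  from theI'[OF this] have "?P (gamma n p' b)" unfolding gamma_def .
  then have \<gamma>: "gamma n p' b \<in> ext_weyl n"
    and \<gamma>\<alpha>: "\<And>i. i < n \<Longrightarrow> gamma n p' b (alpha' n p' i) = alpha_seg n (gseq n b (int i)) (gseq n b (int i + 1))"
    by auto
  define \<kappa> :: complex where "\<kappa> = of_nat p / of_nat p'"
  define z where "z = (\<Sum>i<n. smul (of_nat (a i)) (omega n i)) + rho n"
  define \<zeta> where "\<zeta> = z - smul ((of_nat p' - 1) * \<kappa>) omega0"
  define c where "c = bform n (gamma n p' b \<zeta> - rho n) omega0"
  have e: "(\<Sum>i<n. smul (of_nat (a i)) (omega n i)) - smul ((of_nat p' - 1) * \<kappa>) omega0 + rho n = \<zeta>"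
    by (simp add: \<zeta>_def z_def)
  have c: "\<Lambda> + rho n = gamma n p' b \<zeta> - smul c delta"
    unfolding \<Lambda> Lambda_ab_def Let_def \<kappa>_def[symmetric] e c_def by simp
  let ?Y = "coord n (\<Lambda> + rho n)"
  have z: "bform n z (alpha n (int j)) = of_nat (a j) + 1" if "j < n" for j
    using dominant_vector_props(1)[OF n that, of a] by (simp add: z_def)
  have "bform n z delta = of_nat ((\<Sum>i<n. a i) + n)"
    using dominant_vector_props(2)[OF n, of a] by (simp add: z_def)
  also have "(\<Sum>i<n. a i) + n = p" using par'(3) by linarith
  finally have z\<delta>: "bform n z delta = of_nat p" .
  have o: "bform n omega0 delta = 1" by (simp add: bform_delta omega0_def)
  have \<kappa>: "of_nat p' * \<kappa> = of_nat p" using par'(2) by (simp add: \<kappa>_def)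
  have \<zeta>\<delta>: "bform n \<zeta> delta = \<kappa>"
    using \<kappa> by (simp add: \<zeta>_def bform_bilinear z\<delta> o algebra_simps)
  have \<zeta>\<alpha>: "bform n (alpha' n p' i) \<zeta> = of_nat (a i) + 1" if i: "i < n" for i
  proof (cases "i = 0")
    case False
    then show ?thesis
      using z[OF i] bform_omega0_alpha[OF n, of i] i
      by (simp add: alpha'_def bform_sym[of n "alpha n (int i)"] \<zeta>_def bform_bilinear)
  next
    case True
    have "coord n omega0 0 = coord n omega0 (int n) + 1"
      using coord_mult[OF n0(1), of omega0 0 1] o by simp
    moreover have "coord n omega0 (int n) = 0" "coord n omega0 (int 1) = 0"
      using n0 coord_nat[of n n omega0] coord_nat[of 1 n omega0] by (simp_all add: omega0_def)
    ultimately have o\<alpha>: "bform n omega0 (alpha n 0) = 1" by (simp add: bform_alpha n0)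
    have "bform n (alpha' n p' i) \<zeta> = bform n \<zeta> (alpha n 0) + (of_nat p' - 1) * bform n \<zeta> delta"
      by (simp add: True alpha'_def bform_bilinear bform_sym[of n delta] bform_sym[of n "alpha n 0"])
    also have "bform n \<zeta> (alpha n 0) = of_nat (a 0) + 1 - (of_nat p' - 1) * \<kappa>"
      using z[of 0] n0 o\<alpha> by (simp add: \<zeta>_def bform_bilinear)
    finally show ?thesis using True by (simp add: \<zeta>\<delta>)
  qed
  have Y_step: "?Y (gseq n b (int i)) - ?Y (gseq n b (int i + 1)) = of_nat (a i) + 1" if i: "i < n" for i
  proof -
    have "?Y (gseq n b (int i)) - ?Y (gseq n b (int i + 1))
        = bform n (gamma n p' b (alpha' n p' i)) (gamma n p' b \<zeta> - smul c delta)"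
      using bform_alpha_seg[OF n0(1) mono[of "int i"], of "\<Lambda> + rho n"] c \<gamma>\<alpha>[OF i] by simp
    also have "\<dots> = bform n (alpha' n p' i) \<zeta>"
    proof -
      have "bform n (alpha' n p' i) delta = 0"
        using bform_alpha_delta[OF n] bform_epsx_delta(3)[of n] by (simp add: alpha'_def bform_bilinear)
      moreover have "bform n (gamma n p' b (alpha' n p' i)) delta = bform n (alpha' n p' i) delta"
        using ext_weyl_props(4,5)[OF n \<gamma>] by metis
      ultimately show ?thesis using ext_weyl_props(4)[OF n \<gamma>] by (simp add: bform_bilinear)
    qed
    finally show ?thesis using \<zeta>\<alpha>[OF i] by simp
  qed
  have "bform n (\<Lambda> + rho n) delta = bform n (gamma n p' b \<zeta>) (gamma n p' b delta)"
    using bform_epsx_delta(3)[of n] ext_weyl_props(5)[OF n \<gamma>] by (simp add: c bform_bilinear)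
  then have level: "bform n (\<Lambda> + rho n) delta = \<kappa>"
    using ext_weyl_props(4)[OF n \<gamma>] \<zeta>\<delta> by simp
  then show "bform n (\<Lambda> + rho n) delta = of_nat p / of_nat p'" by (simp add: \<kappa>_def)
  define h where "h s = ?Y (gseq n b s) + of_int (gseq n a s)" for s
  have h_per: "h (s + int n) = h s" for s
  proof -
    have ga: "gseq n a (s + int n) = gseq n a s + int p"
      using gseq_period[OF n0(1), of a s] par'(3) by simp
    show ?thesis unfolding h_def per ga
      using \<kappa> by (simp add: coord_mult[OF n0(1)] level)
  qed
  have h_step: "h (s + 1) = h s" for s
  proof -
    have "h (s mod int n + 1) = h (s mod int n)"
    proof -
      have i: "nat (s mod int n) < n" "int (nat (s mod int n)) = s mod int n"
        using n0 by (auto simp: nat_less_iff)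
      have "?Y (gseq n b (s mod int n)) - ?Y (gseq n b (s mod int n + 1)) = of_nat (a (nat (s mod int n))) + 1"
        using Y_step[OF i(1)] i(2) by simp
      then show ?thesis unfolding h_def gseq_step[of n a] by (simp add: algebra_simps)
    qed
    moreover have "h ((s + 1) mod int n) = h (s + 1)" "h (s mod int n) = h s"
      by (rule periodic_mod, rule h_per)+
    moreover have "h ((s mod int n + 1) mod int n) = h (s mod int n + 1)"
      by (rule periodic_mod, rule h_per)
    moreover have "(s mod int n + 1) mod int n = (s + 1) mod int n" by (simp add: mod_simps)
    ultimately show ?thesis by metis
  qed
  have "h (s mod 1) = h s" by (rule periodic_mod, rule h_step)
  then show "?Y (gseq n b s) = ?Y 0 - of_int (gseq n a s)"
    by (simp add: h_def gseq_0 algebra_simps)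
qed

text \<open>
  The columns of a pattern are indexed by all integers; those at the \<open>g s\<close> represent all of them
  up to simultaneous translation by multiples of \<open>n\<close>.
\<close>

locale burge_patterns = cylinder "int n" "int p' * int n" "int p" g A
  for n p p' :: nat and g A :: "int \<Rightarrow> int" +
  assumes g_inj: "inj_on (\<lambda>s. g s mod int n) {0..<int n}" and p_coprime: "coprime p p'"
begin

lemma n_positive: "int n > 0" using n_ge_2 by simp

lemma g_congruent: "g s mod int n = g t mod int n \<longleftrightarrow> s mod int n = t mod int n"
proof -
  have h: "g (s mod int n) mod int n = g s mod int n" for s
    by (rule periodic_mod[where h = "\<lambda>s. g s mod int n"]) (simp add: g_period)
  have "s mod int n = t mod int n" if "g s mod int n = g t mod int n"
    using g_inj that h[of s] h[of t] n_positive by (auto dest!: inj_onD[of _ _ "s mod int n" "t mod int n"])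
  then show ?thesis using h by metis
qed

lemma g_covers: "\<exists>s. g s mod int n = l mod int n"
proof -
  have "(\<lambda>s. g s mod int n) ` {0..<int n} = {0..<int n}"
    using n_positive card_image[OF g_inj] by (intro card_subset_eq) auto
  moreover have "l mod int n \<in> {0..<int n}" using n_positive by simp
  ultimately show ?thesis by (metis (no_types, lifting) imageE)
qed

definition family_of :: "(int \<Rightarrow> int \<Rightarrow> nat) \<Rightarrow> int \<Rightarrow> nat \<Rightarrow> nat" where
  "family_of d = (\<lambda>s k. d (g s + int k) (g s))"

definition pattern_of :: "(int \<Rightarrow> nat \<Rightarrow> nat) \<Rightarrow> int \<Rightarrow> int \<Rightarrow> nat" where
  "pattern_of \<mu> = (\<lambda>i j. if i < j then 0 else \<mu> (SOME s. g s mod int n = j mod int n) (nat (i - j)))"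

lemma agt_shift:
  assumes d: "agt_pattern n d"
  shows "d (i + int n * k) (j + int n * k) = d i j"
proof -
  have step: "d (i + int n) (j + int n) = d i j" for i j
    using d by (cases "i < j") (auto simp: agt_pattern_def)
  have "d (i + (x + int n)) (j + (x + int n)) = d (i + x) (j + x)" for x
    using step[of "i + x" "j + x"] by (simp add: add.assoc)
  then show ?thesis using periodic_mult[of "\<lambda>x. d (i + x) (j + x)" "int n" 0 k] by simp
qed

lemma family_of_families:
  assumes d: "agt_pattern n d"
  shows "family_of d \<in> part_families (int n)"
proof -
  have "family_of d (s + int n) = family_of d s" for s
  proof
    fix k
    have e: "g (s + int n) = g s + int n * int p'" by (simp add: g_period)
    have "d (g s + int n * int p' + int k) (g s + int n * int p') = d (g s + int k + int n * int p') (g s + int n * int p')"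
      by (simp add: algebra_simps)
    then show "family_of d (s + int n) k = family_of d s k"
      unfolding family_of_def e using agt_shift[OF d] by simp
  qed
  moreover have "is_part (family_of d s)" for s
  proof -
    have dec: "family_of d s (Suc k) \<le> family_of d s k" for k
    proof -
      have "d (g s + int k + 1) (g s) \<le> d (g s + int k) (g s)"
        using d by (simp add: agt_pattern_def)
      then show ?thesis by (simp add: family_of_def add_ac)
    qed
    have mono: "family_of d s l \<le> family_of d s k" if "k \<le> l" for k l
      using that by (rule lift_Suc_antimono_le[of "family_of d s", rotated]) (rule dec)
    have fin: "finite {j. j \<le> g s \<and> d (g s) j \<noteq> 0}" using d by (simp add: agt_pattern_def)
    \<comment> \<open>A pattern has finitely many nonzero entries in each row.  Moving down the column by multiples
      of \<open>n\<close> amounts to moving to the left in row \<open>g s\<close>, so the column vanishes eventually.\<close>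
    have "\<exists>k0::nat. d (g s) (g s - int n * int k0) = 0"
    proof (rule ccontr)
      assume "\<not> ?thesis"
      then have "range (\<lambda>k::nat. g s - int n * int k) \<subseteq> {j. j \<le> g s \<and> d (g s) j \<noteq> 0}" by auto
      then have "finite (range (\<lambda>k::nat. g s - int n * int k))" using fin finite_subset by blast
      moreover have "inj (\<lambda>k::nat. g s - int n * int k)" using n_positive by (auto simp: inj_def)
      ultimately show False using finite_imageD infinite_UNIV_nat by blast
    qed
    then obtain k0 :: nat where "d (g s) (g s - int n * int k0) = 0" by blast
    then have "d (g s + int n * int k0) (g s) = 0"
      using agt_shift[OF d, of "g s" "int k0" "g s - int n * int k0"] by simp
    then have "family_of d s (n * k0) = 0" by (simp add: family_of_def)
    then have "family_of d s k = 0" if "k \<ge> n * k0" for k using mono[OF that] by simp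
    then show ?thesis using dec by (intro is_partI) auto
  qed
  ultimately show ?thesis by (auto simp: part_families_def)
qed

lemma family_vanishes:
  assumes \<mu>: "\<mu> \<in> part_families (int n)" and "k \<ge> family_size (int n) \<mu>"
  shows "\<mu> s k = 0"
proof -
  have "psize (\<mu> (s mod int n)) \<le> family_size (int n) \<mu>"
    unfolding family_size_def by (rule member_le_sum) (use n_positive in auto)
  moreover have "\<mu> (s mod int n) = \<mu> s" by (rule part_familiesD(4)[OF \<mu>]) simp
  ultimately show ?thesis using part_zero_beyond_psize[OF part_familiesD(1)[OF \<mu>]] assms(2) by simp
qed

lemma pattern_of_agt:
  assumes \<mu>: "\<mu> \<in> part_families (int n)"
  shows "agt_pattern n (pattern_of \<mu>)"
  unfolding agt_pattern_def
proof (intro conjI allI impI)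
  fix i j :: int assume "j \<le> i"
  then show "pattern_of \<mu> (i + 1) j \<le> pattern_of \<mu> i j"
    unfolding pattern_of_def using is_part_antimono[OF part_familiesD(1)[OF \<mu>]] by (simp add: nat_mono)
next
  fix i
  have "{j. j \<le> i \<and> pattern_of \<mu> i j \<noteq> 0} \<subseteq> {i - int (family_size (int n) \<mu>)..i}"
  proof
    fix j assume "j \<in> {j. j \<le> i \<and> pattern_of \<mu> i j \<noteq> 0}"
    then have "j \<le> i" "\<not> family_size (int n) \<mu> \<le> nat (i - j)"
      using family_vanishes[OF \<mu>] by (auto simp: pattern_of_def)
    then show "j \<in> {i - int (family_size (int n) \<mu>)..i}" by auto
  qed
  then show "finite {j. j \<le> i \<and> pattern_of \<mu> i j \<noteq> 0}" by (rule finite_subset) simp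
qed (auto simp: pattern_of_def)

lemma family_of_pattern_of:
  assumes \<mu>: "\<mu> \<in> part_families (int n)"
  shows "family_of (pattern_of \<mu>) = \<mu>"
proof (intro ext)
  fix s k
  have "g (SOME t. g t mod int n = g s mod int n) mod int n = g s mod int n" by (rule someI) simp
  then have "\<mu> (SOME t. g t mod int n = g s mod int n) = \<mu> s"
    by (intro part_familiesD(4)[OF \<mu>]) (simp add: g_congruent)
  then show "family_of (pattern_of \<mu>) s k = \<mu> s k" by (simp add: family_of_def pattern_of_def)
qed

lemma pattern_of_family_of:
  assumes d: "agt_pattern n d"
  shows "pattern_of (family_of d) = d"
proof (intro ext)
  fix i j
  show "pattern_of (family_of d) i j = d i j"
  proof (cases "i < j")
    case True then show ?thesis using d by (simp add: pattern_of_def agt_pattern_def)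
  next
    case False
    define t where "t = (SOME t. g t mod int n = j mod int n)"
    have "g t mod int n = j mod int n" unfolding t_def by (rule someI_ex[OF g_covers])
    then obtain m where j: "j = g t + int n * m" by (metis mod_eqE)
    have "pattern_of (family_of d) i j = d (g t + (i - j)) (g t)"
      using False by (simp add: pattern_of_def family_of_def t_def)
    also have "\<dots> = d (g t + (i - j) + int n * m) (g t + int n * m)"
      using agt_shift[OF d] by simp
    also have "g t + (i - j) + int n * m = i" using j by simp
    finally show ?thesis using j by simp
  qed
qed

text \<open>
  Summing along the diagonals \<open>i - j = k\<close>: each is a periodic function of the row, so its sum over
  the rows of one period is the sum over the columns \<open>g s\<close>.
\<close>

lemma sum_row_sums:
  assumes d: "agt_pattern n d"
  shows "(\<Sum>i=1..int n. row_sum d i) = family_size (int n) (family_of d)"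
proof -
  let ?\<mu> = "family_of d" and ?K = "family_size (int n) (family_of d)"
  note \<mu> = family_of_families[OF d]
  have zero: "d i j = 0" if "j \<le> i" "i - j \<ge> int ?K" for i j
  proof -
    have "pattern_of ?\<mu> i j = 0"
      using family_vanishes[OF \<mu>] that by (simp add: pattern_of_def le_nat_iff)
    then show ?thesis by (simp add: pattern_of_family_of[OF d])
  qed
  have row: "row_sum d i = (\<Sum>k<?K. d i (i - int k))" for i
  proof -
    have "row_sum d i = (\<Sum>j\<in>{i - int ?K<..i}. d i j)"
      unfolding row_sum_def
    proof (rule sum.mono_neutral_left)
      show "{j. j \<le> i \<and> d i j \<noteq> 0} \<subseteq> {i - int ?K<..i}"
      proof
        fix j assume "j \<in> {j. j \<le> i \<and> d i j \<noteq> 0}"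
        then show "j \<in> {i - int ?K<..i}" using zero[of j i] by force
      qed
    qed auto
    also have "\<dots> = (\<Sum>k<?K. d i (i - int k))"
      by (rule sum.reindex_bij_witness[of _ "\<lambda>k. i - int k" "\<lambda>j. nat (i - j)"]) auto
    finally show ?thesis .
  qed
  have column: "(\<Sum>i=1..int n. d i (i - int k)) = (\<Sum>s\<in>{0..<int n}. ?\<mu> s k)" for k
  proof -
    define h where "h j = d (j + int k) j" for j
    have per: "h (j + int n) = h j" for j
      using agt_shift[OF d, of "j + int k" 1 j] by (simp add: h_def add_ac)
    have "inj_on (\<lambda>i. (i - int k) mod int n) {1..int n}"
    proof (rule inj_onI)
      fix x y assume xy: "x \<in> {1..int n}" "y \<in> {1..int n}" "(x - int k) mod int n = (y - int k) mod int n"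
      then have "x mod int n = y mod int n" by (simp add: mod_eq_dvd_iff)
      then show "x = y" using inj_onD[OF inj_on_mod_window[of "int n" 1], of x y] xy by auto
    qed
    then have "(\<Sum>i\<in>{1..int n}. h (i - int k)) = (\<Sum>j\<in>{0..<int n}. h j)"
      by (intro sum_periodic_reindex[of "int n" h]) (use n_positive per in auto)
    also have "\<dots> = (\<Sum>s\<in>{0..<int n}. h (g s))"
      by (rule sum_periodic_reindex[of "int n" h, symmetric]) (use n_positive per g_inj in auto)
    finally show ?thesis by (simp add: h_def family_of_def)
  qed
  have "(\<Sum>i=1..int n. row_sum d i) = (\<Sum>k<?K. \<Sum>i=1..int n. d i (i - int k))"
    unfolding row by (rule sum.swap)
  also have "\<dots> = (\<Sum>s\<in>{0..<int n}. \<Sum>k<?K. ?\<mu> s k)"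
    unfolding column by (rule sum.swap)
  also have "\<dots> = ?K"
    unfolding family_size_def[of _ ?\<mu>]
    by (rule sum.cong) (auto intro!: psize_eq[symmetric] family_vanishes[OF \<mu>] simp: family_size_def)
  finally show ?thesis .
qed

text \<open>
  The coordinate \<open>Y\<close> changes by multiples of \<open>p / p'\<close> under translation by multiples of \<open>n\<close>, and its
  values at the \<open>g s\<close> differ by integers.  As \<open>p\<close> and \<open>p'\<close> are coprime, \<open>Y l - Y r\<close> is an integer only if
  \<open>l\<close> and \<open>r\<close> are the same translate of two of the \<open>g s\<close>; then the condition is the separation of
  two rows, and it follows from the one for consecutive rows.
\<close>

lemma permitted_iff_burge:
  fixes Y :: "int \<Rightarrow> complex"
  assumes d: "agt_pattern n d"
    and Y_shift: "\<And>s k. Y (s + int n * k) = Y s - of_int k * (of_nat p / of_nat p')"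
    and Y_g: "\<And>s. Y (g s) = Y 0 - of_int (A s)"
  shows "(\<forall>l r (y::int). l < r \<and> \<not> [l = r] (mod int n) \<and> Y l - Y r = of_int y \<longrightarrow>
        (\<forall>i\<ge>r - 1. int (d i l) \<le> int (d (i + 1) r) + y - 1)) \<longleftrightarrow> burge (family_of d)"
    (is "?L \<longleftrightarrow> ?R")
proof
  assume L: ?L
  show ?R unfolding burge_def
  proof (intro allI impI)
    fix s i assume i: "g (s + 1) - 1 \<le> i"
    have "\<not> [g s = g (s + 1)] (mod int n)"
      using mod_Suc_neq[OF n_ge_2] by (simp add: cong_def g_congruent)
    moreover have "Y (g s) - Y (g (s + 1)) = of_int (A (s + 1) - A s)" by (simp add: Y_g)
    ultimately have "int (d i (g s)) \<le> int (d (i + 1) (g (s + 1))) + (A (s + 1) - A s) - 1"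
      using L i g_step[of s] by blast
    moreover have "family_of d s (nat (i - g s)) = d i (g s)"
      "family_of d (s + 1) (nat (i + 1 - g (s + 1))) = d (i + 1) (g (s + 1))"
      using i g_step[of s] by (simp_all add: family_of_def)
    ultimately show "A s + int (family_of d s (nat (i - g s)))
        < A (s + 1) + int (family_of d (s + 1) (nat (i + 1 - g (s + 1))))" by simp
  qed
next
  assume R: ?R
  show ?L
  proof (intro allI impI)
    fix l r y i
    assume lr: "l < r \<and> \<not> [l = r] (mod int n) \<and> Y l - Y r = of_int y" and i: "r - 1 \<le> i"
    have p': "p' > 0" "p > 0" using N_pos p_pos n_positive by (auto simp: zero_less_mult_iff)
    obtain s k where l: "l = g s + int n * k" using g_covers[of l] by (metis mod_eqE)
    obtain s0 k0 where r0: "r = g s0 + int n * k0" using g_covers[of r] by (metis mod_eqE)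
    have "of_int y = Y l - Y r" using lr by simp
    also have "\<dots> = of_int (A s0 - A s) - of_int (k - k0) * (of_nat p / of_nat p')"
      unfolding l r0 Y_shift Y_g by (simp add: algebra_simps diff_divide_distrib)
    finally have "of_nat p' * (of_int y :: complex) = of_nat p' * of_int (A s0 - A s) - of_int (k - k0) * of_nat p"
      using p' by (simp add: field_simps)
    then have "(of_int (int p' * y) :: complex) = of_int (int p' * (A s0 - A s) - (k - k0) * int p)" by simp
    then have y0: "int p' * y = int p' * (A s0 - A s) - (k - k0) * int p" by (simp only: of_int_eq_iff)
    then have "(k - k0) * int p = int p' * (A s0 - A s - y)" by (simp add: algebra_simps)
    then have "int p' dvd (k - k0) * int p" by simp
    then have "int p' dvd k - k0" using p_coprime by (simp add: coprime_dvd_mult_left_iff coprime_commute)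
    then obtain j where j: "k - k0 = int p' * j" by blast
    \<comment> \<open>Since \<open>g\<close> grows by \<open>n * p'\<close> over a period, the surplus translation is absorbed into the index.\<close>
    define t where "t = s0 - int n * j"
    have gt: "g s0 = g t + int p' * int n * j" and At: "A s0 = A t + int p * j"
      using g_mult[of t j] A_mult[of t j] by (simp_all add: t_def)
    have k: "k = k0 + int p' * j" using j by simp
    have r: "r = g t + int n * k" using r0 gt unfolding k by (simp add: algebra_simps)
    have "int p' * y = int p' * (A t - A s)" using y0 At j by (simp add: algebra_simps)
    then have y: "y = A t - A s" using p' by simp
    have "s < t" using lr l r g_less by simp
    moreover have "i - int n * k + 1 \<ge> g t" using i r by simp
    ultimately have "A s + int (family_of d s (nat (i - int n * k + 1 - 1 - g s)))
        < A t + int (family_of d t (nat (i - int n * k + 1 - g t)))"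
      by (intro burge_chain[OF family_of_families[OF d] R])
    moreover have "family_of d s (nat (i - int n * k + 1 - 1 - g s)) = d i l"
    proof -
      have "g s < g t" using \<open>s < t\<close> g_less by simp
      then have "family_of d s (nat (i - int n * k + 1 - 1 - g s)) = d (i - int n * k) (g s)"
        using i r by (simp add: family_of_def)
      also have "\<dots> = d i l" using agt_shift[OF d, of "i - int n * k" k "g s"] l by simp
      finally show ?thesis .
    qed
    moreover have "family_of d t (nat (i - int n * k + 1 - g t)) = d (i + 1) r"
    proof -
      have "family_of d t (nat (i - int n * k + 1 - g t)) = d (i - int n * k + 1) (g t)"
        using i r by (simp add: family_of_def)
      also have "\<dots> = d (i + 1) r" using agt_shift[OF d, of "i - int n * k + 1" k "g t"] r by (simp add: add_ac)
      finally show ?thesis .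
    qed
    ultimately show "int (d i l) \<le> int (d (i + 1) r) + y - 1" using y by simp
  qed
qed

lemma bij_permitted_burge:
  assumes "\<And>l r. l \<le> r \<Longrightarrow> bform n (alpha_seg n l r) (\<Lambda> + rho n) = Y l - Y r"
    and "\<And>s k. Y (s + int n * k) = Y s - of_int k * (of_nat p / of_nat p')"
    and "\<And>s. Y (g s) = Y 0 - of_int (A s)"
  shows "bij_betw family_of (permitted_patterns n \<Lambda>) {\<mu> \<in> part_families (int n). burge \<mu>}"
proof -
  have perm: "permitted n \<Lambda> d \<longleftrightarrow> burge (family_of d)" if "agt_pattern n d" for d
    unfolding permitted_iff_burge[OF that assms(2,3), symmetric] permitted_def
    using assms(1) by (auto simp: less_imp_le)
  show ?thesis
    by (rule bij_betw_byWitness[where f' = pattern_of])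
      (auto simp: permitted_patterns_def perm pattern_of_family_of family_of_pattern_of
        family_of_families pattern_of_agt)
qed

end

section \<open>The character formula\<close>

lemma qpow_nonzero: "qpow z x \<noteq> 0 \<longleftrightarrow> x = z" by (simp add: qpow_def)

lemma qseries_of_fps_nth: "qseries_of_fps f x = (if x \<in> range of_nat then fps_nth f (THE m. x = of_nat m) else 0)"
proof (cases "x \<in> range of_nat")
  case True
  then obtain m where x: "x = of_nat m" by blast
  have the: "(THE m. x = of_nat m) = m" using x by auto
  have "{k \<in> UNIV. qscale (fps_nth f k) (qpow (of_nat k)) x \<noteq> 0} = (if fps_nth f m = 0 then {} else {m})"
    by (auto simp: qscale_def qpow_def x)
  then show ?thesis using True by (simp add: qseries_of_fps_def qsum_def the) (simp add: qscale_def qpow_def x)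
next
  case False
  then have "{k \<in> UNIV. qscale (fps_nth f k) (qpow (of_nat k)) x \<noteq> 0} = {}"
    by (auto simp: qscale_def qpow_def)
  then show ?thesis using False by (simp add: qseries_of_fps_def qsum_def)
qed

lemma qseries_of_fps_of_nat: "qseries_of_fps f (of_nat m) = fps_nth f m"
  by (simp add: qseries_of_fps_nth)

context burge_patterns
begin

lemma qsum_patterns:
  assumes bij: "bij_betw family_of (permitted_patterns n \<Lambda>) {\<mu> \<in> part_families (int n). burge \<mu>}"
  shows "qsummable (pattern_term n) (permitted_patterns n \<Lambda>)"
    and "qsum (pattern_term n) (permitted_patterns n \<Lambda>) x =
      of_nat (card {\<mu> \<in> part_families (int n). burge \<mu> \<and> of_nat (family_size (int n) \<mu>) = x})"
proof -
  have supp: "{d \<in> permitted_patterns n \<Lambda>. pattern_term n d x \<noteq> 0}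
      = {d \<in> permitted_patterns n \<Lambda>. of_nat (family_size (int n) (family_of d)) = x}" for x
  proof -
    have "pattern_term n d x \<noteq> 0 \<longleftrightarrow> of_nat (family_size (int n) (family_of d)) = x"
      if "d \<in> permitted_patterns n \<Lambda>" for d
    proof -
      have "agt_pattern n d" using that by (simp add: permitted_patterns_def)
      then show ?thesis unfolding pattern_term_def sum_row_sums[OF \<open>agt_pattern n d\<close>] qpow_nonzero by auto
    qed
    then show ?thesis by auto
  qed
  have bij': "bij_betw family_of {d \<in> permitted_patterns n \<Lambda>. pattern_term n d x \<noteq> 0}
      {\<mu> \<in> part_families (int n). burge \<mu> \<and> of_nat (family_size (int n) \<mu>) = x}" for x
    unfolding supp using bij by (auto simp: bij_betw_def inj_on_def image_iff)
  have fin: "finite {\<mu> \<in> part_families (int n). burge \<mu> \<and> of_nat (family_size (int n) \<mu>) = x}" for x :: complex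
  proof (rule finite_subset)
    show "{\<mu> \<in> part_families (int n). burge \<mu> \<and> of_nat (family_size (int n) \<mu>) = x}
        \<subseteq> {\<mu> \<in> part_families (int n). family_size (int n) \<mu> \<le> nat \<lceil>Re x\<rceil>}" by auto
  qed (rule finite_family_size_le)
  show "qsummable (pattern_term n) (permitted_patterns n \<Lambda>)"
    unfolding qsummable_def using bij_betw_finite[OF bij'] fin by blast
  have "qsum (pattern_term n) (permitted_patterns n \<Lambda>) x = (\<Sum>d\<in>{d \<in> permitted_patterns n \<Lambda>. pattern_term n d x \<noteq> 0}. 1)"
    unfolding qsum_def
    by (rule sum.cong) (auto simp: pattern_term_def qpow_def simp del: of_nat_sum split: if_splits)
  then show "qsum (pattern_term n) (permitted_patterns n \<Lambda>) x =
      of_nat (card {\<mu> \<in> part_families (int n). burge \<mu> \<and> of_nat (family_size (int n) \<mu>) = x})"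
    using bij_betw_same_card[OF bij'] by simp
qed

lemma qsum_weyl:
  assumes wt: "\<And>u. u \<in> affine_perms (int n) \<Longrightarrow>
      weyl_term n \<xi> \<eta> (aff_act n u) = qscale (of_int (aperm_sign (int n) u)) (qpow (of_real (energy u)))"
  shows "qsummable (weyl_term n \<xi> \<eta>) (aff_weyl n)"
    and "qsum (weyl_term n \<xi> \<eta>) (aff_weyl n) x =
      (\<Sum>u\<in>{u \<in> affine_perms (int n). of_real (energy u) = x}. of_int (aperm_sign (int n) u))"
proof -
  have n2: "n \<ge> 2" using n_ge_2 by simp
  have nz: "of_int (aperm_sign (int n) u) \<noteq> (0::rat)" for u using aperm_sign_cases[of "int n" u] by auto
  have bij: "bij_betw (aff_act n) {u \<in> affine_perms (int n). of_real (energy u) = x}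
      {w \<in> aff_weyl n. weyl_term n \<xi> \<eta> w x \<noteq> 0}" for x
  proof -
    have "weyl_term n \<xi> \<eta> (aff_act n u) x \<noteq> 0 \<longleftrightarrow> of_real (energy u) = x"
      if "u \<in> affine_perms (int n)" for u
      unfolding wt[OF that] using nz[of u] by (auto simp: qscale_def qpow_def)
    then have "{w \<in> aff_weyl n. weyl_term n \<xi> \<eta> w x \<noteq> 0}
        = aff_act n ` {u \<in> affine_perms (int n). of_real (energy u) = x}"
      unfolding bij_betw_imp_surj_on[OF aff_act_bij[OF n2], symmetric]
      by auto
    then show ?thesis using aff_act_bij[OF n2] by (auto simp: bij_betw_def inj_on_def)
  qed
  have fin: "finite {u \<in> affine_perms (int n). complex_of_real (energy u) = x}" for x
    by (rule finite_subset[OF _ energy_bound_finite[of "Re x"]]) auto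
  show "qsummable (weyl_term n \<xi> \<eta>) (aff_weyl n)"
    unfolding qsummable_def using bij_betw_finite[OF bij] fin by blast
  have "qsum (weyl_term n \<xi> \<eta>) (aff_weyl n) x
      = (\<Sum>u\<in>{u \<in> affine_perms (int n). of_real (energy u) = x}. weyl_term n \<xi> \<eta> (aff_act n u) x)"
    unfolding qsum_def by (rule sum.reindex_bij_betw[OF bij, symmetric])
  also have "\<dots> = (\<Sum>u\<in>{u \<in> affine_perms (int n). of_real (energy u) = x}. of_int (aperm_sign (int n) u))"
    by (rule sum.cong) (auto simp: wt qscale_def qpow_def)
  finally show "qsum (weyl_term n \<xi> \<eta>) (aff_weyl n) x = \<dots>" .
qed

text \<open>
  A configuration is an affine permutation together with an unrestricted family of partitions, so
  the product series counts all configurations with sign.  The exponents are complex: for those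
  that are not real both sides vanish.
\<close>

lemma signed_count_product:
  fixes F G :: qseries
  assumes F: "\<And>m. F (of_nat m) = of_nat (card {\<mu> \<in> part_families (int n). family_size (int n) \<mu> = m})"
    and F0: "\<And>y. y \<notin> range of_nat \<Longrightarrow> F y = 0"
    and G: "\<And>x. G x = (\<Sum>u\<in>{u \<in> affine_perms (int n). of_real (energy u) = x}. of_int (aperm_sign (int n) u))"
  shows "qmultipliable F G"
    and "qmult F G x =
      of_nat (card {\<mu> \<in> part_families (int n). burge \<mu> \<and> of_nat (family_size (int n) \<mu>) = x})"
proof -
  define C where "C x = {c \<in> configs. complex_of_real (weight c) = x}" for x
  define S where "S x = (\<lambda>c. family_size (int n) (snd c)) ` C x" for x
  have C_fin: "finite (C x)" for x
    by (rule finite_subset[OF _ finite_configs_weight[of "Re x"]]) (auto simp: C_def)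
  then have S_fin: "finite (S x)" for x by (simp add: S_def)
  have supp: "{y. F y \<noteq> 0 \<and> G (x - y) \<noteq> 0} \<subseteq> of_nat ` S x" for x
  proof
    fix y assume "y \<in> {y. F y \<noteq> 0 \<and> G (x - y) \<noteq> 0}"
    then have y: "F y \<noteq> 0" "G (x - y) \<noteq> 0" by auto
    then obtain m where m: "y = of_nat m" using F0 by blast
    then have "{\<mu> \<in> part_families (int n). family_size (int n) \<mu> = m} \<noteq> {}" using y(1) F by force
    then obtain \<mu> where \<mu>: "\<mu> \<in> part_families (int n)" "family_size (int n) \<mu> = m" by blast
    have "{u \<in> affine_perms (int n). complex_of_real (energy u) = x - y} \<noteq> {}"
      using y(2) unfolding G by (metis sum.empty)
    then obtain u where u: "u \<in> affine_perms (int n)" "complex_of_real (energy u) = x - y" by blast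
    have "(u, \<mu>) \<in> C x" using u \<mu> m by (simp add: C_def weight_def)
    then show "y \<in> of_nat ` S x" using \<mu>(2) m unfolding S_def by force
  qed
  show "qmultipliable F G"
    unfolding qmultipliable_def using finite_subset[OF supp] S_fin by blast
  have "qmult F G x = (\<Sum>y\<in>of_nat ` S x. F y * G (x - y))"
    unfolding qmult_def by (rule sum.mono_neutral_left) (use S_fin supp in auto)
  also have "\<dots> = (\<Sum>m\<in>S x. F (of_nat m) * G (x - of_nat m))"
    by (subst sum.reindex) (auto simp: inj_on_def)
  also have "\<dots> = (\<Sum>m\<in>S x. \<Sum>c\<in>{c \<in> C x. family_size (int n) (snd c) = m}. of_int (aperm_sign (int n) (fst c)))"
  proof (rule sum.cong)
    fix m
    let ?U = "{u \<in> affine_perms (int n). complex_of_real (energy u) = x - of_nat m}"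
    let ?M = "{\<mu> \<in> part_families (int n). family_size (int n) \<mu> = m}"
    have "complex_of_real (weight c) = x \<longleftrightarrow> complex_of_real (energy (fst c)) = x - of_nat (family_size (int n) (snd c))" for c
      by (auto simp: weight_def)
    then have e: "{c \<in> C x. family_size (int n) (snd c) = m} = ?U \<times> ?M"
      by (auto simp: C_def)
    have prod: "(\<Sum>c\<in>?U \<times> ?M. of_int (aperm_sign (int n) (fst c)) :: rat) = (\<Sum>u\<in>?U. \<Sum>\<mu>\<in>?M. of_int (aperm_sign (int n) u))"
      unfolding sum.cartesian_product by (rule sum.cong) auto
    show "F (of_nat m) * G (x - of_nat m) =
        (\<Sum>c\<in>{c \<in> C x. family_size (int n) (snd c) = m}. of_int (aperm_sign (int n) (fst c)))"
      unfolding e F G prod by (simp add: sum_distrib_left)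
  qed simp
  also have "\<dots> = (\<Sum>c\<in>C x. of_int (aperm_sign (int n) (fst c)))"
    unfolding S_def by (rule sum.image_gen[OF C_fin, symmetric])
  also have "\<dots> = of_int (\<Sum>c\<in>C x. aperm_sign (int n) (fst c))" by simp
  also have "(\<Sum>c\<in>C x. aperm_sign (int n) (fst c))
      = int (card {\<mu> \<in> part_families (int n). burge \<mu> \<and> of_nat (family_size (int n) \<mu>) = x})"
  proof (cases "Im x = 0")
    case True
    then have r: "complex_of_real y = x \<longleftrightarrow> y = Re x" for y by (auto simp: complex_eq_iff)
    have "of_nat m = x \<longleftrightarrow> real m = Re x" for m using r[of "real m"] by simp
    then show ?thesis using signed_config_count[of "Re x"] by (simp only: C_def r)
  next
    case False
    then have "complex_of_real y \<noteq> x" "complex_of_nat m \<noteq> x" for y m by (auto simp: complex_eq_iff)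
    then show ?thesis by (simp add: C_def)
  qed
  finally show "qmult F G x =
      of_nat (card {\<mu> \<in> part_families (int n). burge \<mu> \<and> of_nat (family_size (int n) \<mu>) = x})" by simp
qed

end

theorem proposition4p15:
  fixes n p p' :: nat and a b :: "nat \<Rightarrow> nat" and \<Lambda> \<eta> \<xi> :: avec
  assumes "n \<ge> 3"
    and "admissible_params n p p' a b"
    and "\<Lambda> = Lambda_ab n p p' a b"
    and "admissible n \<Lambda>"
    and "\<eta> = (\<Sum>i<n. smul (of_nat (a i)) (omega n i))"
    and "\<xi> = (\<Sum>i<n. smul (of_nat (b i)) (omega n i))"
  shows "qsummable (pattern_term n) (permitted_patterns n \<Lambda>)
    \<and> qsummable (weyl_term n \<xi> \<eta>) (aff_weyl n)
    \<and> qmultipliable (qseries_of_fps (inverse (qinf ^ n))) (qsum (weyl_term n \<xi> \<eta>) (aff_weyl n))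
    \<and> P_char n \<Lambda> =
        qmult (qpow (- bform n \<Lambda> (rho n)))
          (qmult (qseries_of_fps (inverse (qinf ^ n)))
            (qsum (weyl_term n \<xi> \<eta>) (aff_weyl n)))"
proof -
  have n2: "n \<ge> 2" and n0: "n > 0" using assms(1) by auto
  have par: "p > 0" "p' > 0" "coprime p p'" "int (\<Sum>i<n. a i) = int p - int n"
    "int (\<Sum>i<n. b i) = int p' * int n - int n" "inj_on (\<lambda>s. gseq n b s mod int n) {0..<int n}"
    using assms(2) by (auto simp: admissible_params_def)
  have cyl: "cylinder (int n) (int p' * int n) (int p) (gseq n b) (gseq n a)"
  proof
    show "int n \<ge> 2" using n2 by simp
    show "int p' * int n > 0" using par(2) n0 by simp
    show "int p > 0" using par(1) by simp
    show "gseq n b (s + int n) = gseq n b s + int p' * int n" for s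
      using gseq_period[OF n0, of b s] par(5) by simp
    show "gseq n a (s + int n) = gseq n a s + int p" for s
      using gseq_period[OF n0, of a s] par(4) by simp
  qed (simp_all add: gseq_step)
  interpret burge_patterns n p p' "gseq n b" "gseq n a"
    unfolding burge_patterns_def burge_patterns_axioms_def using cyl par by blast
  let ?Y = "coord n (\<Lambda> + rho n)"
  note Lc = Lambda_coords[OF n2 assms(2,3)]
  have bij: "bij_betw family_of (permitted_patterns n \<Lambda>) {\<mu> \<in> part_families (int n). burge \<mu>}"
  proof (rule bij_permitted_burge[of \<Lambda> ?Y])
    show "bform n (alpha_seg n l r) (\<Lambda> + rho n) = ?Y l - ?Y r" if "l \<le> r" for l r
      by (rule bform_alpha_seg[OF n0 that])
  qed (use Lc coord_mult[OF n0] in auto)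
  have lev_b: "(\<Sum>i<n. b i) + n = p' * n" using par(5) by (simp add: of_nat_eq_iff[symmetric, where 'a = int] del: of_nat_eq_iff)
  have lev_a: "(\<Sum>i<n. a i) + n = p" using par(4) by linarith
  have wt: "weyl_term n \<xi> \<eta> (aff_act n u) = qscale (of_int (aperm_sign (int n) u)) (qpow (of_real (energy u)))"
    if u: "u \<in> affine_perms (int n)" for u
  proof -
    have "bform n (\<xi> + rho n - aff_act n u (\<xi> + rho n)) (\<eta> + rho n) = of_real (energy u)"
    proof (rule energy_bform[OF n2 cyl u])
      show "coord n (\<xi> + rho n) s = coord n (\<xi> + rho n) 0 - of_int (gseq n b s)" for s
        unfolding assms(6) by (rule coord_dominant_vector[OF n2])
      show "coord n (\<eta> + rho n) s = coord n (\<eta> + rho n) 0 - of_int (gseq n a s)" for s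
        unfolding assms(5) by (rule coord_dominant_vector[OF n2])
      show "bform n (\<xi> + rho n) delta = of_int (int p' * int n)"
        unfolding assms(6) dominant_vector_props(2)[OF n2] lev_b by simp
      show "bform n (\<eta> + rho n) delta = of_int (int p)"
        unfolding assms(5) dominant_vector_props(2)[OF n2] lev_a by simp
    qed
    moreover have "(- 1 :: rat) ^ weyl_length n (aff_act n u) = of_int (aperm_sign (int n) u)"
      unfolding weyl_length_sign[OF n2 u, symmetric] by simp
    ultimately show ?thesis by (simp add: weyl_term_def)
  qed
  let ?F = "qseries_of_fps (inverse (qinf ^ n))" and ?G = "qsum (weyl_term n \<xi> \<eta>) (aff_weyl n)"
  have F: "?F (of_nat m) = of_nat (card {\<mu> \<in> part_families (int n). family_size (int n) \<mu> = m})" for m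
    using card_part_families(2)[OF n0, of m] by (simp add: qseries_of_fps_of_nat inverse_qinf_power)
  have F0: "?F y = 0" if "y \<notin> range of_nat" for y using that by (simp add: qseries_of_fps_nth)
  have G: "?G x = (\<Sum>u\<in>{u \<in> affine_perms (int n). of_real (energy u) = x}. of_int (aperm_sign (int n) u))" for x
    by (rule qsum_weyl(2)) (rule wt)
  have mult: "qmultipliable ?F ?G"
    by (rule signed_count_product(1)) (use F F0 G in auto)
  have prod: "qmult ?F ?G x =
      of_nat (card {\<mu> \<in> part_families (int n). burge \<mu> \<and> of_nat (family_size (int n) \<mu>) = x})" for x
    by (rule signed_count_product(2)) (use F F0 G in auto)
  have "qsum (pattern_term n) (permitted_patterns n \<Lambda>) = qmult ?F ?G"
    by (rule ext) (simp only: qsum_patterns(2)[OF bij] prod)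
  then show ?thesis
    using qsum_patterns(1)[OF bij] qsum_weyl(1)[OF wt] mult by (simp add: P_char_def)
qed

end
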